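(* Let $\nu\in\mathcal{P}_2(\mathbb{R}^2)$. An optimal plan for the problem of minimizing $\int c(x,y)\,d\gamma$ over $\gamma\in\Gamma(\nu)$ exists. Moreover, for $\gamma\in\Gamma(\nu)$ the following conditions are equivalent: (a) $\gamma$ is an optimal plan, i.e. $\int c\,d\gamma=\min_{\zeta\in\Gamma(\nu)}\int c\,d\zeta$; (b) whenever $(x^0,y^0)$ and $(x^1,y^1)$ belong to $\operatorname{supp}\gamma$, $$(1-t)c(x^0,y^0)+t\,c(x^1,y^1)\le t(1-t)\,c(y^0,y^1),\qquad t\in[0,1];$$ (c) there is $G\in\mathfrak{M}$ such that $c(x,y)\le\phi_G(y)$ for all $(x,y)\in\operatorname{supp}\gamma$. Finally, if $G$ is a maximal monotone set satisfying the inequality in (c) and $\mu(dx)=\gamma(dx,\mathbb{R}^2)$ is the $x$-marginal of $\gamma$, then $G\supset\operatorname{supp}\mu$ and $$c(x,y)=\phi_G(y)=\min_{z\in G}c(z,y),\qquad (x,y)\in\operatorname{supp}\gamma.$$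
   Context: For $x=(x_1,x_2),y=(y_1,y_2)\in\mathbb{R}^2$ let $c(x,y)=(x_1-y_1)(x_2-y_2)$. $\mathcal{P}_2(\mathbb{R}^d)$ denotes the Borel probability measures on $\mathbb{R}^d$ with finite second moment. Points of $\mathbb{R}^2\times\mathbb{R}^2$ are written $(x,y)$. For $\nu\in\mathcal{P}_2(\mathbb{R}^2)$, $\Gamma(\nu)$ is the set of $\gamma\in\mathcal{P}_2(\mathbb{R}^2\times\mathbb{R}^2)$ whose $y$-marginal is $\nu$ and which satisfy the martingale property $\gamma(y|x)=x$, i.e. the conditional expectation under $\gamma$ of the coordinate $y$ given the coordinate $x$ equals $x$, $\gamma$-a.s. $\operatorname{supp}$ denotes the support (smallest closed set of full measure). A set $G\subset\mathbb{R}^2$ is monotone if $c(r,s)\ge0$ for all $r,s\in G$; it is maximal monotone if it is not a proper subset of another monotone set; $\mathfrak{M}$ is the family of maximal monotone sets in $\mathbb{R}^2$. For $G\in\mathfrak{M}$, $\phi_G(y)=\inf_{x\in G}c(x,y)$, $y\in\mathbb{R}^2$. *)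

theory Defs
  imports "HOL-Probability.Probability" "HOL-Probability.Conditional_Expectation"
begin

type_synonym pt = "real \<times> real"

definition cst :: "pt \<Rightarrow> pt \<Rightarrow> real" where
  "cst x y = (fst x - fst y) * (snd x - snd y)"

definition P2 :: "'a::euclidean_space measure \<Rightarrow> bool" where
  "P2 M \<longleftrightarrow> prob_space M \<and> sets M = sets borel \<and> integrable M (\<lambda>z. (norm z)^2)"

definition msupp :: "'a::topological_space measure \<Rightarrow> 'a set" where
  "msupp M = \<Inter>{C. closed C \<and> emeasure M (space M - C) = 0}"

text \<open>Martingale plans with y-marginal nu: gamma on R^2 x R^2, points (x,y);
  E[y | x] = x gamma-a.s. (componentwise, conditional expectation w.r.t. sigma(x)).\<close>
definition Gamma :: "pt measure \<Rightarrow> (pt \<times> pt) measure set" where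
  "Gamma \<nu> = {\<gamma>. P2 \<gamma> \<and> distr \<gamma> borel snd = \<nu> \<and>
     (AE z in \<gamma>. real_cond_exp \<gamma> (vimage_algebra (space \<gamma>) fst borel) (\<lambda>z. fst (snd z)) z = fst (fst z)) \<and>
     (AE z in \<gamma>. real_cond_exp \<gamma> (vimage_algebra (space \<gamma>) fst borel) (\<lambda>z. snd (snd z)) z = snd (fst z))}"

definition total_cost :: "(pt \<times> pt) measure \<Rightarrow> real" where
  "total_cost \<gamma> = integral\<^sup>L \<gamma> (\<lambda>z. cst (fst z) (snd z))"

definition optimal_plan :: "pt measure \<Rightarrow> (pt \<times> pt) measure \<Rightarrow> bool" where
  "optimal_plan \<nu> \<gamma> \<longleftrightarrow> \<gamma> \<in> Gamma \<nu> \<and> (\<forall>\<zeta>\<in>Gamma \<nu>. total_cost \<gamma> \<le> total_cost \<zeta>)"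

definition monotone_set :: "pt set \<Rightarrow> bool" where
  "monotone_set G \<longleftrightarrow> (\<forall>r\<in>G. \<forall>s\<in>G. cst r s \<ge> 0)"

definition maximal_monotone :: "pt set \<Rightarrow> bool" where
  "maximal_monotone G \<longleftrightarrow> monotone_set G \<and> (\<forall>H. monotone_set H \<and> G \<subseteq> H \<longrightarrow> H = G)"

definition phi :: "pt set \<Rightarrow> pt \<Rightarrow> ereal" where
  "phi G y = (INF x\<in>G. ereal (cst x y))"

end

theory Submission
  imports Defs
begin

text \<open>
  In the coordinates \<open>u = x\<^sub>1 + x\<^sub>2\<close>, \<open>v = x\<^sub>1 - x\<^sub>2\<close> one has \<open>4 c = du\<^sup>2 - dv\<^sup>2\<close>, so maximal monotone sets
  are exactly the graphs \<open>v = f u\<close> of 1-Lipschitz functions.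

  Existence: by the martingale property the cost of a plan is a constant minus \<open>\<integral>x\<^sub>1 x\<^sub>2 d\<gamma>\<close>, and along
  a maximizing sequence \<open>|x|\<^sup>2\<close> is uniformly integrable by Jensen's inequality. Tight sequences have weak
  limit points because a space-filling curve with a Borel section reduces this to Helly's theorem on the line.

  (a) implies (b): from an optimal plan remove a small amount of mass near the two points of the support,
  transport it to its barycentre, and move the rest to its new conditional means; the first-order change
  of the cost gives the inequality.

  (b) implies (c): with \<open>(U, V)\<close> the coordinates of \<open>y\<close>, the inequality \<open>c(x, y) \<le> c(z, y)\<close> on the graph says
  \<open>|f u - V| \<le> sqrt ((u - U)\<^sup>2 - 4 c(x, y))\<close>. The upper and lower bounds are 1-Lipschitz in \<open>u\<close>, and (b) says
  exactly that every lower bound lies below every upper bound; \<open>f\<close> is the supremum of the lower bounds.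

  (c) implies (a): moving \<open>x\<close> along the antidiagonal to the point \<open>p x\<close> of \<open>G\<close> with the same \<open>u\<close>,
  the martingale property gives \<open>\<integral>c(p x, y) = \<integral>c(x, y) + \<integral>c(p x, x)\<close>, where \<open>c(p x, x) \<le> 0\<close> vanishes only on \<open>G\<close>.
  Hence \<open>\<integral>\<phi> d\<nu>\<close> bounds all costs from below, and equality forces \<open>x \<in> G\<close>.
\<close>

section \<open>Weak compactness of tight sequences\<close>

text \<open>The y-marginal is fixed but the x-marginal is free, and x1 x2 grows as fast as the only
  moment at hand. A uniform bound on second moments alone would allow mass to escape to infinity and
  carry cost with it; what prevents this is that the tails in x are dominated by those of the single
  law \<open>\<nu>\<close>. The martingale identity grows only linearly, so for it the moment bound
  suffices.

  A perturbation has to keep both the y-marginal and the martingale property. So y is never moved: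
  the mass at each (x, y) is split by a coin of bias \<open>\<epsilon> * h\<close>, and only x is
  reassigned on each part. The part that stays is no longer centred at x and must be recentred, by a
  shift of order \<open>\<epsilon>\<close>. This contributes the derivative of x1 x2 to first order,
  and that is how c(x, y) enters (b): x1 x2 plus its derivative in direction y - x is y1 y2 - c(x,
  y).

  In the duality argument \<open>phi\<close> may take the value minus infinity; its finiteness
  almost everywhere is extracted from the given plan and handed to the competitors through the
  common marginal.\<close>

definition triangle_wave :: "real \<Rightarrow> real" where
  "triangle_wave t = arccos (cos (pi * t)) / pi"

lemma triangle_wave_id: "0 \<le> t \<Longrightarrow> t \<le> 1 \<Longrightarrow> triangle_wave t = t"
  by (simp add: triangle_wave_def arccos_cos mult_left_le)

lemma triangle_wave_periodic: "triangle_wave (2 * of_nat n + t) = triangle_wave t"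
proof (induction n)
  case (Suc n)
  have "cos (pi * (2 * of_nat (Suc n) + t)) = cos (pi * (2 * of_nat n + t) + 2 * pi)"
    by (simp add: algebra_simps)
  then show ?case using Suc by (simp add: triangle_wave_def)
qed simp

lemma continuous_triangle_wave: "continuous_on UNIV triangle_wave"
  unfolding triangle_wave_def by (intro continuous_intros) auto

text \<open>Schoenberg's function: 0 on the first third of \<open>{0..1}\<close>, 1 on the last
  third, linear between, even and of period 2. The slope sits in the middle third, whose interior
  the Cantor set avoids.\<close>

definition plateau_wave :: "real \<Rightarrow> real" where
  "plateau_wave t = max 0 (min 1 (3 * triangle_wave t - 1))"

lemma plateau_wave_range: "0 \<le> plateau_wave t" "plateau_wave t \<le> 1"
  by (auto simp: plateau_wave_def)

lemma continuous_plateau_wave: "continuous_on UNIV plateau_wave"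
  unfolding plateau_wave_def by (intro continuous_intros continuous_triangle_wave)

lemma plateau_wave_periodic: "plateau_wave (2 * of_nat n + t) = plateau_wave t"
  by (simp add: plateau_wave_def triangle_wave_periodic)

text \<open>Coordinate \<open>j\<close> of Schoenberg's space-filling curve in dimension
  \<open>d\<close>: at a point of the Cantor set, the ternary place \<open>d * k + j\<close>
  supplies the binary digit \<open>k\<close> of this coordinate.\<close>

definition schoenberg :: "nat \<Rightarrow> nat \<Rightarrow> real \<Rightarrow> real" where
  "schoenberg d j t = (\<Sum>k. plateau_wave (3 ^ (d * k + j) * t) * (1/2) ^ Suc k)"

lemma summable_half_power: "summable (\<lambda>k. (1/2::real) ^ Suc k)"
  by (simp add: summable_geometric)

lemma continuous_schoenberg: "continuous_on UNIV (schoenberg d j)"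
proof -
  have "uniform_limit UNIV (\<lambda>n t. \<Sum>k<n. plateau_wave (3 ^ (d * k + j) * t) * (1/2) ^ Suc k)
      (\<lambda>t. \<Sum>k. plateau_wave (3 ^ (d * k + j) * t) * (1/2) ^ Suc k) sequentially"
  proof (rule Weierstrass_m_test[OF _ summable_half_power])
    fix k and t :: real
    show "norm (plateau_wave (3 ^ (d * k + j) * t) * (1/2) ^ Suc k) \<le> (1/2) ^ Suc k"
      using plateau_wave_range[of "3 ^ (d * k + j) * t"]
      by (simp add: abs_mult mult_left_le_one_le)
  qed
  then show ?thesis
    unfolding schoenberg_def[abs_def]
    by (rule uniform_limit_theorem[rotated])
       (auto intro!: always_eventually continuous_intros continuous_on_compose2[OF continuous_plateau_wave])
qed

text \<open>The point of the Cantor set with ternary digits \<open>2 * b m\<close>.\<close>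

definition cantor_point :: "(nat \<Rightarrow> real) \<Rightarrow> real" where
  "cantor_point b = (\<Sum>m. 2 * b m * (1/3) ^ Suc m)"

lemma cantor_point_summable:
  assumes "\<And>m. b m \<in> {0, 1}"
  shows "summable (\<lambda>m. 2 * b m * (1/3::real) ^ Suc m)"
proof (rule summable_comparison_test')
  show "summable (\<lambda>m. 2 * (1/3::real) ^ Suc m)"
    by (simp add: summable_geometric)
  show "norm (2 * b m * (1/3) ^ Suc m) \<le> 2 * (1/3::real) ^ Suc m" for m
    using assms[of m] by auto
qed

lemma cantor_point_range:
  assumes "\<And>m. b m \<in> {0, 1}"
  shows "0 \<le> cantor_point b" "cantor_point b \<le> 1"
proof -
  have b: "0 \<le> b m" "b m \<le> 1" for m using assms[of m] by auto
  show "0 \<le> cantor_point b"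
    unfolding cantor_point_def by (rule suminf_nonneg[OF cantor_point_summable[OF assms]]) (use b in auto)
  have "(\<lambda>m. (2/3) * (1/3::real) ^ m) sums ((2/3) * (1 / (1 - 1/3)))"
    by (intro sums_mult geometric_sums) auto
  then have s: "(\<lambda>m. 2 * (1/3::real) ^ Suc m) sums 1" by simp
  have "cantor_point b \<le> (\<Sum>m. 2 * (1/3::real) ^ Suc m)"
    unfolding cantor_point_def
    by (rule suminf_le[OF _ cantor_point_summable[OF assms] sums_summable[OF s]]) (use b in auto)
  then show "cantor_point b \<le> 1" using sums_unique[OF s] by simp
qed

lemma cantor_point_shift:
  assumes "\<And>m. b m \<in> {0, 1}"
  shows "3 * cantor_point b = 2 * b 0 + cantor_point (\<lambda>m. b (Suc m))"
proof -
  have "cantor_point b = 2 * b 0 * (1/3) + (\<Sum>m. (1/3) * (2 * b (Suc m) * (1/3) ^ Suc m))"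
    unfolding cantor_point_def
    using suminf_split_head[OF cantor_point_summable[of b, OF assms]] by (simp add: mult_ac)
  also have "(\<Sum>m. (1/3) * (2 * b (Suc m) * (1/3) ^ Suc m)) = (1/3) * cantor_point (\<lambda>m. b (Suc m))"
    unfolding cantor_point_def using cantor_point_summable[of "\<lambda>m. b (Suc m)"] assms
    by (intro suminf_mult) auto
  finally show ?thesis by simp
qed

text \<open>Multiplying by \<open>3 ^ m\<close> moves \<open>m\<close> ternary digits in front of
  the point. All digits are even, so the integer part is even and disappears by periodicity. What is
  left begins with the digit \<open>2 * b m\<close>, hence lies in the first or the last third,
  where the wave is constant.\<close>

lemma plateau_wave_cantor_point:
  assumes "\<And>m. b m \<in> {0, 1}"
  shows "plateau_wave (3 ^ m * cantor_point b) = b m"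
  using assms
proof (induction m arbitrary: b)
  case 0
  have t: "triangle_wave (cantor_point b) = cantor_point b"
    using cantor_point_range[of b] 0 by (intro triangle_wave_id) auto
  show ?case
    using cantor_point_shift[of b, OF 0] cantor_point_range[of "\<lambda>m. b (Suc m)", OF 0] 0[of 0]
    unfolding plateau_wave_def by (auto simp: t)
next
  case (Suc m)
  obtain n :: nat where n: "b 0 = of_nat n" using Suc.prems[of 0] by (auto intro: that[of 0] that[of 1])
  have "3 ^ Suc m * cantor_point b = 3 ^ m * (3 * cantor_point b)" by simp
  also have "\<dots> = 2 * of_nat (3 ^ m * n) + 3 ^ m * cantor_point (\<lambda>m. b (Suc m))"
    unfolding cantor_point_shift[OF Suc.prems] n by (simp add: algebra_simps)
  finally show ?case
    using Suc.IH[of "\<lambda>m. b (Suc m)"] Suc.prems by (simp only: plateau_wave_periodic)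
qed

lemma binary_digits:
  fixes y :: real
  assumes "0 \<le> y" "y < 1"
  obtains a :: "nat \<Rightarrow> real" where "\<And>k. a k \<in> {0, 1}" "(\<lambda>k. a k * (1/2) ^ Suc k) sums y"
proof -
  \<comment> \<open>\<open>e k\<close> is \<open>y\<close> cut off after \<open>k\<close> binary
    places. The digits are the increments of these truncations, so their series telescopes to
    \<open>y - e 0\<close>, and \<open>y < 1\<close> makes \<open>e 0\<close> vanish.\<close>
  define e where "e k = of_int \<lfloor>2 ^ k * y\<rfloor> / (2::real) ^ k" for k
  define a where "a k = real_of_int (\<lfloor>2 * (2 ^ k * y)\<rfloor> - 2 * \<lfloor>2 ^ k * y\<rfloor>)" for k
  have "e \<longlonglongrightarrow> y"
  proof (rule tendsto_sandwich)
    show "\<forall>\<^sub>F k in sequentially. y - (1/2) ^ k \<le> e k"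
    proof (intro always_eventually allI)
      fix k
      have "2 ^ k * y \<le> of_int \<lfloor>2 ^ k * y\<rfloor> + 1" by linarith
      then have "(2 ^ k * y - 1) / 2 ^ k \<le> e k"
        unfolding e_def by (intro divide_right_mono) auto
      then show "y - (1/2) ^ k \<le> e k" by (simp add: diff_divide_distrib power_one_over)
    qed
    show "\<forall>\<^sub>F k in sequentially. e k \<le> y"
      by (intro always_eventually) (auto simp: e_def field_simps)
    have "(\<lambda>k. y - (1/2) ^ k) \<longlonglongrightarrow> y - 0"
      by (intro tendsto_intros LIMSEQ_power_zero) auto
    then show "(\<lambda>k. y - (1/2) ^ k) \<longlonglongrightarrow> y" by simp
  qed auto
  then have "(\<lambda>k. e (Suc k) - e k) sums (y - e 0)" by (rule telescope_sums)
  moreover have "e 0 = 0" using assms by (simp add: e_def floor_eq_iff)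
  moreover have "e (Suc k) - e k = a k * (1/2) ^ Suc k" for k
    by (simp add: e_def a_def field_simps)
  ultimately have "(\<lambda>k. a k * (1/2) ^ Suc k) sums y" by simp
  moreover have "a k \<in> {0, 1}" for k
  proof -
    have "\<lfloor>2 * (2 ^ k * y)\<rfloor> - 2 * \<lfloor>2 ^ k * y\<rfloor> \<in> {0, 1}" by (simp, linarith)
    then show ?thesis by (auto simp: a_def)
  qed
  ultimately show ?thesis using that by blast
qed

lemma schoenberg_onto:
  assumes "\<And>j. j < d \<Longrightarrow> 0 \<le> y j \<and> y j < 1"
  obtains t where "0 \<le> t" "t \<le> 1" "\<And>j. j < d \<Longrightarrow> schoenberg d j t = y j"
proof -
  have "\<exists>a. (\<forall>k::nat. a k \<in> {0, 1::real}) \<and> (\<lambda>k. a k * (1/2) ^ Suc k) sums y j" if "j < d" for j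
  proof -
    have "0 \<le> y j" "y j < 1" using assms[OF that] by auto
    then obtain a :: "nat \<Rightarrow> real" where "\<And>k. a k \<in> {0, 1}" "(\<lambda>k. a k * (1/2) ^ Suc k) sums y j"
      by (rule binary_digits) blast
    then show ?thesis by blast
  qed
  then obtain a where a: "\<And>j k. j < d \<Longrightarrow> a j k \<in> {0, 1::real}"
      "\<And>j. j < d \<Longrightarrow> (\<lambda>k. a j k * (1/2) ^ Suc k) sums y j"
    by metis
  \<comment> \<open>Interleaving: place \<open>m\<close> belongs to coordinate
    \<open>m mod d\<close>. The value for \<open>d = 0\<close> only ensures that every
    \<open>b m\<close> is a digit.\<close>
  define b where "b m = (if d = 0 then 0 else a (m mod d) (m div d))" for m
  have b: "b m \<in> {0, 1}" for m using a(1)[of "m mod d" "m div d"] by (auto simp: b_def)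
  show ?thesis
  proof
    show "0 \<le> cantor_point b" "cantor_point b \<le> 1" using cantor_point_range[of b] b by auto
    fix j assume j: "j < d"
    have "b (d * k + j) = a j k" for k using j by (simp add: b_def)
    then show "schoenberg d j (cantor_point b) = y j"
      unfolding schoenberg_def plateau_wave_cantor_point[of b, OF b]
      using a(2)[OF j] by (simp add: sums_iff)
  qed
qed

text \<open>The factor \<open>t - triangle_wave t\<close> is constant \<open>2 * N\<close> on \<open>{2 * N..2 * N + 1}\<close>, where by
  periodicity Schoenberg's curve runs through the whole unit cube.\<close>

lemma space_filling_curve:
  obtains g :: "real \<Rightarrow> 'a::euclidean_space" where
    "continuous_on UNIV g"
    "\<And>x N. norm x < real N \<Longrightarrow> \<exists>t\<in>{0..2 * real N + 1}. g t = x"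
proof -
  define d where "d = DIM('a)"
  obtain e :: "nat \<Rightarrow> 'a" where e: "bij_betw e {..<d} Basis"
    using ex_bij_betw_nat_finite[of "Basis :: 'a set"] by (auto simp: d_def atLeast0LessThan)
  \<comment> \<open>Subtracting 1/2 centres the cube at 0; scaled by \<open>2 * N\<close> it has
    half side \<open>N\<close> and contains the open ball of radius \<open>N\<close>. The explicit
    time bound is what later turns tightness in space into tightness in time.\<close>
  define g where "g t = (\<Sum>j<d. ((t - triangle_wave t) * (schoenberg d j t - 1/2)) *\<^sub>R e j)" for t
  have "continuous_on UNIV g"
    unfolding g_def by (intro continuous_intros continuous_triangle_wave continuous_schoenberg)
  moreover have "\<exists>t\<in>{0..2 * real N + 1}. g t = x" if N: "norm x < real N" for x N
  proof -
    have N0: "real N > 0" using N norm_ge_zero[of x] by linarith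
    have "0 \<le> (x \<bullet> e j) / (2 * real N) + 1/2 \<and> (x \<bullet> e j) / (2 * real N) + 1/2 < 1" if "j < d" for j
    proof -
      have "e j \<in> Basis" using e that by (auto simp: bij_betw_def)
      then have "\<bar>x \<bullet> e j\<bar> < real N" using Basis_le_norm[of "e j" x] N by linarith
      then show ?thesis using N0 by (auto simp: field_simps abs_less_iff)
    qed
    then obtain t where t: "0 \<le> t" "t \<le> 1"
      "\<And>j. j < d \<Longrightarrow> schoenberg d j t = (x \<bullet> e j) / (2 * real N) + 1/2"
      by (rule schoenberg_onto[of d "\<lambda>j. (x \<bullet> e j) / (2 * real N) + 1/2"]) auto
    have s: "schoenberg d j (2 * real N + t) = schoenberg d j t" for j
    proof -
      have "plateau_wave (3 ^ (d * k + j) * (2 * real N + t)) = plateau_wave (3 ^ (d * k + j) * t)" for k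
        using plateau_wave_periodic[of "3 ^ (d * k + j) * N" "3 ^ (d * k + j) * t"]
        by (simp add: algebra_simps)
      then show ?thesis by (simp add: schoenberg_def)
    qed
    have "g (2 * real N + t) = (\<Sum>j<d. (x \<bullet> e j) *\<^sub>R e j)"
      unfolding g_def using t N0
      by (intro sum.cong) (auto simp: s triangle_wave_periodic triangle_wave_id)
    also have "\<dots> = (\<Sum>b\<in>Basis. (x \<bullet> b) *\<^sub>R b)"
      using sum.reindex_bij_betw[OF e, of "\<lambda>b. (x \<bullet> b) *\<^sub>R b"] .
    finally have "g (2 * real N + t) = x" by (simp add: euclidean_representation)
    then show ?thesis using t N0 by (intro bexI[of _ "2 * real N + t"]) auto
  qed
  ultimately show ?thesis using that by blast
qed

section \<open>First hitting times of a curve, and selection of weak limits\<close>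

lemma Inf_preimage_in:
  fixes g :: "real \<Rightarrow> 'a::t2_space"
  assumes g: "continuous_on UNIV g" and ex: "\<exists>t\<ge>0. g t = x"
  shows "0 \<le> Inf {t. 0 \<le> t \<and> g t = x}" "g (Inf {t. 0 \<le> t \<and> g t = x}) = x"
proof -
  have "{t. 0 \<le> t \<and> g t = x} = {0..} \<inter> g -` {x}" by auto
  moreover have "closed (g -` {x})"
    using g by (intro closed_vimage) auto
  ultimately have "closed {t. 0 \<le> t \<and> g t = x}" by (simp add: closed_Int)
  then have "Inf {t. 0 \<le> t \<and> g t = x} \<in> {t. 0 \<le> t \<and> g t = x}"
    using ex by (intro closed_contains_Inf) (auto intro: bdd_belowI[of _ 0])
  then show "0 \<le> Inf {t. 0 \<le> t \<and> g t = x}" "g (Inf {t. 0 \<le> t \<and> g t = x}) = x" by auto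
qed

lemma borel_section:
  fixes g :: "real \<Rightarrow> 'a::{t2_space}"
  assumes g: "continuous_on UNIV g" and ex: "\<And>x. \<exists>t\<ge>0. g t = x"
  shows "(\<lambda>x. Inf {t. 0 \<le> t \<and> g t = x}) \<in> borel_measurable borel"
proof (rule borel_measurableI_le)
  fix a
  have "{x \<in> space borel. Inf {t. 0 \<le> t \<and> g t = x} \<le> a} = g ` {0..a}"
  proof (intro set_eqI iffI)
    fix x assume "x \<in> {x \<in> space borel. Inf {t. 0 \<le> t \<and> g t = x} \<le> a}"
    then show "x \<in> g ` {0..a}"
      using Inf_preimage_in[OF g ex, of x]
      by (intro image_eqI[of _ _ "Inf {t. 0 \<le> t \<and> g t = x}"]) auto
  next
    fix x assume "x \<in> g ` {0..a}"
    then obtain t where t: "0 \<le> t" "t \<le> a" "g t = x" by auto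
    then have "Inf {t. 0 \<le> t \<and> g t = x} \<le> t"
      by (intro cInf_lower) (auto intro: bdd_belowI[of _ 0])
    then show "x \<in> {x \<in> space borel. Inf {t. 0 \<le> t \<and> g t = x} \<le> a}" using t by simp
  qed
  moreover have "compact (g ` {0..a})"
    using g by (intro compact_continuous_image) (auto intro: continuous_on_subset)
  ultimately show "{x \<in> space borel. Inf {t. 0 \<le> t \<and> g t = x} \<le> a} \<in> sets borel"
    by (simp add: compact_imp_closed)
qed

text \<open>The measures are pushed to the line by the section \<open>s\<close>, a Helly limit is
  taken there and pushed back by the curve \<open>g\<close>. The section is merely Borel, but since
  \<open>g (s x) = x\<close> the functions tested on the line are \<open>f (g t)\<close>, which are
  continuous.\<close>

theorem tight_imp_weakly_convergent_subsequence:
  fixes \<mu> :: "nat \<Rightarrow> 'a::euclidean_space measure"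
  assumes prob: "\<And>n. prob_space (\<mu> n)" and sets: "\<And>n. sets (\<mu> n) = sets borel"
    and tight: "\<And>\<epsilon>. \<epsilon> > 0 \<Longrightarrow> \<exists>R. \<forall>n. measure (\<mu> n) {x. norm x \<ge> R} < \<epsilon>"
  obtains r M where "strict_mono (r :: nat \<Rightarrow> nat)" "prob_space M" "sets M = sets borel"
    "\<And>f :: 'a \<Rightarrow> real. continuous_on UNIV f \<Longrightarrow> bounded (range f) \<Longrightarrow>
       (\<lambda>n. integral\<^sup>L (\<mu> (r n)) f) \<longlonglongrightarrow> integral\<^sup>L M f"
proof -
  obtain g :: "real \<Rightarrow> 'a" where g: "continuous_on UNIV g"
    "\<And>x N. norm x < real N \<Longrightarrow> \<exists>t\<in>{0..2 * real N + 1}. g t = x"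
    using space_filling_curve by blast
  have ex: "\<exists>t\<ge>0. g t = x" for x
  proof -
    obtain N where "norm x < real N" using reals_Archimedean2 by blast
    from g(2)[OF this] show ?thesis by auto
  qed
  define s where "s x = Inf {t. 0 \<le> t \<and> g t = x}" for x
  have s_meas [measurable]: "s \<in> borel_measurable borel"
    unfolding s_def[abs_def] by (rule borel_section[OF g(1) ex])
  have s: "0 \<le> s x" "g (s x) = x" for x
    using Inf_preimage_in[OF g(1) ex, of x] by (auto simp: s_def)
  have s_le: "s x \<le> 2 * real N + 1" if N: "norm x < real N" for x N
  proof -
    obtain t where "t \<in> {0..2 * real N + 1}" "g t = x" using g(2)[OF N] by auto
    then show ?thesis
      unfolding s_def by (intro cInf_lower2[of t]) (auto intro: bdd_belowI[of _ 0])
  qed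
  have g_meas [measurable]: "g \<in> borel_measurable borel"
    using g(1) by (rule borel_measurable_continuous_onI)
  have m [measurable_cong]: "sets (\<mu> n) = sets borel" for n by (rule sets)
  define \<nu> where "\<nu> n = distr (\<mu> n) borel s" for n
  have sm: "s \<in> measurable (\<mu> n) borel" for n by measurable
  have rd: "real_distribution (\<nu> n)" for n
    unfolding \<nu>_def real_distribution_def real_distribution_axioms_def
    using prob_space.prob_space_distr[OF prob sm] by simp
  have "Helly_Selection.tight \<nu>"
    unfolding Helly_Selection.tight_def
  proof (intro conjI allI impI rd)
    fix \<epsilon> :: real assume "\<epsilon> > 0"
    then obtain R where R: "\<And>n. measure (\<mu> n) {x. norm x \<ge> R} < \<epsilon>" using tight by blast
    obtain N where N: "R < real N" using reals_Archimedean2 by blast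
    \<comment> \<open>The intervals in the definition of tightness are open on the left, and
      \<open>s\<close> may take the value 0; hence the endpoint -1.\<close>
    have "1 - \<epsilon> < measure (\<nu> n) {-1<..2 * real N + 1}" for n
    proof -
      interpret prob_space "\<mu> n" by (rule prob)
      have sp: "space (\<mu> n) = UNIV" using sets_eq_imp_space_eq[OF sets] by simp
      have "1 - \<epsilon> < 1 - measure (\<mu> n) {x. norm x \<ge> R}" using R[of n] by simp
      also have "\<dots> = measure (\<mu> n) (space (\<mu> n) - {x. norm x \<ge> R})"
        by (rule prob_compl[symmetric]) measurable
      also have "\<dots> \<le> measure (\<mu> n) (s -` {-1<..2 * real N + 1} \<inter> space (\<mu> n))"
      proof (rule finite_measure_mono)
        show "space (\<mu> n) - {x. R \<le> norm x} \<subseteq> s -` {- 1<..2 * real N + 1} \<inter> space (\<mu> n)"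
        proof
          fix x assume "x \<in> space (\<mu> n) - {x. R \<le> norm x}"
          then have "norm x < real N" "x \<in> space (\<mu> n)" using N by auto
          then show "x \<in> s -` {- 1<..2 * real N + 1} \<inter> space (\<mu> n)"
            using s_le[of x N] s(1)[of x] by auto
        qed
      qed measurable
      also have "\<dots> = measure (\<nu> n) {-1<..2 * real N + 1}"
        unfolding \<nu>_def by (simp add: measure_distr)
      finally show ?thesis .
    qed
    then show "\<exists>a b. a < b \<and> (\<forall>n. 1 - \<epsilon> < measure (\<nu> n) {a<..b})"
      by (intro exI[of _ "-1"] exI[of _ "2 * real N + 1"]) auto
  qed
  from tight_imp_convergent_subsubsequence[OF this strict_mono_id]
  obtain r L where r: "strict_mono (r :: nat \<Rightarrow> nat)" "real_distribution L" "weak_conv_m (\<nu> \<circ> id \<circ> r) L"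
    by blast
  interpret L: real_distribution L by fact
  show ?thesis
  proof
    show "strict_mono r" by fact
    have gL: "g \<in> measurable L borel" by simp
    show "prob_space (distr L borel g)" by (rule L.prob_space_distr[OF gL])
    show "sets (distr L borel g) = sets borel" by simp
    fix f :: "'a \<Rightarrow> real" assume f: "continuous_on UNIV f" "bounded (range f)"
    then obtain B where B: "\<And>x. norm (f x) \<le> B" by (auto simp: bounded_iff)
    have fm [measurable]: "f \<in> borel_measurable borel"
      using f(1) by (rule borel_measurable_continuous_onI)
    have cont: "continuous_on UNIV (\<lambda>t. f (g t))"
      using continuous_on_compose2[OF f(1) g(1)] by simp
    have "(\<lambda>n. integral\<^sup>L ((\<nu> \<circ> id \<circ> r) n) (\<lambda>t. f (g t))) \<longlonglongrightarrow> integral\<^sup>L L (\<lambda>t. f (g t))"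
      using r(2,3) rd B cont
      by (intro weak_conv_imp_integral_bdd_continuous_conv[where B = B])
         (auto simp: continuous_on_eq_continuous_at comp_def)
    moreover have "integral\<^sup>L ((\<nu> \<circ> id \<circ> r) n) (\<lambda>t. f (g t)) = integral\<^sup>L (\<mu> (r n)) f" for n
      by (simp add: \<nu>_def integral_distr s)
    moreover have "integral\<^sup>L L (\<lambda>t. f (g t)) = integral\<^sup>L (distr L borel g) f"
      by (simp add: integral_distr)
    ultimately show "(\<lambda>n. integral\<^sup>L (\<mu> (r n)) f) \<longlonglongrightarrow> integral\<^sup>L (distr L borel g) f"
      by simp
  qed
qed

section \<open>Maximal monotone sets as Lipschitz graphs\<close>

definition lipschitz_graph :: "(real \<Rightarrow> real) \<Rightarrow> pt set" where
  "lipschitz_graph f = {z. fst z - snd z = f (fst z + snd z)}"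

lemma cst_rotated:
  "4 * cst r s = ((fst r + snd r) - (fst s + snd s))\<^sup>2 - ((fst r - snd r) - (fst s - snd s))\<^sup>2"
  by (simp add: cst_def power2_eq_square algebra_simps)

lemma cst_nonneg_iff:
  "0 \<le> cst r s \<longleftrightarrow> \<bar>(fst r - snd r) - (fst s - snd s)\<bar> \<le> \<bar>(fst r + snd r) - (fst s + snd s)\<bar>"
  using cst_rotated[of r s] unfolding abs_le_square_iff by linarith

lemma lipschitz_1D:
  assumes "1-lipschitz_on UNIV (f :: real \<Rightarrow> real)"
  shows "\<bar>f u - f v\<bar> \<le> \<bar>u - v\<bar>"
  using lipschitz_onD[OF assms, of u v] by (simp add: dist_real_def)

lemma monotone_lipschitz_graph:
  assumes "1-lipschitz_on UNIV f"
  shows "monotone_set (lipschitz_graph f)"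
  using lipschitz_1D[OF assms] by (auto simp: monotone_set_def lipschitz_graph_def cst_nonneg_iff)

text \<open>The map \<open>p\<close> of the overview: \<open>u\<close> is kept and \<open>v\<close>
  is replaced by \<open>f u\<close>. It is explicit, so it is continuous and no minimiser has to be
  selected measurably.\<close>

definition graph_proj :: "(real \<Rightarrow> real) \<Rightarrow> pt \<Rightarrow> pt" where
  "graph_proj f z = ((fst z + snd z + f (fst z + snd z)) / 2, (fst z + snd z - f (fst z + snd z)) / 2)"

lemma graph_proj_sum: "fst (graph_proj f z) + snd (graph_proj f z) = fst z + snd z"
  and graph_proj_diff: "fst (graph_proj f z) - snd (graph_proj f z) = f (fst z + snd z)"
  by (simp_all add: graph_proj_def field_simps)

lemma graph_proj_in: "graph_proj f z \<in> lipschitz_graph f"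
  by (simp only: lipschitz_graph_def mem_Collect_eq graph_proj_sum graph_proj_diff)

lemma cst_graph_proj: "cst (graph_proj f z) z = - ((fst z - snd z - f (fst z + snd z))\<^sup>2) / 4"
  by (simp add: cst_def graph_proj_def power2_eq_square field_simps)

text \<open>A point \<open>z\<close> of a larger monotone set is comparable with
  \<open>graph_proj f z\<close>, but their cost is minus a square that vanishes only on the
  graph.\<close>

lemma maximal_monotone_lipschitz_graph:
  assumes "1-lipschitz_on UNIV f"
  shows "maximal_monotone (lipschitz_graph f)"
  unfolding maximal_monotone_def
proof (intro conjI allI impI monotone_lipschitz_graph[OF assms])
  fix H assume H: "monotone_set H \<and> lipschitz_graph f \<subseteq> H"
  have "z \<in> lipschitz_graph f" if "z \<in> H" for z
  proof -
    have "0 \<le> cst (graph_proj f z) z"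
      using H that graph_proj_in[of f z] by (auto simp: monotone_set_def)
    then have "(fst z - snd z - f (fst z + snd z))\<^sup>2 \<le> 0" by (simp add: cst_graph_proj)
    then show ?thesis by (simp add: lipschitz_graph_def)
  qed
  then show "H = lipschitz_graph f" using H by auto
qed

text \<open>Serves twice. With \<open>r i\<close> the distance to a base point it is McShane's
  extension of a 1-Lipschitz function; with hyperbolic radii it produces the graph for the two-point
  condition.\<close>

lemma lipschitz_sandwich:
  fixes r :: "'i \<Rightarrow> real \<Rightarrow> real"
  assumes lip: "\<And>i. i \<in> I \<Longrightarrow> 1-lipschitz_on UNIV (r i)"
    and le: "\<And>i j u. i \<in> I \<Longrightarrow> j \<in> I \<Longrightarrow> V i - V j \<le> r i u + r j u"
  obtains f where "1-lipschitz_on UNIV f" "\<And>i u. i \<in> I \<Longrightarrow> \<bar>f u - V i\<bar> \<le> r i u"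
proof (cases "I = {}")
  case True
  \<comment> \<open>There are no constraints, and a supremum over the empty index set would be
    unspecified; any 1-Lipschitz function does.\<close>
  have "1-lipschitz_on UNIV (\<lambda>u::real. u)" by (intro lipschitz_onI) auto
  then show ?thesis using True that by blast
next
  case False
  define f where "f u = (SUP i\<in>I. V i - r i u)" for u
  have bdd: "bdd_above ((\<lambda>i. V i - r i u) ` I)" for u
  proof -
    obtain j where "j \<in> I" using False by auto
    then show ?thesis using le[of _ j u] by (intro bdd_aboveI2[of _ _ "V j + r j u"]) (simp add: algebra_simps)
  qed
  have up: "f u \<le> f v + \<bar>u - v\<bar>" for u v
    unfolding f_def
  proof (rule cSUP_least[OF False])
    fix i assume i: "i \<in> I"
    have "V i - r i u \<le> V i - r i v + \<bar>u - v\<bar>"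
      using lipschitz_1D[OF lip[OF i], of u v] by linarith
    also have "V i - r i v \<le> (SUP i\<in>I. V i - r i v)" using i bdd by (rule cSUP_upper)
    finally show "V i - r i u \<le> (SUP i\<in>I. V i - r i v) + \<bar>u - v\<bar>" by simp
  qed
  show ?thesis
  proof
    show "1-lipschitz_on UNIV f"
    proof (rule lipschitz_onI)
      fix u v :: real
      show "dist (f u) (f v) \<le> 1 * dist u v"
        using up[of u v] up[of v u] by (auto simp: dist_real_def abs_le_iff)
    qed simp
    fix i u assume i: "i \<in> I"
    have "V i - r i u \<le> f u" unfolding f_def using i bdd by (rule cSUP_upper)
    moreover have "f u \<le> V i + r i u"
      unfolding f_def using le[OF _ i, of _ u] by (intro cSUP_least[OF False]) (simp add: algebra_simps)
    ultimately show "\<bar>f u - V i\<bar> \<le> r i u" by linarith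
  qed
qed

text \<open>Monotonicity says that on \<open>G\<close> the coordinate \<open>v\<close> is a
  1-Lipschitz function of \<open>u\<close>. Its extension to the whole line has a monotone graph
  containing \<open>G\<close>, and maximality forces equality.\<close>

lemma maximal_monotone_imp_lipschitz_graph:
  assumes "maximal_monotone G"
  obtains f where "1-lipschitz_on UNIV f" "G = lipschitz_graph f"
proof -
  have mono: "0 \<le> cst r s" if "r \<in> G" "s \<in> G" for r s
    using assms that by (auto simp: maximal_monotone_def monotone_set_def)
  obtain f where f: "1-lipschitz_on UNIV f"
    "\<And>z u. z \<in> G \<Longrightarrow> \<bar>f u - (fst z - snd z)\<bar> \<le> \<bar>u - (fst z + snd z)\<bar>"
  proof (rule lipschitz_sandwich[of G "\<lambda>z u. \<bar>u - (fst z + snd z)\<bar>" "\<lambda>z. fst z - snd z"])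
    show "1-lipschitz_on UNIV (\<lambda>u. \<bar>u - (fst z + snd z)\<bar>)" for z :: pt
      by (intro lipschitz_onI) (auto simp: dist_real_def)
    show "(fst i - snd i) - (fst j - snd j) \<le> \<bar>u - (fst i + snd i)\<bar> + \<bar>u - (fst j + snd j)\<bar>"
      if "i \<in> G" "j \<in> G" for i j u
      using mono[OF that] unfolding cst_nonneg_iff by linarith
  qed blast
  have "G \<subseteq> lipschitz_graph f"
    using f(2)[of z "fst z + snd z" for z] by (force simp: lipschitz_graph_def)
  then have "G = lipschitz_graph f"
    using assms monotone_lipschitz_graph[OF f(1)] by (auto simp: maximal_monotone_def)
  then show ?thesis using that f by blast
qed

text \<open>Here \<open>p0\<close>, \<open>p1\<close> are the differences of \<open>u\<close> to the
  two base points, \<open>a0\<close>, \<open>a1\<close> the two costs and \<open>V\<close> the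
  difference in the other coordinate. Expanding the variance of \<open>p0\<close>, \<open>p1\<close>
  with weights 1 - t and t turns the hypothesis into a bound of t (1 - t) V^2 by (1 - t) r0^2 + t
  r1^2, up to a nonpositive square; it remains to optimise \<open>t\<close>.\<close>

lemma two_point_bound:
  fixes p0 p1 a0 a1 V r0 r1 :: real
  assumes b: "\<And>t. 0 \<le> t \<Longrightarrow> t \<le> 1 \<Longrightarrow> 4 * ((1 - t) * a0 + t * a1) \<le> t * (1 - t) * ((p0 - p1)\<^sup>2 - V\<^sup>2)"
    and r: "0 \<le> r0" "0 \<le> r1" "r0\<^sup>2 = p0\<^sup>2 - 4 * a0" "r1\<^sup>2 = p1\<^sup>2 - 4 * a1"
  shows "\<bar>V\<bar> \<le> r0 + r1"
proof (rule field_le_epsilon)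
  fix e :: real assume e: "0 < e"
  \<comment> \<open>The radii are enlarged because either may be 0, and then the optimal
    \<open>t\<close> would be an endpoint or undefined.\<close>
  define R0 where "R0 = r0 + e / 2"
  define R1 where "R1 = r1 + e / 2"
  have R: "0 < R0" "0 < R1" "r0\<^sup>2 \<le> R0\<^sup>2" "r1\<^sup>2 \<le> R1\<^sup>2"
    using r(1,2) e by (auto simp: R0_def R1_def intro!: power_mono)
  \<comment> \<open>This \<open>t\<close> minimises R0^2 / t + R1^2 / (1 - t), with minimum (R0 +
    R1)^2.\<close>
  define t where "t = R0 / (R0 + R1)"
  have t: "0 < t" "t < 1" using R by (auto simp: t_def field_simps)
  have tR: "(1 - t) * R0\<^sup>2 + t * R1\<^sup>2 = t * (1 - t) * (R0 + R1)\<^sup>2"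
  proof -
    have s: "R0 + R1 \<noteq> 0" using R by linarith
    then have t1: "1 - t = R1 / (R0 + R1)" by (simp add: t_def field_simps)
    show ?thesis unfolding t1 using s by (simp add: t_def field_simps power2_eq_square)
  qed
  have "t * (1 - t) * V\<^sup>2 \<le> t * (1 - t) * (p0 - p1)\<^sup>2 - 4 * ((1 - t) * a0 + t * a1)"
    using b[of t] t by (simp add: algebra_simps)
  also have "\<dots> = (1 - t) * r0\<^sup>2 + t * r1\<^sup>2 - ((1 - t) * p0 + t * p1)\<^sup>2"
    unfolding r by (simp add: power2_eq_square algebra_simps)
  also have "\<dots> \<le> (1 - t) * R0\<^sup>2 + t * R1\<^sup>2"
    using mult_left_mono[OF R(3), of "1 - t"] mult_left_mono[OF R(4), of t] t
      zero_le_power2[of "(1 - t) * p0 + t * p1"] by linarith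
  finally have "t * (1 - t) * V\<^sup>2 \<le> t * (1 - t) * (R0 + R1)\<^sup>2" unfolding tR .
  then have "V\<^sup>2 \<le> (R0 + R1)\<^sup>2" using t by (simp add: mult_le_cancel_left)
  then have "\<bar>V\<bar> \<le> \<bar>R0 + R1\<bar>" unfolding abs_le_square_iff .
  then show "\<bar>V\<bar> \<le> r0 + r1 + e" using R by (simp add: R0_def R1_def)
qed

lemma two_point_condition_imp_graph:
  assumes b: "\<And>x0 y0 x1 y1 t. (x0, y0) \<in> S \<Longrightarrow> (x1, y1) \<in> S \<Longrightarrow> 0 \<le> t \<Longrightarrow> t \<le> 1 \<Longrightarrow>
      (1 - t) * cst x0 y0 + t * cst x1 y1 \<le> t * (1 - t) * cst y0 y1"
  obtains f where "1-lipschitz_on UNIV f"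
    "\<And>x y z. (x, y) \<in> S \<Longrightarrow> z \<in> lipschitz_graph f \<Longrightarrow> cst x y \<le> cst z y"
proof -
  \<comment> \<open>The condition for a point paired with itself; it makes the square root below
    genuine.\<close>
  have neg: "cst x y \<le> 0" if "(x, y) \<in> S" for x y using b[OF that that, of 0] by simp
  define p where "p = (\<lambda>(y::pt) u. u - (fst y + snd y))"
  \<comment> \<open>The radius sqrt((u - U)^2 - 4 c) is written as a norm in the plane, so that the
    reverse triangle inequality gives its Lipschitz bound.\<close>
  define r where "r = (\<lambda>(x, y) u. norm (p y u, sqrt (- 4 * cst x y)))"
  define V where "V = (\<lambda>(x::pt, y::pt). fst y - snd y)"
  have r2: "(r (x, y) u)\<^sup>2 = (p y u)\<^sup>2 - 4 * cst x y" if "(x, y) \<in> S" for x y u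
  proof -
    have "0 \<le> (p y u)\<^sup>2 - 4 * cst x y" using neg[OF that] zero_le_power2[of "p y u"] by linarith
    then show ?thesis using neg[OF that] by (simp add: r_def norm_Pair)
  qed
  obtain f where f: "1-lipschitz_on UNIV f" "\<And>i u. i \<in> S \<Longrightarrow> \<bar>f u - V i\<bar> \<le> r i u"
  proof (rule lipschitz_sandwich[of S r V])
    fix i assume "i \<in> S"
    obtain x y where i: "i = (x, y)" by (cases i)
    show "1-lipschitz_on UNIV (r i)"
    proof (rule lipschitz_onI)
      fix u v
      have "\<bar>r i u - r i v\<bar> \<le> norm ((p y u, sqrt (- 4 * cst x y)) - (p y v, sqrt (- 4 * cst x y)))"
        unfolding r_def i by (simp only: prod.case norm_triangle_ineq3)
      then show "dist (r i u) (r i v) \<le> 1 * dist u v"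
        by (simp add: norm_Pair p_def dist_real_def)
    qed simp
  next
    fix i j u assume ij: "i \<in> S" "j \<in> S"
    obtain x0 y0 x1 y1 where eq: "i = (x0, y0)" "j = (x1, y1)" by (metis surj_pair)
    have "\<bar>(fst y0 - snd y0) - (fst y1 - snd y1)\<bar> \<le> r i u + r j u"
    proof (rule two_point_bound)
      fix t :: real assume "0 \<le> t" "t \<le> 1"
      then have "(1 - t) * cst x0 y0 + t * cst x1 y1 \<le> t * (1 - t) * cst y0 y1"
        using b ij eq by simp
      then have "4 * ((1 - t) * cst x0 y0 + t * cst x1 y1) \<le> t * (1 - t) * (4 * cst y0 y1)" by simp
      also have "4 * cst y0 y1 = (p y0 u - p y1 u)\<^sup>2 - ((fst y0 - snd y0) - (fst y1 - snd y1))\<^sup>2"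
        unfolding cst_rotated by (simp add: p_def power2_eq_square algebra_simps)
      finally show "4 * ((1 - t) * cst x0 y0 + t * cst x1 y1) \<le>
        t * (1 - t) * ((p y0 u - p y1 u)\<^sup>2 - ((fst y0 - snd y0) - (fst y1 - snd y1))\<^sup>2)" .
    qed (use ij r2 in \<open>auto simp: eq r_def\<close>)
    then show "V i - V j \<le> r i u + r j u" by (simp add: V_def eq)
  qed blast
  have "cst x y \<le> cst z y" if S: "(x, y) \<in> S" and z: "z \<in> lipschitz_graph f" for x y z
  proof -
    define u where "u = fst z + snd z"
    have "\<bar>f u - V (x, y)\<bar> \<le> \<bar>r (x, y) u\<bar>" using f(2)[OF S, of u] by simp
    then have "(f u - V (x, y))\<^sup>2 \<le> (r (x, y) u)\<^sup>2" unfolding abs_le_square_iff .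
    then have "4 * cst x y \<le> (p y u)\<^sup>2 - (f u - V (x, y))\<^sup>2" unfolding r2[OF S] by linarith
    also have "\<dots> = 4 * cst z y"
      unfolding cst_rotated using z by (simp add: p_def u_def V_def lipschitz_graph_def)
    finally show ?thesis by simp
  qed
  then show ?thesis using that f by blast
qed

lemma le_phi_iff: "ereal a \<le> phi G y \<longleftrightarrow> (\<forall>z\<in>G. a \<le> cst z y)"
  by (simp add: phi_def le_INF_iff)

lemma closed_lipschitz_graph:
  assumes "1-lipschitz_on UNIV f"
  shows "closed (lipschitz_graph f)"
proof -
  have c: "continuous_on UNIV f" by (rule lipschitz_on_continuous_on[OF assms])
  show ?thesis
    unfolding lipschitz_graph_def
    by (intro closed_Collect_eq continuous_intros continuous_on_compose2[OF c]) auto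
qed

section \<open>Supports, square integrability and continuous test functions\<close>

lemma borel_measurable_fst' [measurable (raw)]:
  fixes f :: "'a \<Rightarrow> 'b::topological_space \<times> 'c::topological_space"
  assumes "f \<in> borel_measurable M"
  shows "(\<lambda>x. fst (f x)) \<in> borel_measurable M"
  using measurable_compose[OF assms borel_measurable_continuous_onI[OF continuous_on_fst[OF continuous_on_id]]] .

lemma borel_measurable_snd' [measurable (raw)]:
  fixes f :: "'a \<Rightarrow> 'b::topological_space \<times> 'c::topological_space"
  assumes "f \<in> borel_measurable M"
  shows "(\<lambda>x. snd (f x)) \<in> borel_measurable M"
  using measurable_compose[OF assms borel_measurable_continuous_onI[OF continuous_on_snd[OF continuous_on_id]]] .

text \<open>The complement of the support is a union of possibly uncountably many open null sets;
  Lindelof reduces it to a countable union.\<close>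

lemma AE_msupp:
  fixes M :: "'a::second_countable_topology measure"
  assumes "sets M = sets borel"
  shows "AE z in M. z \<in> msupp M"
proof -
  have sp: "space M = UNIV" using sets_eq_imp_space_eq[OF assms] by simp
  define \<F> where "\<F> = {U. open U \<and> emeasure M U = 0}"
  obtain \<F>' where F': "\<F>' \<subseteq> \<F>" "countable \<F>'" "\<Union>\<F>' = \<Union>\<F>"
    by (rule Lindelof[of \<F>]) (auto simp: \<F>_def)
  have "(\<Union>U\<in>\<F>'. U) \<in> null_sets M"
    using F' assms by (intro null_sets_UN') (auto simp: \<F>_def null_sets_def)
  then have "\<Union>\<F> \<in> null_sets M" using F'(3) by simp
  then have "AE z in M. z \<notin> \<Union>\<F>" by (rule AE_not_in)
  moreover have "z \<in> msupp M" if "z \<notin> \<Union>\<F>" for z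
    unfolding msupp_def
  proof (rule InterI)
    fix C assume "C \<in> {C. closed C \<and> emeasure M (space M - C) = 0}"
    then have "UNIV - C \<in> \<F>" by (auto simp: \<F>_def sp open_Diff)
    then show "z \<in> C" using that by blast
  qed
  ultimately show ?thesis by (rule eventually_mono)
qed

lemma msupp_subset:
  assumes "sets M = sets borel" "closed C" "AE z in M. z \<in> C"
  shows "msupp M \<subseteq> C"
proof -
  have "space M - C \<in> sets M" using assms(1,2) by (intro sets.compl_sets) simp
  then have "emeasure M (space M - C) = 0"
    using assms(3) by (intro AE_iff_measurable[THEN iffD1]) auto
  then show ?thesis
    using assms(2) unfolding msupp_def by (intro Inter_lower) simp
qed

lemma msupp_emeasure_pos:
  assumes "sets M = sets borel" "z \<in> msupp M" "open U" "z \<in> U"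
  shows "emeasure M U \<noteq> 0"
proof
  assume "emeasure M U = 0"
  moreover have "space M - (- U) = U" using sets_eq_imp_space_eq[OF assms(1)] by auto
  ultimately have "closed (- U) \<and> emeasure M (space M - (- U)) = 0"
    using assms(3) by (simp only: closed_Compl)
  then have "z \<in> - U" using assms(2) unfolding msupp_def by blast
  then show False using assms(4) by simp
qed

lemma integrable_mult_L2:
  fixes f g :: "'a \<Rightarrow> real"
  assumes "f \<in> borel_measurable M" "g \<in> borel_measurable M"
    and "integrable M (\<lambda>x. (f x)\<^sup>2)" "integrable M (\<lambda>x. (g x)\<^sup>2)"
  shows "integrable M (\<lambda>x. f x * g x)"
proof (rule Bochner_Integration.integrable_bound)
  show "integrable M (\<lambda>x. (f x)\<^sup>2 + (g x)\<^sup>2)" using assms by simp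
  show "AE x in M. norm (f x * g x) \<le> norm ((f x)\<^sup>2 + (g x)\<^sup>2)"
  proof (intro AE_I2)
    fix x
    have "0 \<le> (\<bar>f x\<bar> - \<bar>g x\<bar>)\<^sup>2" "0 \<le> \<bar>f x\<bar> * \<bar>g x\<bar>" by auto
    then have "\<bar>f x\<bar> * \<bar>g x\<bar> \<le> (f x)\<^sup>2 + (g x)\<^sup>2" using \<open>0 \<le> (\<bar>f x\<bar> - \<bar>g x\<bar>)\<^sup>2\<close>
      unfolding power2_diff power2_abs by linarith
    then show "norm (f x * g x) \<le> norm ((f x)\<^sup>2 + (g x)\<^sup>2)" by (simp add: abs_mult)
  qed
qed (use assms in simp)

lemma integrable_add_square:
  fixes f g :: "'a \<Rightarrow> real"
  assumes "f \<in> borel_measurable M" "g \<in> borel_measurable M"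
    and "integrable M (\<lambda>x. (f x)\<^sup>2)" "integrable M (\<lambda>x. (g x)\<^sup>2)"
  shows "integrable M (\<lambda>x. (f x + g x)\<^sup>2)"
  using integrable_mult_L2[OF assms] assms by (simp add: power2_sum mult.assoc)

section \<open>Continuous test functions determine Borel identities\<close>

lemma closed_indicator_approx:
  fixes C :: "'a::metric_space set"
  assumes "closed C"
  obtains f :: "nat \<Rightarrow> 'a \<Rightarrow> real" where "\<And>n. continuous_on UNIV (f n)"
    "\<And>n x. 0 \<le> f n x" "\<And>n x. f n x \<le> 1" "\<And>x. (\<lambda>n. f n x) \<longlonglongrightarrow> indicator C x"
proof (cases "C = {}")
  case True
  \<comment> \<open>\<open>infdist\<close> to the empty set is 0 by convention, so the general
    formula would give the constant 1 here.\<close>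
  then show ?thesis by (intro that[of "\<lambda>_ _. 0"]) auto
next
  case False
  define f where "f n x = max 0 (1 - real n * infdist x C)" for n x
  show ?thesis
  proof
    show "continuous_on UNIV (f n)" for n
      unfolding f_def by (intro continuous_intros)
    show "0 \<le> f n x" "f n x \<le> 1" for n x by (auto simp: f_def infdist_nonneg)
    fix x
    show "(\<lambda>n. f n x) \<longlonglongrightarrow> indicator C x"
    proof (cases "x \<in> C")
      case True
      then show ?thesis by (simp add: f_def)
    next
      case nin: False
      then have d: "infdist x C > 0" using in_closed_iff_infdist_zero[OF assms False] infdist_nonneg[of x C] by force
      obtain N where N: "1 / infdist x C < real N" using reals_Archimedean2 by blast
      have "f n x = 0" if "n \<ge> N" for n
      proof -
        have "1 \<le> real N * infdist x C" using N d by (simp add: field_simps)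
        also have "\<dots> \<le> real n * infdist x C" using that d by simp
        finally show ?thesis by (simp add: f_def)
      qed
      then have "eventually (\<lambda>n. f n x = 0) sequentially" unfolding eventually_sequentially by blast
      then show ?thesis using nin by (simp add: tendsto_eventually)
    qed
  qed
qed

lemma borel_eq_sigma_sets_closed: "sets borel = sigma_sets UNIV (Collect closed)"
  by (simp add: borel_eq_closed)

lemma Int_stable_closed: "Int_stable (Collect closed)"
  by (auto simp: Int_stable_def)

text \<open>Weak limits yield the martingale identity only against bounded continuous functions of
  x, whereas membership in \<open>Gamma\<close> is checked on events. Closed sets are reached by
  dominated convergence, all Borel sets by Dynkin's argument.\<close>

lemma integral_indicator_eq_0_of_continuous:
  fixes X :: "'a \<Rightarrow> 'b::metric_space" and W :: "'a \<Rightarrow> real"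
  assumes [measurable]: "X \<in> borel_measurable M" and W: "integrable M W"
    and 0: "\<And>f :: 'b \<Rightarrow> real. continuous_on UNIV f \<Longrightarrow> bounded (range f) \<Longrightarrow> (\<integral>z. f (X z) * W z \<partial>M) = 0"
    and A: "A \<in> sets borel"
  shows "(\<integral>z. indicator A (X z) * W z \<partial>M) = 0"
proof -
  note [measurable] = borel_measurable_integrable[OF W]
  have int: "integrable M (\<lambda>z. indicator A (X z) * W z)" if "A \<in> sets borel" for A
    using W by (rule Bochner_Integration.integrable_bound) (use that in \<open>auto split: split_indicator\<close>)
  have "Collect closed \<subseteq> Pow (UNIV :: 'b set)" by simp
  with Int_stable_closed show ?thesis using A[unfolded borel_eq_sigma_sets_closed]
  proof (induction rule: sigma_sets_induct_disjoint)
    case (basic C)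
    then obtain f :: "nat \<Rightarrow> 'b \<Rightarrow> real" where f: "\<And>n. continuous_on UNIV (f n)"
      "\<And>n x. 0 \<le> f n x" "\<And>n x. f n x \<le> 1" "\<And>x. (\<lambda>n. f n x) \<longlonglongrightarrow> indicator C x"
      using closed_indicator_approx by blast
    have [measurable]: "f n \<in> borel_measurable borel" "C \<in> sets borel" for n
      using f(1) basic by (auto intro: borel_measurable_continuous_onI)
    have "(\<lambda>n. \<integral>z. f n (X z) * W z \<partial>M) \<longlonglongrightarrow> (\<integral>z. indicator C (X z) * W z \<partial>M)"
    proof (rule integral_dominated_convergence[of _ _ _ "\<lambda>z. \<bar>W z\<bar>"])
      show "AE z in M. (\<lambda>n. f n (X z) * W z) \<longlonglongrightarrow> indicator C (X z) * W z"
        using f(4) by (intro AE_I2 tendsto_intros)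
      show "AE z in M. norm (f n (X z) * W z) \<le> \<bar>W z\<bar>" for n
        using f(2,3) by (intro AE_I2) (auto simp: abs_mult intro: mult_left_le_one_le)
    qed (use W in auto)
    moreover have "(\<integral>z. f n (X z) * W z \<partial>M) = 0" for n
      using f by (intro 0) (auto intro!: boundedI[of _ 1])
    ultimately show ?case by (simp add: LIMSEQ_const_iff)
  next
    case empty
    then show ?case by simp
  next
    case (compl A)
    then have A: "A \<in> sets borel" by (simp add: borel_eq_sigma_sets_closed)
    have "(\<integral>z. indicator (UNIV - A) (X z) * W z \<partial>M) = (\<integral>z. 1 * W z - indicator A (X z) * W z \<partial>M)"
      by (intro Bochner_Integration.integral_cong) (auto split: split_indicator)
    also have "\<dots> = (\<integral>z. 1 * W z \<partial>M) - (\<integral>z. indicator A (X z) * W z \<partial>M)"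
      using W int[OF A] by (intro Bochner_Integration.integral_diff) auto
    \<comment> \<open>The constant 1 is itself a test function, so the total integral vanishes and
      complements are harmless.\<close>
    also have "(\<integral>z. 1 * W z \<partial>M) = 0" by (rule 0[of "\<lambda>_. 1"]) auto
    finally show ?case using compl by simp
  next
    case (union A)
    then have A [measurable]: "A i \<in> sets borel" for i by (auto simp: borel_eq_sigma_sets_closed)
    then have [measurable]: "\<Union>(range A) \<in> sets borel" by (intro sets.countable_UN) auto
    have "(\<lambda>n. \<integral>z. (\<Sum>i<n. indicator (A i) (X z)) * W z \<partial>M) \<longlonglongrightarrow> (\<integral>z. indicator (\<Union>(range A)) (X z) * W z \<partial>M)"
    proof (rule integral_dominated_convergence[of _ _ _ "\<lambda>z. \<bar>W z\<bar>"])
      have "(\<lambda>n. indicator (A n) x :: real) sums indicator (\<Union>(range A)) x" for x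
        using union(1) by (intro indicator_sums) (auto simp: disjoint_family_on_def)
      then show "AE z in M. (\<lambda>n. (\<Sum>i<n. indicator (A i) (X z)) * W z) \<longlonglongrightarrow> indicator (\<Union>(range A)) (X z) * W z"
        unfolding sums_def by (intro AE_I2 tendsto_mult) auto
      show "AE z in M. norm ((\<Sum>i<n. indicator (A i) (X z)) * W z) \<le> \<bar>W z\<bar>" for n
      proof (intro AE_I2)
        fix z
        have "(\<Sum>i<n. indicator (A i) (X z) :: real) = indicator (\<Union>i<n. A i) (X z)"
          using union(1) by (intro indicator_UN_disjoint[symmetric]) (auto simp: disjoint_family_on_def)
        then show "norm ((\<Sum>i<n. indicator (A i) (X z)) * W z) \<le> \<bar>W z\<bar>"
          by (simp add: abs_mult split: split_indicator)
      qed
    qed (use W in auto)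
    moreover have "(\<integral>z. (\<Sum>i<n. indicator (A i) (X z)) * W z \<partial>M) = 0" for n
      unfolding sum_distrib_right using union(3) int[OF A] by (subst Bochner_Integration.integral_sum) auto
    ultimately show ?case by (simp add: LIMSEQ_const_iff)
  qed
qed

text \<open>Closed sets form an intersection-stable generator, and their indicators are limits of
  bounded continuous functions. This identifies the y-marginal of a weak limit.\<close>

lemma prob_measure_eqI_continuous:
  fixes M N :: "'a::metric_space measure"
  assumes "prob_space M" "prob_space N" and s: "sets M = sets borel" "sets N = sets borel"
    and eq: "\<And>f :: 'a \<Rightarrow> real. continuous_on UNIV f \<Longrightarrow> bounded (range f) \<Longrightarrow> integral\<^sup>L M f = integral\<^sup>L N f"
  shows "M = N"
proof (rule measure_eqI_generator_eq[OF Int_stable_closed, where A = "\<lambda>_. UNIV"])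
  interpret M: prob_space M by fact
  interpret N: prob_space N by fact
  note [measurable_cong] = s
  fix C :: "'a set" assume C: "C \<in> Collect closed"
  then obtain f :: "nat \<Rightarrow> 'a \<Rightarrow> real" where f: "\<And>n. continuous_on UNIV (f n)"
    "\<And>n x. 0 \<le> f n x" "\<And>n x. f n x \<le> 1" "\<And>x. (\<lambda>n. f n x) \<longlonglongrightarrow> indicator C x"
    using closed_indicator_approx by blast
  have [measurable]: "f n \<in> borel_measurable borel" "C \<in> sets borel" for n
    using f(1) C by (auto intro: borel_measurable_continuous_onI)
  have lim: "(\<lambda>n. integral\<^sup>L M (f n)) \<longlonglongrightarrow> integral\<^sup>L M (indicat_real C)"
    by (rule integral_dominated_convergence[of _ _ _ "\<lambda>z. 1"]) (use f in auto)
  moreover have "(\<lambda>n. integral\<^sup>L N (f n)) \<longlonglongrightarrow> integral\<^sup>L N (indicat_real C)"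
    by (rule integral_dominated_convergence[of _ _ _ "\<lambda>z. 1"]) (use f in auto)
  moreover have "integral\<^sup>L M (f n) = integral\<^sup>L N (f n)" for n
    using f by (intro eq) (auto intro!: boundedI[of _ 1])
  ultimately have "(\<lambda>n. integral\<^sup>L M (f n)) \<longlonglongrightarrow> integral\<^sup>L N (indicat_real C)" by simp
  with lim have "integral\<^sup>L M (indicat_real C) = integral\<^sup>L N (indicat_real C)" by (rule LIMSEQ_unique)
  moreover have "space M = UNIV" "space N = UNIV"
    using s sets_eq_imp_space_eq[of M borel] sets_eq_imp_space_eq[of N borel] by auto
  ultimately show "emeasure M C = emeasure N C"
    by (simp add: M.emeasure_eq_measure N.emeasure_eq_measure)
next
  interpret M: prob_space M by fact
  show "emeasure M UNIV \<noteq> \<infinity>" by simp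
qed (auto simp: s borel_eq_sigma_sets_closed)

section \<open>Limits of integrals of unbounded functions\<close>

text \<open>Tails are measured by the positive part of |f| - K rather than by |f| on a superlevel
  set: it is exactly the error of clipping at K, and for |x|^2 it is convex, so Jensen's inequality
  applies to it.\<close>

lemma tail_integral_LIMSEQ:
  fixes f :: "'a \<Rightarrow> real"
  assumes f: "integrable M f"
  shows "(\<lambda>n. \<integral>z. max 0 (\<bar>f z\<bar> - real n) \<partial>M) \<longlonglongrightarrow> 0"
proof -
  note [measurable] = borel_measurable_integrable[OF f]
  have "(\<lambda>n. \<integral>z. max 0 (\<bar>f z\<bar> - real n) \<partial>M) \<longlonglongrightarrow> (\<integral>z. 0 \<partial>M)"
  proof (rule integral_dominated_convergence[of _ _ _ "\<lambda>z. \<bar>f z\<bar>"])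
    show "AE z in M. (\<lambda>n. max 0 (\<bar>f z\<bar> - real n)) \<longlonglongrightarrow> 0"
    proof (intro AE_I2 tendsto_eventually)
      fix z
      obtain N where N: "\<bar>f z\<bar> < real N" using reals_Archimedean2 by blast
      show "eventually (\<lambda>n. max 0 (\<bar>f z\<bar> - real n) = 0) sequentially"
        unfolding eventually_sequentially using N by (intro exI[of _ N]) auto
    qed
  qed (use f in auto)
  then show ?thesis by simp
qed

lemma integral_clip_le:
  fixes f :: "'a \<Rightarrow> real"
  assumes "prob_space M" and f: "integrable M f" and "0 \<le> K"
  shows "\<bar>integral\<^sup>L M f - (\<integral>z. max (- K) (min K (f z)) \<partial>M)\<bar> \<le> (\<integral>z. max 0 (\<bar>f z\<bar> - K) \<partial>M)"
proof -
  interpret prob_space M by fact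
  note [measurable] = borel_measurable_integrable[OF f]
  have clip: "integrable M (\<lambda>z. max (- K) (min K (f z)))"
    using assms(3) by (intro integrable_const_bound[of _ K]) (auto simp: abs_le_iff)
  have "\<bar>integral\<^sup>L M f - (\<integral>z. max (- K) (min K (f z)) \<partial>M)\<bar> = \<bar>\<integral>z. f z - max (- K) (min K (f z)) \<partial>M\<bar>"
    using f clip by simp
  also have "\<dots> \<le> (\<integral>z. \<bar>f z - max (- K) (min K (f z))\<bar> \<partial>M)" by (rule integral_abs_bound)
  also have "\<dots> = (\<integral>z. max 0 (\<bar>f z\<bar> - K) \<partial>M)"
    using assms(3) by (intro Bochner_Integration.integral_cong) auto
  finally show ?thesis .
qed

locale weak_limit =
  fixes \<mu> :: "nat \<Rightarrow> 'a::euclidean_space measure" and M :: "'a measure"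
  assumes prob_seq: "\<And>n. prob_space (\<mu> n)" and sets_seq: "\<And>n. sets (\<mu> n) = sets borel"
    and prob_lim: "prob_space M" and sets_lim: "sets M = sets borel"
    and weak: "\<And>f :: 'a \<Rightarrow> real. continuous_on UNIV f \<Longrightarrow> bounded (range f) \<Longrightarrow>
       (\<lambda>n. integral\<^sup>L (\<mu> n) f) \<longlonglongrightarrow> integral\<^sup>L M f"
begin

text \<open>Fatou's lemma for weak convergence: the truncations \<open>min (f z) k\<close> are
  admissible tests with integral at most \<open>C\<close>, and they increase to
  \<open>f\<close>.\<close>

lemma integrable_limit:
  fixes f :: "'a \<Rightarrow> real"
  assumes f: "continuous_on UNIV f" "\<And>z. 0 \<le> f z"
    and int: "\<And>n. integrable (\<mu> n) f" and C: "\<And>n. integral\<^sup>L (\<mu> n) f \<le> C"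
  shows "integrable M f"
proof -
  interpret prob_space M by (rule prob_lim)
  note [measurable_cong] = sets_lim sets_seq
  have [measurable]: "f \<in> borel_measurable borel" by (rule borel_measurable_continuous_onI[OF f(1)])
  have int_min: "integrable M (\<lambda>z. min (f z) (real k))" for k
    using f(2) by (intro integrable_const_bound[of _ "real k"]) auto
  have le: "(\<integral>z. min (f z) (real k) \<partial>M) \<le> C" for k
  proof (rule LIMSEQ_le_const2[OF weak])
    show "continuous_on UNIV (\<lambda>z. min (f z) (real k))" using f(1) by (intro continuous_intros)
    show "bounded (range (\<lambda>z. min (f z) (real k)))"
      using f(2) by (intro boundedI[of _ "real k"]) auto
    have "(\<integral>z. min (f z) (real k) \<partial>\<mu> n) \<le> C" for n
    proof -
      interpret N: prob_space "\<mu> n" by (rule prob_seq)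
      have "integrable (\<mu> n) (\<lambda>z. min (f z) (real k))"
        using f(2) by (intro N.integrable_const_bound[of _ "real k"]) auto
      then have "(\<integral>z. min (f z) (real k) \<partial>\<mu> n) \<le> integral\<^sup>L (\<mu> n) f"
        using int by (intro integral_mono) auto
      then show ?thesis using C[of n] by simp
    qed
    then show "\<exists>N. \<forall>n\<ge>N. (\<integral>z. min (f z) (real k) \<partial>\<mu> n) \<le> C" by blast
  qed
  have "incseq (\<lambda>k. \<integral>z. min (f z) (real k) \<partial>M)"
    by (intro incseq_SucI integral_mono int_min) auto
  then obtain L where L: "(\<lambda>k. \<integral>z. min (f z) (real k) \<partial>M) \<longlonglongrightarrow> L"
    using incseq_convergent[of _ C] le by blast
  show ?thesis
  proof (rule integrable_monotone_convergence[OF int_min _ _ L])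
    show "AE z in M. (\<lambda>k. min (f z) (real k)) \<longlonglongrightarrow> f z"
    proof (intro AE_I2 tendsto_eventually)
      fix z
      obtain N where N: "f z < real N" using reals_Archimedean2 by blast
      show "eventually (\<lambda>n. min (f z) (real n) = f z) sequentially"
        unfolding eventually_sequentially using N by (intro exI[of _ N]) auto
    qed
  qed (auto simp: incseq_def)
qed

text \<open>Clipping \<open>f\<close> at a common level gives an admissible test function, and
  uniform integrability bounds the clipping error simultaneously for all \<open>n\<close> and for
  the limit.\<close>

lemma integral_limit:
  fixes f :: "'a \<Rightarrow> real"
  assumes f: "continuous_on UNIV f"
    and int: "\<And>n. integrable (\<mu> n) f" "integrable M f"
    and tail: "\<And>\<epsilon>. 0 < \<epsilon> \<Longrightarrow> \<exists>K\<ge>0. \<forall>n. (\<integral>z. max 0 (\<bar>f z\<bar> - K) \<partial>\<mu> n) \<le> \<epsilon>"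
  shows "(\<lambda>n. integral\<^sup>L (\<mu> n) f) \<longlonglongrightarrow> integral\<^sup>L M f"
proof (rule LIMSEQ_I)
  fix r :: real assume r: "0 < r"
  obtain K1 where K1: "0 \<le> K1" "\<And>n. (\<integral>z. max 0 (\<bar>f z\<bar> - K1) \<partial>\<mu> n) \<le> r / 4"
    using tail[of "r / 4"] r by auto
  obtain K2 where K2: "(\<integral>z. max 0 (\<bar>f z\<bar> - real K2) \<partial>M) \<le> r / 4"
    using order_tendstoD(2)[OF tail_integral_LIMSEQ[OF int(2)], of "r / 4"] r
    unfolding eventually_sequentially by (auto intro: less_imp_le)
  define K where "K = max K1 (real K2)"
  define g where "g z = max (- K) (min K (f z))" for z
  have K0: "0 \<le> K" using K1 by (simp add: K_def)
  have mono: "(\<integral>z. max 0 (\<bar>f z\<bar> - K) \<partial>N) \<le> (\<integral>z. max 0 (\<bar>f z\<bar> - K') \<partial>N)"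
    if "K' \<le> K" "0 \<le> K'" "integrable N f" for N K'
  proof -
    have i: "integrable N (\<lambda>z. max 0 (\<bar>f z\<bar> - c))" if "0 \<le> c" for c
      by (rule Bochner_Integration.integrable_bound[OF \<open>integrable N f\<close>])
         (use that borel_measurable_integrable[OF \<open>integrable N f\<close>] in auto)
    show ?thesis using that K0 by (intro integral_mono i) auto
  qed
  have 1: "\<bar>integral\<^sup>L (\<mu> n) f - integral\<^sup>L (\<mu> n) g\<bar> \<le> r / 4" for n
    using integral_clip_le[OF prob_seq int(1)[of n] K0] mono[OF _ K1(1) int(1)[of n]] K1(2)[of n]
    unfolding g_def[abs_def] by (simp add: K_def)
  have 2: "\<bar>integral\<^sup>L M f - integral\<^sup>L M g\<bar> \<le> r / 4"
    using integral_clip_le[OF prob_lim int(2) K0] mono[OF _ _ int(2), of "real K2"] K2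
    unfolding g_def[abs_def] by (simp add: K_def)
  have "(\<lambda>n. integral\<^sup>L (\<mu> n) g) \<longlonglongrightarrow> integral\<^sup>L M g"
  proof (rule weak)
    show "continuous_on UNIV g" unfolding g_def using f by (intro continuous_intros)
    show "bounded (range g)" unfolding g_def using K0 by (intro boundedI[of _ K]) auto
  qed
  from LIMSEQ_D[OF this, of "r / 4"] r obtain n0 where
    n0: "\<And>n. n \<ge> n0 \<Longrightarrow> \<bar>integral\<^sup>L (\<mu> n) g - integral\<^sup>L M g\<bar> < r / 4" by auto
  have "norm (integral\<^sup>L (\<mu> n) f - integral\<^sup>L M f) < r" if "n \<ge> n0" for n
    using 1[of n] 2 n0[OF that] r unfolding real_norm_def by linarith
  then show "\<exists>n0. \<forall>n\<ge>n0. norm (integral\<^sup>L (\<mu> n) f - integral\<^sup>L M f) < r" by blast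
qed

text \<open>A bound in L2 gives uniform integrability, because |f| - K is at most f^2 / K.\<close>

lemma integral_limit_L2:
  fixes f :: "'a \<Rightarrow> real"
  assumes f: "continuous_on UNIV f"
    and int: "\<And>n. integrable (\<mu> n) (\<lambda>z. (f z)\<^sup>2)" and C: "\<And>n. (\<integral>z. (f z)\<^sup>2 \<partial>\<mu> n) \<le> C"
  shows "(\<lambda>n. integral\<^sup>L (\<mu> n) f) \<longlonglongrightarrow> integral\<^sup>L M f"
proof -
  note [measurable_cong] = sets_lim sets_seq
  have [measurable]: "f \<in> borel_measurable borel" by (rule borel_measurable_continuous_onI[OF f(1)])
  have L2: "integrable N f" if "prob_space N" "sets N = sets borel" "integrable N (\<lambda>z. (f z)\<^sup>2)" for N
  proof -
    interpret prob_space N by fact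
    have "f \<in> borel_measurable N" using that(2) by simp
    then show ?thesis using that(3) by (rule square_integrable_imp_integrable)
  qed
  have i: "integrable (\<mu> n) f" for n using L2[OF prob_seq sets_seq int] .
  have "0 \<le> (\<integral>z. (f z)\<^sup>2 \<partial>\<mu> 0)" by simp
  also have "\<dots> \<le> C" by (rule C)
  finally have C0: "0 \<le> C" .
  show ?thesis
  proof (rule integral_limit[OF f i])
    have "integrable M (\<lambda>z. (f z)\<^sup>2)"
      using f int C by (intro integrable_limit[where C = C]) (auto intro!: continuous_intros)
    then show "integrable M f" using L2[OF prob_lim sets_lim] by blast
    fix \<epsilon> :: real assume e: "0 < \<epsilon>"
    \<comment> \<open>The \<open>+ 1\<close> keeps \<open>K\<close> positive when
      \<open>C = 0\<close>.\<close>
    define K where "K = (C + 1) / \<epsilon>"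
    have K: "0 < K" using C0 e by (simp add: K_def)
    have "(\<integral>z. max 0 (\<bar>f z\<bar> - K) \<partial>\<mu> n) \<le> \<epsilon>" for n
    proof -
      have "(\<integral>z. max 0 (\<bar>f z\<bar> - K) \<partial>\<mu> n) \<le> (\<integral>z. (f z)\<^sup>2 / K \<partial>\<mu> n)"
      proof (intro integral_mono)
        show "integrable (\<mu> n) (\<lambda>z. max 0 (\<bar>f z\<bar> - K))"
          by (rule Bochner_Integration.integrable_bound[OF i[of n]]) (use K in auto)
        show "integrable (\<mu> n) (\<lambda>z. (f z)\<^sup>2 / K)" using int by simp
        fix z
        have "\<bar>f z\<bar> * K \<le> (f z)\<^sup>2 + K\<^sup>2"
          using zero_le_power2[of "\<bar>f z\<bar> - K"] mult_nonneg_nonneg[of "\<bar>f z\<bar>" K] K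
          unfolding power2_diff power2_abs by linarith
        then have "\<bar>f z\<bar> - K \<le> (f z)\<^sup>2 / K" using K by (simp add: field_simps power2_eq_square)
        then show "max 0 (\<bar>f z\<bar> - K) \<le> (f z)\<^sup>2 / K" using K by simp
      qed
      also have "\<dots> \<le> C / K" using C[of n] K by (simp add: divide_right_mono)
      also have "\<dots> \<le> \<epsilon>" using C0 e by (simp add: K_def field_simps)
      finally show ?thesis .
    qed
    then show "\<exists>K\<ge>0. \<forall>n. (\<integral>z. max 0 (\<bar>f z\<bar> - K) \<partial>\<mu> n) \<le> \<epsilon>" using K by (intro exI[of _ K]) auto
  qed
qed

end

section \<open>Martingale plans\<close>

lemma norm_sq_Pair: "(norm z)\<^sup>2 = (norm (fst z))\<^sup>2 + (norm (snd z))\<^sup>2"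
  by (cases z) (simp add: norm_Pair)

lemma norm_sq_pt: "(norm z)\<^sup>2 = (fst z)\<^sup>2 + (snd z)\<^sup>2" for z :: pt
  by (simp add: norm_sq_Pair)

lemma coord_L2:
  assumes X: "X \<in> borel_measurable M" "integrable M (\<lambda>z. (norm (X z :: pt))\<^sup>2)"
    and p: "p \<in> {fst, snd}"
  shows "integrable M (\<lambda>z. (p (X z))\<^sup>2)"
proof (rule Bochner_Integration.integrable_bound[OF X(2)])
  note [measurable] = X(1)
  show "(\<lambda>z. (p (X z))\<^sup>2) \<in> borel_measurable M" using p by auto
  show "AE z in M. norm ((p (X z))\<^sup>2) \<le> norm ((norm (X z))\<^sup>2)"
    using p by (auto simp: norm_sq_pt)
qed

lemma norm_L2:
  assumes X: "X \<in> borel_measurable M"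
    and "integrable M (\<lambda>z. (fst (X z :: pt))\<^sup>2)" "integrable M (\<lambda>z. (snd (X z))\<^sup>2)"
  shows "integrable M (\<lambda>z. (norm (X z))\<^sup>2)"
  using assms by (simp add: norm_sq_pt)

locale plan =
  fixes \<nu> :: "pt measure" and \<gamma> :: "(pt \<times> pt) measure"
  assumes in_Gamma: "\<gamma> \<in> Gamma \<nu>"
begin

lemma sets_plan [measurable_cong]: "sets \<gamma> = sets borel"
  using in_Gamma by (simp add: Gamma_def P2_def)

lemma space_plan: "space \<gamma> = UNIV"
  using sets_eq_imp_space_eq[OF sets_plan] by simp

sublocale prob_space \<gamma>
  using in_Gamma by (simp add: Gamma_def P2_def)

lemma integrable_norm_sq: "integrable \<gamma> (\<lambda>z. (norm z)\<^sup>2)"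
  using in_Gamma by (simp add: Gamma_def P2_def)

lemma distr_snd: "distr \<gamma> borel snd = \<nu>"
  using in_Gamma by (simp add: Gamma_def)

lemma integrable_norm_sq_fst: "integrable \<gamma> (\<lambda>z. (norm (fst z))\<^sup>2)"
  and integrable_norm_sq_snd: "integrable \<gamma> (\<lambda>z. (norm (snd z))\<^sup>2)"
  by (rule Bochner_Integration.integrable_bound[OF integrable_norm_sq]; simp add: norm_sq_Pair)+

lemma L2_fst: "p \<in> {fst, snd} \<Longrightarrow> integrable \<gamma> (\<lambda>z. (p (fst z))\<^sup>2)"
  by (rule coord_L2[OF _ integrable_norm_sq_fst]) measurable

lemma L2_snd: "p \<in> {fst, snd} \<Longrightarrow> integrable \<gamma> (\<lambda>z. (p (snd z))\<^sup>2)"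
  by (rule coord_L2[OF _ integrable_norm_sq_snd]) measurable

lemma integral_snd_eq:
  assumes "f \<in> borel_measurable borel"
  shows "(\<integral>z. f (snd z) \<partial>\<gamma>) = (\<integral>y. (f y :: real) \<partial>\<nu>)"
  unfolding distr_snd[symmetric] using assms by (subst integral_distr) auto

lemma integrable_snd_iff:
  assumes "f \<in> borel_measurable borel"
  shows "integrable \<gamma> (\<lambda>z. f (snd z) :: real) \<longleftrightarrow> integrable \<nu> f"
  unfolding distr_snd[symmetric] using assms by (subst integrable_distr_eq) auto

abbreviation "sigma_fst \<equiv> vimage_algebra (space \<gamma>) fst (borel :: pt measure)"

lemma subalgebra_fst: "subalgebra \<gamma> sigma_fst"
  unfolding subalgebra_def
proof
  show "sets sigma_fst \<subseteq> sets \<gamma>"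
    unfolding sets_vimage_algebra
    by (rule sets.sigma_sets_subset) (auto intro!: measurable_sets[of fst \<gamma> borel])
qed simp

sublocale fm: finite_measure_subalgebra \<gamma> sigma_fst
  by unfold_locales (rule subalgebra_fst)

lemma measurable_sigma_fst:
  assumes "h \<in> borel_measurable (borel :: pt measure)"
  shows "(\<lambda>z. h (fst z)) \<in> borel_measurable sigma_fst"
  using measurable_compose[OF measurable_vimage_algebra1[of fst] assms] by (simp add: space_plan)

text \<open>Stated for arbitrary \<open>sigma_fst\<close>-measurable \<open>h\<close>, not only for
  functions composed with \<open>fst\<close>, because the variation tests with quantities built from
  conditional expectations. Square integrability of \<open>h\<close> makes the products with the
  coordinates integrable.\<close>

lemma orthogonal_sigma:
  fixes h :: "pt \<times> pt \<Rightarrow> real"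
  assumes p: "p \<in> {fst, snd}" and h: "h \<in> borel_measurable sigma_fst"
    and L2: "integrable \<gamma> (\<lambda>z. (h z)\<^sup>2)"
  shows "(\<integral>z. h z * (p (snd z) - p (fst z)) \<partial>\<gamma>) = 0"
proof -
  have [measurable]: "h \<in> borel_measurable \<gamma>"
    using measurable_from_subalg[OF subalgebra_fst h] .
  have [measurable]: "p \<in> borel_measurable borel" using p by auto
  have AE: "AE z in \<gamma>. real_cond_exp \<gamma> sigma_fst (\<lambda>z. p (snd z)) z = p (fst z)"
    using p in_Gamma by (auto simp: Gamma_def)
  have i1: "integrable \<gamma> (\<lambda>z. h z * p (snd z))" by (intro integrable_mult_L2 L2 L2_snd p) measurable
  have i2: "integrable \<gamma> (\<lambda>z. h z * p (fst z))" by (intro integrable_mult_L2 L2 L2_fst p) measurable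
  have "(\<integral>z. h z * p (snd z) \<partial>\<gamma>) = (\<integral>z. h z * real_cond_exp \<gamma> sigma_fst (\<lambda>z. p (snd z)) z \<partial>\<gamma>)"
    by (rule fm.real_cond_exp_intg(2)[symmetric, OF i1 h]) measurable
  also have "\<dots> = (\<integral>z. h z * p (fst z) \<partial>\<gamma>)"
    by (intro integral_cong_AE) (use AE in auto)
  finally show ?thesis using i1 i2 by (simp add: right_diff_distrib)
qed

lemma orthogonal:
  fixes h :: "pt \<Rightarrow> real"
  assumes "p \<in> {fst, snd}" "h \<in> borel_measurable borel" "integrable \<gamma> (\<lambda>z. (h (fst z))\<^sup>2)"
  shows "(\<integral>z. h (fst z) * (p (snd z) - p (fst z)) \<partial>\<gamma>) = 0"
  using orthogonal_sigma[OF assms(1) measurable_sigma_fst[OF assms(2)] assms(3)] .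

lemma integrable_increment:
  fixes h :: "pt \<Rightarrow> real"
  assumes "p \<in> {fst, snd}" "h \<in> borel_measurable borel" "integrable \<gamma> (\<lambda>z. (h (fst z))\<^sup>2)"
  shows "integrable \<gamma> (\<lambda>z. h (fst z) * (p (snd z) - p (fst z)))"
proof -
  note [measurable] = assms(2)
  have [measurable]: "p \<in> borel_measurable borel" using assms(1) by auto
  have "integrable \<gamma> (\<lambda>z. h (fst z) * p (snd z) - h (fst z) * p (fst z))"
    by (intro Bochner_Integration.integrable_diff integrable_mult_L2 assms(3) L2_snd L2_fst assms(1)) measurable
  then show ?thesis by (simp add: right_diff_distrib)
qed

lemma integrable_products:
  assumes "p \<in> {fst, snd}" "q \<in> {fst, snd}"
  shows "integrable \<gamma> (\<lambda>z. p (fst z) * q (fst z))" "integrable \<gamma> (\<lambda>z. p (fst z) * q (snd z))"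
    "integrable \<gamma> (\<lambda>z. p (snd z) * q (snd z))"
proof -
  have [measurable]: "p \<in> borel_measurable borel" "q \<in> borel_measurable borel" using assms by auto
  show "integrable \<gamma> (\<lambda>z. p (fst z) * q (fst z))" "integrable \<gamma> (\<lambda>z. p (fst z) * q (snd z))"
    "integrable \<gamma> (\<lambda>z. p (snd z) * q (snd z))"
    by (intro integrable_mult_L2 L2_fst L2_snd assms; measurable)+
qed

text \<open>Up to y1 y2 - x1 x2, the cost consists of martingale increments multiplied by functions
  of x. So minimising the cost means maximising the integral of x1 x2, and competitors are compared
  in this form below.\<close>

lemma total_cost_eq:
  "total_cost \<gamma> = (\<integral>y. fst y * snd y \<partial>\<nu>) - (\<integral>z. fst (fst z) * snd (fst z) \<partial>\<gamma>)"
proof -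
  have i: "integrable \<gamma> (\<lambda>z. fst (fst z) * (snd (snd z) - snd (fst z)))"
    "integrable \<gamma> (\<lambda>z. snd (fst z) * (fst (snd z) - fst (fst z)))"
    using integrable_increment[of snd fst] integrable_increment[of fst snd] L2_fst by auto
  have o: "(\<integral>z. fst (fst z) * (snd (snd z) - snd (fst z)) \<partial>\<gamma>) = 0"
    "(\<integral>z. snd (fst z) * (fst (snd z) - fst (fst z)) \<partial>\<gamma>) = 0"
    using orthogonal[of snd fst] orthogonal[of fst snd] L2_fst by auto
  have "total_cost \<gamma> = (\<integral>z. fst (snd z) * snd (snd z) - fst (fst z) * snd (fst z)
     - fst (fst z) * (snd (snd z) - snd (fst z)) - snd (fst z) * (fst (snd z) - fst (fst z)) \<partial>\<gamma>)"
    unfolding total_cost_def cst_def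
    by (intro Bochner_Integration.integral_cong) (auto simp: algebra_simps)
  also have "\<dots> = (\<integral>z. fst (snd z) * snd (snd z) \<partial>\<gamma>) - (\<integral>z. fst (fst z) * snd (fst z) \<partial>\<gamma>)"
    using i o integrable_products[of fst snd] by simp
  also have "(\<integral>z. fst (snd z) * snd (snd z) \<partial>\<gamma>) = (\<integral>y. fst y * snd y \<partial>\<nu>)"
    by (rule integral_snd_eq) measurable
  finally show ?thesis .
qed

text \<open>Jensen's inequality for the convex function \<open>max 0 (|x|\<^sup>2 - K)\<close>, via its subgradient at \<open>x\<close>.\<close>

lemma second_moment_tail:
  assumes K: "0 \<le> K"
  shows "(\<integral>z. max 0 ((norm (fst z))\<^sup>2 - K) \<partial>\<gamma>) \<le> (\<integral>y. max 0 ((norm y)\<^sup>2 - K) \<partial>\<nu>)"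
proof -
  define h where "h p x = (if (norm x)\<^sup>2 > K then 2 * p x else 0)" for p :: "pt \<Rightarrow> real" and x :: pt
  have h [measurable]: "h p \<in> borel_measurable borel" if "p \<in> {fst, snd}" for p
    using that unfolding h_def[abs_def] by auto
  have hL2: "integrable \<gamma> (\<lambda>z. (h p (fst z))\<^sup>2)" if "p \<in> {fst, snd}" for p
  proof (rule Bochner_Integration.integrable_bound)
    show "integrable \<gamma> (\<lambda>z. 4 * (p (fst z))\<^sup>2)" using L2_fst[OF that] by simp
    show "(\<lambda>z. (h p (fst z))\<^sup>2) \<in> borel_measurable \<gamma>" using h[OF that] by measurable
    show "AE z in \<gamma>. norm ((h p (fst z))\<^sup>2) \<le> norm (4 * (p (fst z))\<^sup>2)"
      by (auto simp: h_def power_mult_distrib)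
  qed
  have i: "integrable \<gamma> (\<lambda>z. max 0 ((norm (fst z))\<^sup>2 - K))"
    by (rule Bochner_Integration.integrable_bound[OF integrable_norm_sq_fst]) (use K in auto)
  have j: "integrable \<gamma> (\<lambda>z. max 0 ((norm (snd z))\<^sup>2 - K))"
    by (rule Bochner_Integration.integrable_bound[OF integrable_norm_sq_snd]) (use K in auto)
  have le: "max 0 ((norm x)\<^sup>2 - K) \<le> max 0 ((norm y)\<^sup>2 - K) - h fst x * (fst y - fst x) - h snd x * (snd y - snd x)"
    for x y :: pt
  proof (cases "(norm x)\<^sup>2 > K")
    case True
    have "(norm x)\<^sup>2 \<le> (norm y)\<^sup>2 - 2 * fst x * (fst y - fst x) - 2 * snd x * (snd y - snd x)"
      using zero_le_power2[of "fst x - fst y"] zero_le_power2[of "snd x - snd y"]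
      unfolding norm_sq_pt by (simp add: power2_eq_square algebra_simps)
    then show ?thesis using True by (simp add: h_def)
  qed (simp add: h_def)
  have "(\<integral>z. max 0 ((norm (fst z))\<^sup>2 - K) \<partial>\<gamma>) \<le>
    (\<integral>z. max 0 ((norm (snd z))\<^sup>2 - K) - h fst (fst z) * (fst (snd z) - fst (fst z)) - h snd (fst z) * (snd (snd z) - snd (fst z)) \<partial>\<gamma>)"
    using i j integrable_increment[of _ "h _"] h hL2 by (intro integral_mono le) auto
  also have "\<dots> = (\<integral>z. max 0 ((norm (snd z))\<^sup>2 - K) \<partial>\<gamma>)"
    using j integrable_increment[of _ "h _"] orthogonal[of _ "h _"] h hL2 by simp
  also have "\<dots> = (\<integral>y. max 0 ((norm y)\<^sup>2 - K) \<partial>\<nu>)"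
    by (rule integral_snd_eq) measurable
  finally show ?thesis .
qed

end

text \<open>Plans are built as joint laws of random points on an auxiliary space, which may carry
  extra randomness such as a coin. Every event of the sigma-algebra of x is a preimage under
  \<open>fst\<close>, so testing increments with indicators of \<open>X\<close> characterises the
  conditional expectation.\<close>

lemma Gamma_I:
  assumes "prob_space \<Omega>" and X [measurable]: "X \<in> borel_measurable \<Omega>" and Y [measurable]: "Y \<in> borel_measurable \<Omega>"
    and X2: "integrable \<Omega> (\<lambda>w. (norm (X w))\<^sup>2)" and Y2: "integrable \<Omega> (\<lambda>w. (norm (Y w))\<^sup>2)"
    and marg: "distr \<Omega> borel Y = \<nu>"
    and mart: "\<And>p A. p \<in> {fst, snd} \<Longrightarrow> A \<in> sets borel \<Longrightarrow>
       (\<integral>w. indicator A (X w) * (p (Y w) - p (X w)) \<partial>\<Omega>) = 0"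
  shows "distr \<Omega> borel (\<lambda>w. (X w, Y w)) \<in> Gamma \<nu>"
proof -
  interpret \<Omega>: prob_space \<Omega> by fact
  define \<gamma> where "\<gamma> = distr \<Omega> borel (\<lambda>w. (X w, Y w))"
  have sets_g [measurable_cong]: "sets \<gamma> = sets borel" by (simp add: \<gamma>_def)
  have sp: "space \<gamma> = UNIV" by (simp add: \<gamma>_def)
  have pr: "prob_space \<gamma>" unfolding \<gamma>_def by (rule \<Omega>.prob_space_distr) measurable
  interpret prob_space \<gamma> by (rule pr)
  have P2: "P2 \<gamma>"
    unfolding P2_def
  proof (intro conjI pr sets_g)
    show "integrable \<gamma> (\<lambda>z. (norm z)\<^sup>2)"
      unfolding \<gamma>_def using X2 Y2 by (subst integrable_distr_eq) (auto simp: norm_Pair)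
  qed
  have snd: "distr \<gamma> borel snd = \<nu>"
    unfolding \<gamma>_def marg[symmetric] by (subst distr_distr) (auto simp: comp_def)
  let ?F = "vimage_algebra (space \<gamma>) fst (borel :: pt measure)"
  have sub: "subalgebra \<gamma> ?F"
    unfolding subalgebra_def
  proof
    show "sets ?F \<subseteq> sets \<gamma>"
      unfolding sets_vimage_algebra
      by (rule sets.sigma_sets_subset) (auto intro!: measurable_sets[of fst \<gamma> borel])
  qed simp
  interpret fm: finite_measure_subalgebra \<gamma> ?F by unfold_locales (rule sub)
  have AE: "AE z in \<gamma>. real_cond_exp \<gamma> ?F (\<lambda>z. p (snd z)) z = p (fst z)" if p: "p \<in> {fst, snd}" for p
  proof -
    have pm [measurable]: "p \<in> borel_measurable borel" using p by auto
    have pi: "integrable \<Omega> (\<lambda>w. p (X w))" "integrable \<Omega> (\<lambda>w. p (Y w))"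
      using coord_L2[OF X X2 p] coord_L2[OF Y Y2 p] by (auto intro!: \<Omega>.square_integrable_imp_integrable)
    then have i: "integrable \<gamma> (\<lambda>z. p (fst z))" "integrable \<gamma> (\<lambda>z. p (snd z))"
      unfolding \<gamma>_def by (subst integrable_distr_eq; simp)+
    show ?thesis
    proof (rule fm.real_cond_exp_charact)
      show "integrable \<gamma> (\<lambda>z. p (snd z))" "integrable \<gamma> (\<lambda>z. p (fst z))" using i by auto
      show "(\<lambda>z. p (fst z)) \<in> borel_measurable ?F"
        using measurable_compose[OF measurable_vimage_algebra1[of fst] pm] by (simp add: sp)
      fix A assume "A \<in> sets ?F"
      then obtain B where B [measurable]: "B \<in> sets borel" and A: "A = fst -` B"
        by (auto simp: sets_vimage_algebra2 sp)
      have iB: "integrable \<Omega> (\<lambda>w. indicator B (X w) * p (Y w))" "integrable \<Omega> (\<lambda>w. indicator B (X w) * p (X w))"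
        by (rule Bochner_Integration.integrable_bound[OF pi(2)]; auto split: split_indicator)
           (rule Bochner_Integration.integrable_bound[OF pi(1)]; auto split: split_indicator)
      have ind: "indicator A z = indicator B (fst z)" for z :: "pt \<times> pt" by (auto simp: A split: split_indicator)
      have "(LINT z:A|\<gamma>. p (snd z)) = (\<integral>w. indicator B (X w) * p (Y w) \<partial>\<Omega>)"
        unfolding set_lebesgue_integral_def ind \<gamma>_def by (subst integral_distr) auto
      also have "\<dots> = (\<integral>w. indicator B (X w) * p (X w) \<partial>\<Omega>)"
        using mart[OF p B] iB by (simp add: right_diff_distrib)
      also have "\<dots> = (LINT z:A|\<gamma>. p (fst z))"
        unfolding set_lebesgue_integral_def ind \<gamma>_def by (subst integral_distr) auto
      finally show "(LINT z:A|\<gamma>. p (snd z)) = (LINT z:A|\<gamma>. p (fst z))" .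
    qed
  qed
  show ?thesis
    unfolding \<gamma>_def[symmetric] Gamma_def using P2 snd AE[of fst] AE[of snd] by simp
qed

section \<open>Existence of an optimal plan\<close>

text \<open>The trivial martingale x = y; it makes the supremum over \<open>Gamma\<close>
  meaningful.\<close>

lemma diagonal_plan:
  assumes "P2 \<nu>"
  shows "distr \<nu> borel (\<lambda>y. (y, y)) \<in> Gamma \<nu>"
proof -
  have s [measurable_cong]: "sets \<nu> = sets borel" using assms by (simp add: P2_def)
  show ?thesis
    using assms by (intro Gamma_I) (auto simp: P2_def distr_id2[OF s[symmetric]])
qed

lemma abs_mult_coord_le: "\<bar>fst x * snd x\<bar> \<le> (norm x)\<^sup>2" for x :: pt
proof -
  have "2 * (\<bar>fst x\<bar> * \<bar>snd x\<bar>) \<le> (norm x)\<^sup>2"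
    using zero_le_power2[of "\<bar>fst x\<bar> - \<bar>snd x\<bar>"] unfolding power2_diff power2_abs norm_sq_pt by linarith
  moreover have "0 \<le> \<bar>fst x\<bar> * \<bar>snd x\<bar>" by simp
  ultimately show ?thesis unfolding abs_mult by linarith
qed

lemma (in plan) second_moment_fst: "(\<integral>z. (norm (fst z))\<^sup>2 \<partial>\<gamma>) \<le> (\<integral>y. (norm y)\<^sup>2 \<partial>\<nu>)"
  using second_moment_tail[of 0] by simp

lemma (in plan) second_moment: "(\<integral>z. (norm z)\<^sup>2 \<partial>\<gamma>) \<le> 2 * (\<integral>y. (norm y)\<^sup>2 \<partial>\<nu>)"
proof -
  have "(\<integral>z. (norm (snd z))\<^sup>2 \<partial>\<gamma>) = (\<integral>y. (norm y)\<^sup>2 \<partial>\<nu>)"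
    by (rule integral_snd_eq) measurable
  then show ?thesis
    unfolding norm_sq_Pair[of "_ :: pt \<times> pt"]
    using second_moment_fst integrable_norm_sq_fst integrable_norm_sq_snd by simp
qed

theorem exists_optimal_plan:
  assumes \<nu>: "P2 \<nu>"
  shows "\<exists>\<gamma>. optimal_plan \<nu> \<gamma>"
proof -
  define Q where "Q \<gamma> = (\<integral>z. fst (fst z) * snd (fst z) \<partial>\<gamma>)" for \<gamma> :: "(pt \<times> pt) measure"
  define m where "m = (\<integral>y. (norm y)\<^sup>2 \<partial>\<nu>)"
  have s [measurable_cong]: "sets \<nu> = sets borel" using \<nu> by (simp add: P2_def)
  have m0: "0 \<le> m" by (simp add: m_def)
  have Qm: "Q \<gamma> \<le> m" if "\<gamma> \<in> Gamma \<nu>" for \<gamma>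
  proof -
    interpret plan \<nu> \<gamma> by unfold_locales fact
    have "Q \<gamma> \<le> (\<integral>z. (norm (fst z))\<^sup>2 \<partial>\<gamma>)"
      unfolding Q_def using integrable_products[of fst snd] integrable_norm_sq_fst
      by (intro integral_mono order_trans[OF abs_ge_self abs_mult_coord_le]) auto
    then show ?thesis using second_moment_fst by (simp add: m_def)
  qed
  have ne: "Gamma \<nu> \<noteq> {}" using diagonal_plan[OF \<nu>] by auto
  have bdd: "bdd_above (Q ` Gamma \<nu>)" using Qm by (intro bdd_aboveI2)
  define S where "S = (SUP \<gamma>\<in>Gamma \<nu>. Q \<gamma>)"
  have "\<exists>\<gamma>\<in>Gamma \<nu>. S - 1 / real (Suc n) < Q \<gamma>" for n
    using less_cSUP_iff[OF ne bdd, of "S - 1 / real (Suc n)"] by (simp add: S_def)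
  then obtain \<mu> where \<mu>: "\<And>n. \<mu> n \<in> Gamma \<nu>" "\<And>n. S - 1 / real (Suc n) < Q (\<mu> n)" by metis
  interpret P: plan \<nu> "\<mu> n" for n by unfold_locales (rule \<mu>)
  have tight: "\<exists>R. \<forall>n. measure (\<mu> n) {z. norm z \<ge> R} < \<epsilon>" if e: "0 < \<epsilon>" for \<epsilon>
  proof (intro exI allI)
    fix n
    \<comment> \<open>Markov's inequality with the second moment bound \<open>2 * m\<close>; the
      \<open>+ 1\<close> makes the final inequality strict.\<close>
    define c where "c = (2 * m + 1) / \<epsilon>"
    have c: "0 < c" using e m0 by (simp add: c_def)
    have "sqrt c \<le> norm z \<longleftrightarrow> c \<le> (norm z)\<^sup>2" for z :: "pt \<times> pt"
      using real_sqrt_le_iff[of c "(norm z)\<^sup>2"] by simp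
    then have "measure (\<mu> n) {z. norm z \<ge> sqrt c} = measure (\<mu> n) {z \<in> space (\<mu> n). (norm z)\<^sup>2 \<ge> c}"
      by (simp add: P.space_plan)
    also have "\<dots> \<le> (\<integral>z. (norm z)\<^sup>2 \<partial>\<mu> n) / c"
      using c P.integrable_norm_sq by (intro integral_Markov_inequality_measure[where A = "{}"]) auto
    also have "\<dots> \<le> 2 * m / c" using P.second_moment c by (simp add: m_def divide_right_mono)
    also have "\<dots> < \<epsilon>" using m0 e c by (simp add: c_def field_simps)
    finally show "measure (\<mu> n) {z. norm z \<ge> sqrt ((2 * m + 1) / \<epsilon>)} < \<epsilon>" by (simp add: c_def)
  qed
  obtain r M where r: "strict_mono (r :: nat \<Rightarrow> nat)" "prob_space M" "sets M = sets borel"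
    "\<And>f :: pt \<times> pt \<Rightarrow> real. continuous_on UNIV f \<Longrightarrow> bounded (range f) \<Longrightarrow>
       (\<lambda>n. integral\<^sup>L (\<mu> (r n)) f) \<longlonglongrightarrow> integral\<^sup>L M f"
    by (rule tight_imp_weakly_convergent_subsequence[OF P.prob_space_axioms P.sets_plan tight]) (assumption, rule that)
  interpret W: weak_limit "\<lambda>n. \<mu> (r n)" M
    by (rule weak_limit.intro[OF P.prob_space_axioms P.sets_plan r(2,3)]) (rule r(4))
  interpret M: prob_space M by (rule r)
  note [measurable_cong] = r(3) P.sets_plan
  have M2: "integrable M (\<lambda>z. (norm z)\<^sup>2)"
    using P.integrable_norm_sq P.second_moment
    by (intro W.integrable_limit[where C = "2 * m"]) (auto simp: m_def intro!: continuous_intros)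
  have M2': "integrable M (\<lambda>z. (norm (fst z))\<^sup>2)" "integrable M (\<lambda>z. (norm (snd z))\<^sup>2)"
    by (rule Bochner_Integration.integrable_bound[OF M2]; simp add: norm_sq_Pair)+
  have coordM: "integrable M (\<lambda>z. p (fst z))" "integrable M (\<lambda>z. p (snd z))" if p: "p \<in> {fst, snd}" for p :: "pt \<Rightarrow> real"
  proof -
    have [measurable]: "p \<in> borel_measurable borel" using p by auto
    show "integrable M (\<lambda>z. p (fst z))"
      by (rule M.square_integrable_imp_integrable[OF _ coord_L2[OF _ M2'(1) p]]) measurable
    show "integrable M (\<lambda>z. p (snd z))"
      by (rule M.square_integrable_imp_integrable[OF _ coord_L2[OF _ M2'(2) p]]) measurable
  qed
  \<comment> \<open>Along the sequence, integrals of functions of y are constant, so their limit is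
    the integral under \<open>\<nu>\<close>.\<close>
  have marg: "distr M borel snd = \<nu>"
  proof (rule prob_measure_eqI_continuous)
    show "prob_space (distr M borel snd)" by (intro M.prob_space_distr) measurable
    show "prob_space \<nu>" using \<nu> by (simp add: P2_def)
    show "sets (distr M borel snd) = sets borel" "sets \<nu> = sets borel" using s by auto
    fix f :: "pt \<Rightarrow> real" assume f: "continuous_on UNIV f" "bounded (range f)"
    have [measurable]: "f \<in> borel_measurable borel" by (rule borel_measurable_continuous_onI[OF f(1)])
    have "(\<lambda>n. \<integral>z. f (snd z) \<partial>\<mu> (r n)) \<longlonglongrightarrow> (\<integral>z. f (snd z) \<partial>M)"
      using f by (intro r(4) continuous_on_compose2[OF f(1)] continuous_intros) (auto intro: bounded_subset)
    then have "(\<lambda>n. \<integral>y. f y \<partial>\<nu>) \<longlonglongrightarrow> (\<integral>z. f (snd z) \<partial>M)"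
      using P.integral_snd_eq[of f] by simp
    then show "integral\<^sup>L (distr M borel snd) f = integral\<^sup>L \<nu> f"
      by (simp add: LIMSEQ_const_iff integral_distr)
  qed
  have mart: "(\<integral>z. indicator A (fst z) * (p (snd z) - p (fst z)) \<partial>M) = 0"
    if p: "p \<in> {fst, snd}" and A: "A \<in> sets borel" for p A
  proof (rule integral_indicator_eq_0_of_continuous[OF _ _ _ A])
    have [measurable]: "p \<in> borel_measurable borel" using p by auto
    have pc: "continuous_on UNIV p" using p by (auto intro!: continuous_intros)
    show "integrable M (\<lambda>z. p (snd z) - p (fst z))" using coordM[OF p] by simp
    fix f :: "pt \<Rightarrow> real" assume f: "continuous_on UNIV f" "bounded (range f)"
    then obtain B where B: "\<And>x. \<bar>f x\<bar> \<le> B" by (auto simp: bounded_iff)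
    have fm [measurable]: "f \<in> borel_measurable borel" by (rule borel_measurable_continuous_onI[OF f(1)])
    have le: "(f (fst z) * (p (snd z) - p (fst z)))\<^sup>2 \<le> 2 * B\<^sup>2 * (norm z)\<^sup>2" for z
    proof -
      have "(p (snd z) - p (fst z))\<^sup>2 \<le> 2 * (p (snd z))\<^sup>2 + 2 * (p (fst z))\<^sup>2"
        using zero_le_power2[of "p (snd z) + p (fst z)"] by (simp add: power2_eq_square algebra_simps)
      also have "\<dots> \<le> 2 * (norm z)\<^sup>2" using p unfolding norm_sq_Pair[of z] norm_sq_pt by auto
      finally have "(p (snd z) - p (fst z))\<^sup>2 \<le> 2 * (norm z)\<^sup>2" .
      moreover have "(f (fst z))\<^sup>2 \<le> B\<^sup>2" using power_mono[OF B[of "fst z"], of 2] by simp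
      ultimately have "(f (fst z))\<^sup>2 * (p (snd z) - p (fst z))\<^sup>2 \<le> B\<^sup>2 * (2 * (norm z)\<^sup>2)"
        by (intro mult_mono) auto
      then show ?thesis by (simp add: power_mult_distrib mult_ac)
    qed
    have int: "integrable (\<mu> n) (\<lambda>z. (f (fst z) * (p (snd z) - p (fst z)))\<^sup>2)" for n
    proof (rule Bochner_Integration.integrable_bound)
      show "integrable (\<mu> n) (\<lambda>z. 2 * B\<^sup>2 * (norm z)\<^sup>2)" using P.integrable_norm_sq by simp
      show "AE z in \<mu> n. norm ((f (fst z) * (p (snd z) - p (fst z)))\<^sup>2) \<le> norm (2 * B\<^sup>2 * (norm z)\<^sup>2)"
        using le by auto
    qed measurable
    \<comment> \<open>The integrand is unbounded but grows linearly, so the uniform second moment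
      bound already lets it pass to the limit.\<close>
    have "(\<lambda>n. \<integral>z. f (fst z) * (p (snd z) - p (fst z)) \<partial>\<mu> (r n)) \<longlonglongrightarrow> (\<integral>z. f (fst z) * (p (snd z) - p (fst z)) \<partial>M)"
    proof (rule W.integral_limit_L2[where C = "2 * B\<^sup>2 * (2 * m)"])
      show "continuous_on UNIV (\<lambda>z. f (fst z) * (p (snd z) - p (fst z)))"
        by (intro continuous_intros continuous_on_compose2[OF f(1)] continuous_on_compose2[OF pc]) auto
      show "integrable (\<mu> (r n)) (\<lambda>z. (f (fst z) * (p (snd z) - p (fst z)))\<^sup>2)" for n by (rule int)
      fix n
      have "(\<integral>z. (f (fst z) * (p (snd z) - p (fst z)))\<^sup>2 \<partial>\<mu> (r n)) \<le> (\<integral>z. 2 * B\<^sup>2 * (norm z)\<^sup>2 \<partial>\<mu> (r n))"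
        using int le P.integrable_norm_sq by (intro integral_mono) auto
      also have "\<dots> = 2 * B\<^sup>2 * (\<integral>z. (norm z)\<^sup>2 \<partial>\<mu> (r n))" by simp
      also have "\<dots> \<le> 2 * B\<^sup>2 * (2 * m)" using P.second_moment by (intro mult_left_mono) (auto simp: m_def)
      finally show "(\<integral>z. (f (fst z) * (p (snd z) - p (fst z)))\<^sup>2 \<partial>\<mu> (r n)) \<le> 2 * B\<^sup>2 * (2 * m)" .
    qed
    moreover have "(\<integral>z. f (fst z) * (p (snd z) - p (fst z)) \<partial>\<mu> n) = 0" for n
    proof (rule P.orthogonal[OF p fm])
      have "(f x)\<^sup>2 \<le> B\<^sup>2" for x using power_mono[OF B[of x], of 2] by simp
      then show "integrable (\<mu> n) (\<lambda>z. (f (fst z))\<^sup>2)" by (intro P.integrable_const_bound[where B = "B\<^sup>2"]) auto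
    qed
    ultimately show "(\<integral>z. f (fst z) * (p (snd z) - p (fst z)) \<partial>M) = 0" by (simp add: LIMSEQ_const_iff)
  qed measurable
  have id: "(\<lambda>z. z) \<in> borel_measurable M" by measurable
  have "distr M borel (\<lambda>z. (fst z, snd z)) \<in> Gamma \<nu>"
    by (rule Gamma_I[OF r(2) borel_measurable_fst'[OF id] borel_measurable_snd'[OF id] M2' marg mart])
  then have MG: "M \<in> Gamma \<nu>" by (simp add: distr_id2[OF r(3)[symmetric]])
  interpret PM: plan \<nu> M by unfold_locales (rule MG)
  \<comment> \<open>Quadratic growth: the moment bound no longer suffices, and the tails are
    controlled uniformly by those of \<open>\<nu>\<close> through
    \<open>second_moment_tail\<close>.\<close>
  have "(\<lambda>n. Q (\<mu> (r n))) \<longlonglongrightarrow> Q M"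
    unfolding Q_def
  proof (rule W.integral_limit)
    show "continuous_on UNIV (\<lambda>z::pt \<times> pt. fst (fst z) * snd (fst z))" by (intro continuous_intros)
    show "integrable (\<mu> (r n)) (\<lambda>z. fst (fst z) * snd (fst z))" "integrable M (\<lambda>z. fst (fst z) * snd (fst z))" for n
      using P.integrable_products[of fst snd] PM.integrable_products[of fst snd] by auto
    fix \<epsilon> :: real assume e: "0 < \<epsilon>"
    have "integrable \<nu> (\<lambda>y. (norm y)\<^sup>2)" using \<nu> by (simp add: P2_def)
    from order_tendstoD(2)[OF tail_integral_LIMSEQ[OF this] e]
    obtain K where K: "(\<integral>y. max 0 ((norm y)\<^sup>2 - real K) \<partial>\<nu>) \<le> \<epsilon>"
      unfolding eventually_sequentially by (auto intro: less_imp_le)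
    have "(\<integral>z. max 0 (\<bar>fst (fst z) * snd (fst z)\<bar> - real K) \<partial>\<mu> n) \<le> \<epsilon>" for n
    proof -
      have "(\<integral>z. max 0 (\<bar>fst (fst z) * snd (fst z)\<bar> - real K) \<partial>\<mu> n) \<le> (\<integral>z. max 0 ((norm (fst z))\<^sup>2 - real K) \<partial>\<mu> n)"
      proof (intro integral_mono)
        show "integrable (\<mu> n) (\<lambda>z. max 0 (\<bar>fst (fst z) * snd (fst z)\<bar> - real K))"
          by (rule Bochner_Integration.integrable_bound[OF P.integrable_products(1)[of fst snd]]) auto
        show "integrable (\<mu> n) (\<lambda>z. max 0 ((norm (fst z))\<^sup>2 - real K))"
          by (rule Bochner_Integration.integrable_bound[OF P.integrable_norm_sq_fst]) auto
        show "max 0 (\<bar>fst (fst z) * snd (fst z)\<bar> - real K) \<le> max 0 ((norm (fst z))\<^sup>2 - real K)" for z :: "pt \<times> pt"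
          using abs_mult_coord_le[of "fst z"] by auto
      qed
      also have "\<dots> \<le> (\<integral>y. max 0 ((norm y)\<^sup>2 - real K) \<partial>\<nu>)" by (rule P.second_moment_tail) simp
      finally show ?thesis using K by simp
    qed
    then show "\<exists>K\<ge>0. \<forall>n. (\<integral>z. max 0 (\<bar>fst (fst z) * snd (fst z)\<bar> - K) \<partial>\<mu> (r n)) \<le> \<epsilon>"
      by (intro exI[of _ "real K"]) auto
  qed
  moreover have "(\<lambda>n. S - 1 / real (Suc n)) \<longlonglongrightarrow> S - 0"
    by (intro tendsto_intros LIMSEQ_Suc[OF lim_1_over_n])
  moreover have "S - 1 / real (Suc n) \<le> Q (\<mu> (r n))" for n
  proof -
    have "1 / real (Suc (r n)) \<le> 1 / real (Suc n)" using seq_suble[OF r(1), of n] by (simp add: frac_le)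
    then show ?thesis using \<mu>(2)[of "r n"] by linarith
  qed
  ultimately have SQ: "S \<le> Q M" by (intro LIMSEQ_le[of "\<lambda>n. S - 1 / real (Suc n)" S]) auto
  have "total_cost M \<le> total_cost \<zeta>" if z: "\<zeta> \<in> Gamma \<nu>" for \<zeta>
  proof -
    interpret Z: plan \<nu> \<zeta> by unfold_locales (rule z)
    have "Q \<zeta> \<le> S" unfolding S_def using bdd z by (intro cSUP_upper)
    then show ?thesis using SQ unfolding PM.total_cost_eq Z.total_cost_eq by (simp add: Q_def)
  qed
  then show ?thesis using MG unfolding optimal_plan_def by blast
qed

section \<open>Variations of a plan\<close>

lemma integrable_mult_bounded:
  fixes f g :: "'a \<Rightarrow> real"
  assumes f: "integrable M f" and [measurable]: "g \<in> borel_measurable M" and g: "\<And>z. \<bar>g z\<bar> \<le> C"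
  shows "integrable M (\<lambda>z. f z * g z)"
proof (rule Bochner_Integration.integrable_bound)
  note [measurable] = borel_measurable_integrable[OF f]
  show "integrable M (\<lambda>z. C * f z)" using f by simp
  show "(\<lambda>z. f z * g z) \<in> borel_measurable M" by measurable
  show "AE z in M. norm (f z * g z) \<le> norm (C * f z)"
  proof (intro AE_I2)
    fix z
    have "\<bar>f z\<bar> * \<bar>g z\<bar> \<le> \<bar>f z\<bar> * \<bar>C\<bar>" using g[of z] by (intro mult_left_mono) auto
    then show "norm (f z * g z) \<le> norm (C * f z)" by (simp add: abs_mult mult.commute)
  qed
qed

text \<open>The law of a point \<open>z\<close> of \<open>M\<close> together with a coin showing
  \<open>True\<close> with probability \<open>k z\<close>. As a density on a product with counting
  measure it is accessible to Fubini.\<close>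

definition mixture :: "'a measure \<Rightarrow> ('a \<Rightarrow> real) \<Rightarrow> ('a \<times> bool) measure" where
  "mixture M k = density (M \<Otimes>\<^sub>M count_space UNIV) (\<lambda>w. ennreal (if snd w then k (fst w) else 1 - k (fst w)))"

locale mixing = prob_space M for M :: "'a measure" +
  fixes k :: "'a \<Rightarrow> real"
  assumes k_meas [measurable]: "k \<in> borel_measurable M" and k_range: "\<And>z. 0 \<le> k z" "\<And>z. k z \<le> 1"
begin

sublocale B: finite_measure "count_space (UNIV :: bool set)"
  by (rule finite_measure_count_space) simp

sublocale P: pair_sigma_finite M "count_space (UNIV :: bool set)" ..

lemma sets_mixture [measurable_cong]: "sets (mixture M k) = sets (M \<Otimes>\<^sub>M count_space UNIV)"
  by (simp add: mixture_def)

lemma weight_measurable [measurable]: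
  "(\<lambda>w. if snd w then k (fst w) else 1 - k (fst w)) \<in> borel_measurable (M \<Otimes>\<^sub>M count_space UNIV)"
  by measurable

lemma nn_integral_mixture:
  assumes [measurable]: "F \<in> borel_measurable (M \<Otimes>\<^sub>M count_space UNIV)"
  shows "(\<integral>\<^sup>+w. F w \<partial>mixture M k) = (\<integral>\<^sup>+z. ennreal (k z) * F (z, True) + ennreal (1 - k z) * F (z, False) \<partial>M)"
  unfolding mixture_def
  by (subst nn_integral_density, measurable, subst B.nn_integral_fst[symmetric], measurable)
     (simp add: nn_integral_count_space_finite UNIV_bool add.commute)

text \<open>The two weights add up to 1, so forgetting the coin restores \<open>M\<close>. Hence
  reassigning x after the coin toss leaves the y-marginal untouched.\<close>

lemma distr_mixture_fst: "distr (mixture M k) M fst = M"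
proof (rule measure_eqI)
  fix A assume "A \<in> sets (distr (mixture M k) M fst)"
  then have A [measurable]: "A \<in> sets M" by simp
  have "emeasure (distr (mixture M k) M fst) A = (\<integral>\<^sup>+z. indicator A z \<partial>distr (mixture M k) M fst)" by simp
  also have "\<dots> = (\<integral>\<^sup>+w. indicator A (fst w) \<partial>mixture M k)" by (subst nn_integral_distr) auto
  also have "\<dots> = (\<integral>\<^sup>+z. indicator A z \<partial>M)"
    by (subst nn_integral_mixture, measurable)
       (use k_range in \<open>simp add: distrib_right[symmetric] ennreal_plus[symmetric] del: ennreal_plus\<close>)
  finally show "emeasure (distr (mixture M k) M fst) A = emeasure M A" by simp
qed simp

lemma prob_space_mixture: "prob_space (mixture M k)"
proof -
  have "prob_space (distr (mixture M k) M fst)" unfolding distr_mixture_fst by (rule prob_space_axioms)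
  then show ?thesis by (rule prob_space_distrD[rotated]) measurable
qed

lemma
  fixes F :: "'a \<times> bool \<Rightarrow> real"
  assumes [measurable]: "F \<in> borel_measurable (M \<Otimes>\<^sub>M count_space UNIV)"
    and i: "integrable M (\<lambda>z. k z * F (z, True))" "integrable M (\<lambda>z. (1 - k z) * F (z, False))"
  shows integrable_mixture: "integrable (mixture M k) F"
    and integral_mixture: "(\<integral>w. F w \<partial>mixture M k) = (\<integral>z. k z * F (z, True) \<partial>M) + (\<integral>z. (1 - k z) * F (z, False) \<partial>M)"
proof -
  show int: "integrable (mixture M k) F"
  proof (rule integrableI_bounded)
    have "(\<integral>\<^sup>+w. ennreal (norm (F w)) \<partial>mixture M k) =
      (\<integral>\<^sup>+z. ennreal (norm (k z * F (z, True))) + ennreal (norm ((1 - k z) * F (z, False))) \<partial>M)"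
      using k_range by (subst nn_integral_mixture) (auto simp: abs_mult ennreal_mult)
    also have "\<dots> = (\<integral>\<^sup>+z. ennreal (norm (k z * F (z, True))) \<partial>M) + (\<integral>\<^sup>+z. ennreal (norm ((1 - k z) * F (z, False))) \<partial>M)"
      by (rule nn_integral_add) measurable
    also have "\<dots> < \<infinity>" using i unfolding integrable_iff_bounded by (simp add: less_top)
    finally show "(\<integral>\<^sup>+w. ennreal (norm (F w)) \<partial>mixture M k) < \<infinity>" .
  qed measurable
  define G where "G w = (if snd w then k (fst w) else 1 - k (fst w)) * F w" for w
  have G: "integrable (M \<Otimes>\<^sub>M count_space UNIV) G"
    using int k_range unfolding mixture_def G_def[abs_def] by (subst (asm) integrable_density) auto
  have "(\<integral>w. F w \<partial>mixture M k) = (\<integral>w. G w \<partial>(M \<Otimes>\<^sub>M count_space UNIV))"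
    unfolding mixture_def G_def using k_range by (subst integral_density) auto
  also have "\<dots> = (\<integral>z. \<integral>b. G (z, b) \<partial>count_space UNIV \<partial>M)"
    by (rule P.integral_fst'[symmetric, OF G])
  also have "\<dots> = (\<integral>z. k z * F (z, True) + (1 - k z) * F (z, False) \<partial>M)"
    by (simp add: lebesgue_integral_count_space_finite UNIV_bool G_def add.commute)
  also have "\<dots> = (\<integral>z. k z * F (z, True) \<partial>M) + (\<integral>z. (1 - k z) * F (z, False) \<partial>M)"
    using i by (rule Bochner_Integration.integral_add)
  finally show "(\<integral>w. F w \<partial>mixture M k) = (\<integral>z. k z * F (z, True) \<partial>M) + (\<integral>z. (1 - k z) * F (z, False) \<partial>M)" .
qed

end

text \<open>A conditional expectation respects the bounds of \<open>V\<close> only almost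
  everywhere. Clipping it changes nothing almost everywhere and makes them hold at every point,
  which keeps denominators away from 0 in the variation.\<close>

lemma (in plan) bounded_projection:
  fixes V :: "pt \<times> pt \<Rightarrow> real"
  assumes V [measurable]: "V \<in> borel_measurable borel" and ab: "\<And>z. a \<le> V z" "\<And>z. V z \<le> b"
  obtains v where "v \<in> borel_measurable sigma_fst" "\<And>z. a \<le> v z" "\<And>z. v z \<le> b"
    "\<And>f :: pt \<times> pt \<Rightarrow> real. f \<in> borel_measurable sigma_fst \<Longrightarrow> integrable \<gamma> f \<Longrightarrow> (\<integral>z. f z * V z \<partial>\<gamma>) = (\<integral>z. f z * v z \<partial>\<gamma>)"
proof
  define v where "v z = max a (min b (real_cond_exp \<gamma> sigma_fst V z))" for z
  show vm: "v \<in> borel_measurable sigma_fst" unfolding v_def by measurable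
  have "a \<le> b" using ab[of undefined] by linarith
  then show "a \<le> v z" "v z \<le> b" for z by (auto simp: v_def)
  have Vm: "V \<in> borel_measurable \<gamma>" by measurable
  have Vb: "\<bar>V z\<bar> \<le> max \<bar>a\<bar> \<bar>b\<bar>" for z using ab[of z] by auto
  have iV: "integrable \<gamma> V" using Vm Vb by (intro integrable_const_bound[of _ "max \<bar>a\<bar> \<bar>b\<bar>"]) auto
  have "AE z in \<gamma>. a \<le> real_cond_exp \<gamma> sigma_fst V z" using ab iV by (intro fm.real_cond_exp_ge_c) auto
  moreover have "AE z in \<gamma>. real_cond_exp \<gamma> sigma_fst V z \<le> b" using ab iV by (intro fm.real_cond_exp_le_c) auto
  ultimately have AE: "AE z in \<gamma>. real_cond_exp \<gamma> sigma_fst V z = v z" by eventually_elim (simp add: v_def)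
  fix f :: "pt \<times> pt \<Rightarrow> real" assume f: "f \<in> borel_measurable sigma_fst" "integrable \<gamma> f"
  have vm': "v \<in> borel_measurable \<gamma>" by (rule measurable_from_subalg[OF subalgebra_fst vm])
  have fm': "f \<in> borel_measurable \<gamma>" using f by auto
  have "(\<integral>z. f z * V z \<partial>\<gamma>) = (\<integral>z. f z * real_cond_exp \<gamma> sigma_fst V z \<partial>\<gamma>)"
    by (rule fm.real_cond_exp_intg(2)[symmetric, OF integrable_mult_bounded[OF f(2) Vm Vb] f(1) Vm])
  also have "\<dots> = (\<integral>z. f z * v z \<partial>\<gamma>)"
    by (intro integral_cong_AE) (use AE fm' vm' in auto)
  finally show "(\<integral>z. f z * V z \<partial>\<gamma>) = (\<integral>z. f z * v z \<partial>\<gamma>)" .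
qed

text \<open>A fraction \<open>\<epsilon> * h\<close> of the mass of \<open>\<gamma>\<close> is transported to its barycentre \<open>c\<close>, and the remaining
  mass to its new conditional mean \<open>m p z = p (fst z) - \<epsilon> * d p z / (1 - \<epsilon> * e z)\<close>, where \<open>e\<close> and
  \<open>d p\<close> are the conditional expectations of \<open>h\<close> and of \<open>h\<close> times the increment.\<close>

lemma (in plan) variation:
  fixes h :: "pt \<times> pt \<Rightarrow> real"
  assumes hm [measurable]: "h \<in> borel_measurable borel"
    and h01: "\<And>z. 0 \<le> h z" "\<And>z. h z \<le> 1" and supp: "\<And>z. h z \<noteq> 0 \<Longrightarrow> norm z \<le> R" and R: "0 \<le> R"
    and H: "0 < (\<integral>z. h z \<partial>\<gamma>)" and \<epsilon>: "0 < \<epsilon>" "\<epsilon> \<le> 1/2"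
  obtains \<zeta> where "\<zeta> \<in> Gamma \<nu>"
    "(\<integral>z. fst (fst z) * snd (fst z) \<partial>\<zeta>) \<ge> (\<integral>z. fst (fst z) * snd (fst z) \<partial>\<gamma>)
       + \<epsilon> * ((\<integral>z. h z * fst (snd z) \<partial>\<gamma>) * (\<integral>z. h z * snd (snd z) \<partial>\<gamma>) / (\<integral>z. h z \<partial>\<gamma>)
            - (\<integral>z. h z * (fst (snd z) * snd (snd z) - cst (fst z) (snd z)) \<partial>\<gamma>))
       - \<epsilon>\<^sup>2 * (4 * R)\<^sup>2"
proof -
  \<comment> \<open>Where \<open>h\<close> is nonzero all coordinates of x and y are at most
    \<open>R\<close> in absolute value, so their increments are at most
    \<open>2 * R\<close>.\<close>
  define D where "D = 2 * R"
  have fstsnd: "fst \<in> {fst, snd}" "snd \<in> {fst, snd}" by auto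
  have inc_le: "\<bar>h z * (p (snd z) - p (fst z))\<bar> \<le> D" and coord_le: "\<bar>h z * p (snd z)\<bar> \<le> D"
    if p: "p \<in> {fst, snd}" for p z
  proof -
    have "\<bar>p (fst z)\<bar> \<le> norm z" "\<bar>p (snd z)\<bar> \<le> norm z"
      using p norm_fst_le[of "fst z" "snd z"] norm_snd_le[of "snd z" "fst z"]
        norm_fst_le[of "fst (fst z)" "snd (fst z)"] norm_snd_le[of "snd (fst z)" "fst (fst z)"]
        norm_fst_le[of "fst (snd z)" "snd (snd z)"] norm_snd_le[of "snd (snd z)" "fst (snd z)"]
      by auto
    then have "h z * \<bar>p (snd z) - p (fst z)\<bar> \<le> 1 * D \<and> h z * \<bar>p (snd z)\<bar> \<le> 1 * D"
    proof (cases "h z = 0")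
      case False
      then have "norm z \<le> R" by (rule supp)
      then show ?thesis
        using \<open>\<bar>p (fst z)\<bar> \<le> norm z\<close> \<open>\<bar>p (snd z)\<bar> \<le> norm z\<close> h01[of z] R
        by (intro conjI mult_mono) (auto simp: D_def)
    qed (use R in \<open>simp add: D_def\<close>)
    then show "\<bar>h z * (p (snd z) - p (fst z))\<bar> \<le> D" "\<bar>h z * p (snd z)\<bar> \<le> D"
      using h01[of z] by (simp_all add: abs_mult)
  qed
  obtain e where e [measurable]: "e \<in> borel_measurable sigma_fst" and e01: "\<And>z. 0 \<le> e z" "\<And>z. e z \<le> 1"
    and e_int: "\<And>f. f \<in> borel_measurable sigma_fst \<Longrightarrow> integrable \<gamma> f \<Longrightarrow> (\<integral>z. f z * h z \<partial>\<gamma>) = (\<integral>z. f z * e z \<partial>\<gamma>)"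
    by (rule bounded_projection[OF hm h01]) (rule that)
  \<comment> \<open>\<open>v\<close> is a bounded version of the conditional expectation, given x,
    of \<open>h\<close> times the \<open>p\<close>-increment. Packed into one predicate, it allows a
    simultaneous choice for both coordinates.\<close>
  define cond where "cond p v \<longleftrightarrow> v \<in> borel_measurable sigma_fst \<and> (\<forall>z. \<bar>v z\<bar> \<le> D) \<and>
    (\<forall>f. f \<in> borel_measurable sigma_fst \<longrightarrow> integrable \<gamma> f \<longrightarrow>
      (\<integral>z. f z * (h z * (p (snd z) - p (fst z))) \<partial>\<gamma>) = (\<integral>z. f z * v z \<partial>\<gamma>))"
    for p :: "pt \<Rightarrow> real" and v
  have "\<exists>v. cond p v" if p: "p \<in> {fst, snd}" for p
  proof -
    from p have [measurable]: "p \<in> borel_measurable borel" by auto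
    have "(\<lambda>z. h z * (p (snd z) - p (fst z))) \<in> borel_measurable borel" by measurable
    moreover have "- D \<le> h z * (p (snd z) - p (fst z))" "h z * (p (snd z) - p (fst z)) \<le> D" for z
      using inc_le[OF p, of z] by auto
    ultimately obtain v where "v \<in> borel_measurable sigma_fst" "\<And>z. - D \<le> v z" "\<And>z. v z \<le> D"
      "\<And>f. f \<in> borel_measurable sigma_fst \<Longrightarrow> integrable \<gamma> f \<Longrightarrow>
        (\<integral>z. f z * (h z * (p (snd z) - p (fst z))) \<partial>\<gamma>) = (\<integral>z. f z * v z \<partial>\<gamma>)"
      by (rule bounded_projection) (rule that)
    then have "cond p v" unfolding cond_def by (simp add: abs_le_iff minus_le_iff)
    then show ?thesis by (intro exI[of _ v])
  qed
  then have "\<forall>p\<in>{fst, snd}. \<exists>v. cond p v" by simp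
  from bchoice[OF this] obtain d where cond: "\<forall>p\<in>{fst, snd}. cond p (d p)" ..
  have d: "d p \<in> borel_measurable sigma_fst" "\<bar>d p z\<bar> \<le> D"
    and d_int: "f \<in> borel_measurable sigma_fst \<Longrightarrow> integrable \<gamma> f \<Longrightarrow>
        (\<integral>z. f z * (h z * (p (snd z) - p (fst z))) \<partial>\<gamma>) = (\<integral>z. f z * d p z \<partial>\<gamma>)"
    if "p \<in> {fst, snd}" for p z f
    using bspec[OF cond that] unfolding cond_def by blast+
  \<comment> \<open>Given x, the proportion of mass that stays is \<open>1 - \<epsilon> * e\<close>,
    at least 1/2 because \<open>\<epsilon> \<le> 1/2\<close>; dividing by it yields the shift of the
    mean per unit of \<open>\<epsilon>\<close>, bounded by \<open>2 * D\<close>.\<close>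
  define \<delta> where "\<delta> p z = d p z / (1 - \<epsilon> * e z)" for p z
  define m where "m z = (fst (fst z) - \<epsilon> * \<delta> fst z, snd (fst z) - \<epsilon> * \<delta> snd z)" for z
  define c where "c = ((\<integral>z. h z * fst (snd z) \<partial>\<gamma>) / (\<integral>z. h z \<partial>\<gamma>), (\<integral>z. h z * snd (snd z) \<partial>\<gamma>) / (\<integral>z. h z \<partial>\<gamma>))"
  have m_eq: "p (m z) = p (fst z) - \<epsilon> * \<delta> p z" if "p \<in> {fst, snd}" for p z
    using that by (auto simp: m_def)
  have c_eq: "p c = (\<integral>z. h z * p (snd z) \<partial>\<gamma>) / (\<integral>z. h z \<partial>\<gamma>)" if "p \<in> {fst, snd}" for p
    using that by (auto simp: c_def)
  have den: "1/2 \<le> 1 - \<epsilon> * e z" for z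
    using mult_mono[of \<epsilon> "1/2" "e z" 1] \<epsilon> e01[of z] by simp
  have \<delta>m: "\<delta> p \<in> borel_measurable sigma_fst" if "p \<in> {fst, snd}" for p
    unfolding \<delta>_def[abs_def] using d(1)[OF that] by measurable
  have \<delta>_le: "\<bar>\<delta> p z\<bar> \<le> 2 * D" if p: "p \<in> {fst, snd}" for p z
  proof -
    have "\<bar>d p z\<bar> / \<bar>1 - \<epsilon> * e z\<bar> \<le> D / (1/2)"
      using den[of z] d(2)[OF p, of z] R by (intro frac_le) (auto simp: D_def)
    then show ?thesis by (simp add: \<delta>_def)
  qed
  have sub: "f \<in> borel_measurable \<gamma>" if "f \<in> borel_measurable sigma_fst" for f :: "pt \<times> pt \<Rightarrow> real"
    by (rule measurable_from_subalg[OF subalgebra_fst that])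
  have em' [measurable]: "e \<in> borel_measurable \<gamma>" by (rule sub[OF e])
  have hm' [measurable]: "h \<in> borel_measurable \<gamma>" by measurable
  have dm' [measurable]: "\<delta> fst \<in> borel_measurable \<gamma>" "\<delta> snd \<in> borel_measurable \<gamma>"
    using sub[OF \<delta>m] by auto
  have mm [measurable]: "m \<in> borel_measurable \<gamma>" unfolding m_def[abs_def] by measurable
  have mm_sigma: "m \<in> borel_measurable sigma_fst"
    unfolding m_def[abs_def]
    using measurable_sigma_fst[of fst] measurable_sigma_fst[of snd] \<delta>m fstsnd
    by (intro borel_measurable_Pair borel_measurable_diff borel_measurable_times) auto
  have h_abs: "\<bar>h z\<bar> \<le> 1" for z using h01[of z] by auto
  have eh: "0 \<le> \<epsilon> * h z" "\<epsilon> * h z \<le> 1" for z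
    using \<epsilon> h01[of z] mult_mono[of \<epsilon> 1 "h z" 1] by auto
  have eh_abs: "\<bar>\<epsilon> * h z\<bar> \<le> 1" "\<bar>1 - \<epsilon> * h z\<bar> \<le> 1" for z using eh[of z] by auto
  \<comment> \<open>Conditioning replaces \<open>h\<close> by \<open>e\<close>, which cancels the denominator of \<open>\<delta> p\<close>.\<close>
  have key: "(\<integral>z. f z * \<delta> p z * (1 - \<epsilon> * h z) \<partial>\<gamma>) = (\<integral>z. f z * (h z * (p (snd z) - p (fst z))) \<partial>\<gamma>)"
    if p: "p \<in> {fst, snd}" and f: "f \<in> borel_measurable sigma_fst" "integrable \<gamma> f" for p f
  proof -
    have i: "integrable \<gamma> (\<lambda>z. f z * \<delta> p z)"
      by (rule integrable_mult_bounded[OF f(2) sub[OF \<delta>m[OF p]] \<delta>_le[OF p]])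
    have fm: "(\<lambda>z. f z * \<delta> p z) \<in> borel_measurable sigma_fst" using f(1) \<delta>m[OF p] by measurable
    have ih: "integrable \<gamma> (\<lambda>z. f z * \<delta> p z * h z)" by (rule integrable_mult_bounded[OF i hm' h_abs])
    have ie: "integrable \<gamma> (\<lambda>z. f z * \<delta> p z * e z)"
      by (rule integrable_mult_bounded[OF i em', of 1]) (use e01 in auto)
    have "(\<integral>z. f z * \<delta> p z * (1 - \<epsilon> * h z) \<partial>\<gamma>) = (\<integral>z. f z * \<delta> p z - \<epsilon> * (f z * \<delta> p z * h z) \<partial>\<gamma>)"
      by (simp add: algebra_simps)
    also have "\<dots> = (\<integral>z. f z * \<delta> p z \<partial>\<gamma>) - \<epsilon> * (\<integral>z. f z * \<delta> p z * e z \<partial>\<gamma>)"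
      using i ih e_int[OF fm i] by simp
    also have "\<dots> = (\<integral>z. f z * \<delta> p z - \<epsilon> * (f z * \<delta> p z * e z) \<partial>\<gamma>)" using i ie by simp
    also have "\<dots> = (\<integral>z. f z * d p z \<partial>\<gamma>)"
    proof (intro Bochner_Integration.integral_cong refl)
      fix z
      have "\<delta> p z * (1 - \<epsilon> * e z) = d p z" using den[of z] by (simp add: \<delta>_def)
      then have "f z * (\<delta> p z * (1 - \<epsilon> * e z)) = f z * d p z" by simp
      then show "f z * \<delta> p z - \<epsilon> * (f z * \<delta> p z * e z) = f z * d p z" by (simp add: algebra_simps)
    qed
    finally show ?thesis using d_int[OF p f] by simp
  qed
  interpret mix: mixing \<gamma> "\<lambda>z. \<epsilon> * h z"
    by unfold_locales (use eh in auto)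
  let ?\<Omega> = "mixture \<gamma> (\<lambda>z. \<epsilon> * h z)"
  define X where "X w = (if snd w then c else m (fst w))" for w :: "(pt \<times> pt) \<times> bool"
  define Y where "Y w = snd (fst w)" for w :: "(pt \<times> pt) \<times> bool"
  have Xm [measurable]: "X \<in> borel_measurable (\<gamma> \<Otimes>\<^sub>M count_space UNIV)" unfolding X_def[abs_def] by measurable
  have Ym [measurable]: "Y \<in> borel_measurable (\<gamma> \<Otimes>\<^sub>M count_space UNIV)" unfolding Y_def[abs_def] by measurable
  have Xm': "X \<in> borel_measurable ?\<Omega>" and Ym': "Y \<in> borel_measurable ?\<Omega>" by measurable
  have mix_int: "integrable ?\<Omega> F"
    and mix_eq: "(\<integral>w. F w \<partial>?\<Omega>) = (\<integral>z. \<epsilon> * h z * F (z, True) \<partial>\<gamma>) + (\<integral>z. (1 - \<epsilon> * h z) * F (z, False) \<partial>\<gamma>)"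
    if F: "F \<in> borel_measurable (\<gamma> \<Otimes>\<^sub>M count_space UNIV)"
      and i: "integrable \<gamma> (\<lambda>z. F (z, True))" "integrable \<gamma> (\<lambda>z. F (z, False))" for F :: "(pt \<times> pt) \<times> bool \<Rightarrow> real"
  proof -
    have "integrable \<gamma> (\<lambda>z. F (z, True) * (\<epsilon> * h z))"
      by (rule integrable_mult_bounded[OF i(1) _ eh_abs(1)]) measurable
    then have i1: "integrable \<gamma> (\<lambda>z. \<epsilon> * h z * F (z, True))" by (simp add: mult.commute)
    have "integrable \<gamma> (\<lambda>z. F (z, False) * (1 - \<epsilon> * h z))"
      by (rule integrable_mult_bounded[OF i(2) _ eh_abs(2)]) measurable
    then have i2: "integrable \<gamma> (\<lambda>z. (1 - \<epsilon> * h z) * F (z, False))" by (simp add: mult.commute)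
    show "integrable ?\<Omega> F"
      "(\<integral>w. F w \<partial>?\<Omega>) = (\<integral>z. \<epsilon> * h z * F (z, True) \<partial>\<gamma>) + (\<integral>z. (1 - \<epsilon> * h z) * F (z, False) \<partial>\<gamma>)"
      using mix.integrable_mixture[OF F i1 i2] mix.integral_mixture[OF F i1 i2] by auto
  qed
  have L2m: "integrable \<gamma> (\<lambda>z. (p (m z))\<^sup>2)" if p: "p \<in> {fst, snd}" for p
  proof (rule Bochner_Integration.integrable_bound)
    have [measurable]: "p \<in> borel_measurable borel" using p by auto
    show "(\<lambda>z. (p (m z))\<^sup>2) \<in> borel_measurable \<gamma>" by measurable
    show "integrable \<gamma> (\<lambda>z. 2 * (p (fst z))\<^sup>2 + 2 * (2 * D)\<^sup>2)" using L2_fst[OF p] by simp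
    show "AE z in \<gamma>. norm ((p (m z))\<^sup>2) \<le> norm (2 * (p (fst z))\<^sup>2 + 2 * (2 * D)\<^sup>2)"
    proof (intro AE_I2)
      fix z
      have "\<bar>\<epsilon> * \<delta> p z\<bar> \<le> 1 * (2 * D)"
        unfolding abs_mult using \<epsilon> \<delta>_le[OF p, of z] by (intro mult_mono) auto
      then have "(\<epsilon> * \<delta> p z)\<^sup>2 \<le> (2 * D)\<^sup>2" using power_mono[of "\<bar>\<epsilon> * \<delta> p z\<bar>" "2 * D" 2] by simp
      moreover have "(p (m z))\<^sup>2 \<le> 2 * (p (fst z))\<^sup>2 + 2 * (\<epsilon> * \<delta> p z)\<^sup>2"
        unfolding m_eq[OF p] using zero_le_power2[of "p (fst z) + \<epsilon> * \<delta> p z"]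
        unfolding power2_sum power2_diff by linarith
      ultimately show "norm ((p (m z))\<^sup>2) \<le> norm (2 * (p (fst z))\<^sup>2 + 2 * (2 * D)\<^sup>2)" by simp
    qed
  qed
  have im: "integrable \<gamma> (\<lambda>z. p (m z))" and iy: "integrable \<gamma> (\<lambda>z. p (snd z))" and ix: "integrable \<gamma> (\<lambda>z. p (fst z))"
    if p: "p \<in> {fst, snd}" for p
  proof -
    have [measurable]: "p \<in> borel_measurable borel" using p by auto
    show "integrable \<gamma> (\<lambda>z. p (m z))" by (rule square_integrable_imp_integrable[OF _ L2m[OF p]]) measurable
    show "integrable \<gamma> (\<lambda>z. p (snd z))" by (rule square_integrable_imp_integrable[OF _ L2_snd[OF p]]) measurable
    show "integrable \<gamma> (\<lambda>z. p (fst z))" by (rule square_integrable_imp_integrable[OF _ L2_fst[OF p]]) measurable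
  qed
  have X2: "integrable ?\<Omega> (\<lambda>w. (p (X w))\<^sup>2)" and Y2: "integrable ?\<Omega> (\<lambda>w. (p (Y w))\<^sup>2)"
    if p: "p \<in> {fst, snd}" for p
  proof -
    have [measurable]: "p \<in> borel_measurable borel" using p by auto
    show "integrable ?\<Omega> (\<lambda>w. (p (X w))\<^sup>2)"
      by (rule mix_int, measurable) (use L2m[OF p] in \<open>simp_all add: X_def\<close>)
    show "integrable ?\<Omega> (\<lambda>w. (p (Y w))\<^sup>2)"
      by (rule mix_int, measurable) (use L2_snd[OF p] in \<open>simp_all add: Y_def\<close>)
  qed
  have marg: "distr ?\<Omega> borel Y = \<nu>"
  proof -
    have "distr ?\<Omega> borel Y = distr (distr ?\<Omega> \<gamma> fst) borel snd"
      unfolding Y_def[abs_def] by (subst distr_distr) (auto simp: comp_def)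
    then show ?thesis by (simp add: mix.distr_mixture_fst distr_snd)
  qed
  have mart: "(\<integral>w. indicator A (X w) * (p (Y w) - p (X w)) \<partial>?\<Omega>) = 0"
    if p: "p \<in> {fst, snd}" and A: "A \<in> sets borel" for p A
  proof -
    have pm [measurable]: "p \<in> borel_measurable borel" using p by auto
    note [measurable] = A
    define g where "g z = (indicator A (m z) :: real)" for z
    have gs: "g \<in> borel_measurable sigma_fst"
      unfolding g_def[abs_def] by (rule measurable_compose[OF mm_sigma]) measurable
    have gm [measurable]: "g \<in> borel_measurable \<gamma>" by (rule sub[OF gs])
    have g1: "\<bar>g z\<bar> \<le> 1" for z by (simp add: g_def split: split_indicator)
    have gi: "integrable \<gamma> g" using g1 by (intro integrable_const_bound[of _ 1]) auto
    have g2: "integrable \<gamma> (\<lambda>z. (g z)\<^sup>2)"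
      by (intro integrable_const_bound[of _ 1]) (auto simp: g_def split: split_indicator)
    have inc: "integrable \<gamma> (\<lambda>z. (p (snd z) - p (fst z)) * g z)"
      using ix[OF p] iy[OF p] by (intro integrable_mult_bounded[OF _ gm g1]) auto
    have hinc: "integrable \<gamma> (\<lambda>z. g z * (h z * (p (snd z) - p (fst z))))"
      by (rule integrable_mult_bounded[OF gi _ inc_le[OF p]]) measurable
    have dp: "integrable \<gamma> (\<lambda>z. g z * \<delta> p z * (1 - \<epsilon> * h z))"
      using integrable_mult_bounded[OF integrable_mult_bounded[OF gi sub[OF \<delta>m[OF p]] \<delta>_le[OF p]] _ eh_abs(2)] by simp
    \<comment> \<open>For the mass that stays, the old increment is orthogonal to \<open>g\<close>,
      a function of x, and by \<open>key\<close> the two terms of order \<open>\<epsilon>\<close>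
      cancel. This is the statement that \<open>m\<close> is the new conditional mean.\<close>
    have "(\<integral>z. (1 - \<epsilon> * h z) * (indicator A (m z) * (p (snd z) - p (m z))) \<partial>\<gamma>) =
      (\<integral>z. (p (snd z) - p (fst z)) * g z - \<epsilon> * (g z * (h z * (p (snd z) - p (fst z)))) + \<epsilon> * (g z * \<delta> p z * (1 - \<epsilon> * h z)) \<partial>\<gamma>)"
      unfolding m_eq[OF p] g_def[symmetric] by (intro Bochner_Integration.integral_cong) (auto simp: algebra_simps)
    also have "\<dots> = (\<integral>z. (p (snd z) - p (fst z)) * g z \<partial>\<gamma>)"
      using inc hinc dp key[OF p gs gi] by simp
    also have "\<dots> = 0" using orthogonal_sigma[OF p gs g2] by (simp add: mult.commute)
    finally have second: "(\<integral>z. (1 - \<epsilon> * h z) * (indicator A (m z) * (p (snd z) - p (m z))) \<partial>\<gamma>) = 0" .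
    have ih: "integrable \<gamma> h" using h_abs by (intro integrable_const_bound[of _ 1]) auto
    have ihy: "integrable \<gamma> (\<lambda>z. h z * p (snd z))"
      using coord_le[OF p] by (intro integrable_const_bound[of _ D]) auto
    have "(\<integral>z. \<epsilon> * h z * (indicator A c * (p (snd z) - p c)) \<partial>\<gamma>) =
      (\<integral>z. \<epsilon> * indicator A c * (h z * p (snd z) - p c * h z) \<partial>\<gamma>)"
      by (intro Bochner_Integration.integral_cong) (auto simp: algebra_simps)
    also have "\<dots> = \<epsilon> * indicator A c * ((\<integral>z. h z * p (snd z) \<partial>\<gamma>) - p c * (\<integral>z. h z \<partial>\<gamma>))"
      using ih ihy by simp
    also have "\<dots> = 0" using H by (simp add: c_eq[OF p])
    finally have first: "(\<integral>z. \<epsilon> * h z * (indicator A c * (p (snd z) - p c)) \<partial>\<gamma>) = 0" .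
    have "(\<integral>w. indicator A (X w) * (p (Y w) - p (X w)) \<partial>?\<Omega>) =
      (\<integral>z. \<epsilon> * h z * (indicator A c * (p (snd z) - p c)) \<partial>\<gamma>)
      + (\<integral>z. (1 - \<epsilon> * h z) * (indicator A (m z) * (p (snd z) - p (m z))) \<partial>\<gamma>)"
    proof (subst mix_eq)
      show "integrable \<gamma> (\<lambda>z. indicator A (X (z, True)) * (p (Y (z, True)) - p (X (z, True))))"
        using iy[OF p] by (simp add: X_def Y_def)
      have "integrable \<gamma> (\<lambda>z. (p (snd z) - p (m z)) * g z)"
        using im[OF p] iy[OF p] by (intro integrable_mult_bounded[OF _ gm g1]) auto
      then show "integrable \<gamma> (\<lambda>z. indicator A (X (z, False)) * (p (Y (z, False)) - p (X (z, False))))"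
        by (simp add: X_def Y_def g_def mult.commute)
    qed (measurable, simp add: X_def Y_def)
    then show ?thesis unfolding first second by simp
  qed
  define \<zeta> where "\<zeta> = distr ?\<Omega> borel (\<lambda>w. (X w, Y w))"
  have \<zeta>: "\<zeta> \<in> Gamma \<nu>"
    unfolding \<zeta>_def
    by (rule Gamma_I[OF mix.prob_space_mixture Xm' Ym' norm_L2[OF Xm'] norm_L2[OF Ym'] marg mart])
       (use X2 Y2 fstsnd in auto)
  have xx: "integrable \<gamma> (\<lambda>z. fst (fst z) * snd (fst z))" by (rule integrable_products) auto
  have hxx: "integrable \<gamma> (\<lambda>z. fst (fst z) * snd (fst z) * h z)"
    by (rule integrable_mult_bounded[OF xx hm' h_abs])
  have xs: "fst \<circ> fst \<in> borel_measurable sigma_fst" "snd \<circ> fst \<in> borel_measurable sigma_fst"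
    using measurable_sigma_fst[of fst] measurable_sigma_fst[of snd] by (simp_all add: comp_def)
  have key1: "(\<integral>z. fst (fst z) * \<delta> snd z * (1 - \<epsilon> * h z) \<partial>\<gamma>) = (\<integral>z. fst (fst z) * (h z * (snd (snd z) - snd (fst z))) \<partial>\<gamma>)"
    using key[OF fstsnd(2) xs(1)] ix[OF fstsnd(1)] by (simp add: comp_def)
  have key2: "(\<integral>z. snd (fst z) * \<delta> fst z * (1 - \<epsilon> * h z) \<partial>\<gamma>) = (\<integral>z. snd (fst z) * (h z * (fst (snd z) - fst (fst z))) \<partial>\<gamma>)"
    using key[OF fstsnd(1) xs(2)] ix[OF fstsnd(2)] by (simp add: comp_def)
  have i1: "integrable \<gamma> (\<lambda>z. fst (fst z) * \<delta> snd z * (1 - \<epsilon> * h z))"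
    "integrable \<gamma> (\<lambda>z. snd (fst z) * \<delta> fst z * (1 - \<epsilon> * h z))"
    by (rule integrable_mult_bounded[OF integrable_mult_bounded[OF ix _ \<delta>_le] _ eh_abs(2)]; use fstsnd in simp)+
  have i2: "integrable \<gamma> (\<lambda>z. fst (fst z) * (h z * (snd (snd z) - snd (fst z))))"
    by (rule integrable_mult_bounded[OF ix _ inc_le]; use fstsnd in simp)
  have i3: "integrable \<gamma> (\<lambda>z. snd (fst z) * (h z * (fst (snd z) - fst (fst z))))"
    by (rule integrable_mult_bounded[OF ix _ inc_le]; use fstsnd in simp)
  \<comment> \<open>The coefficient of the second-order term; the constant is (2 D)^2 with D = 2
    R.\<close>
  have rest_le: "\<bar>\<delta> fst z * \<delta> snd z * (1 - \<epsilon> * h z)\<bar> \<le> (4 * R)\<^sup>2" for z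
  proof -
    have "\<bar>\<delta> fst z\<bar> * \<bar>\<delta> snd z\<bar> * \<bar>1 - \<epsilon> * h z\<bar> \<le> (2 * D) * (2 * D) * 1"
      using \<delta>_le[OF fstsnd(1), of z] \<delta>_le[OF fstsnd(2), of z] eh_abs(2)[of z] R
      by (intro mult_mono) (auto simp: D_def)
    then show ?thesis by (simp add: abs_mult D_def power2_eq_square)
  qed
  have i4: "integrable \<gamma> (\<lambda>z. \<delta> fst z * \<delta> snd z * (1 - \<epsilon> * h z))"
    using rest_le by (intro integrable_const_bound[of _ "(4 * R)\<^sup>2"]) auto
  have "(\<integral>z. - ((4 * R)\<^sup>2) \<partial>\<gamma>) \<le> (\<integral>z. \<delta> fst z * \<delta> snd z * (1 - \<epsilon> * h z) \<partial>\<gamma>)"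
    using rest_le by (intro integral_mono i4) (auto simp: abs_le_iff minus_le_iff)
  then have rest: "- ((4 * R)\<^sup>2) \<le> (\<integral>z. \<delta> fst z * \<delta> snd z * (1 - \<epsilon> * h z) \<partial>\<gamma>)" by (simp add: prob_space)
  \<comment> \<open>y1 y2 - c(x, y) is the first-order Taylor expansion of the product of the
    coordinates at x, evaluated at y. In this form it matches the first-order loss of the recentred
    mass.\<close>
  have hq: "(\<integral>z. h z * (fst (snd z) * snd (snd z) - cst (fst z) (snd z)) \<partial>\<gamma>) =
     (\<integral>z. fst (fst z) * snd (fst z) * h z \<partial>\<gamma>) + (\<integral>z. fst (fst z) * (h z * (snd (snd z) - snd (fst z))) \<partial>\<gamma>)
     + (\<integral>z. snd (fst z) * (h z * (fst (snd z) - fst (fst z))) \<partial>\<gamma>)"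
  proof -
    have "(\<integral>z. h z * (fst (snd z) * snd (snd z) - cst (fst z) (snd z)) \<partial>\<gamma>) =
      (\<integral>z. fst (fst z) * snd (fst z) * h z + fst (fst z) * (h z * (snd (snd z) - snd (fst z)))
        + snd (fst z) * (h z * (fst (snd z) - fst (fst z))) \<partial>\<gamma>)"
      by (intro Bochner_Integration.integral_cong) (auto simp: cst_def algebra_simps)
    then show ?thesis using hxx i2 i3 by simp
  qed
  have "(\<integral>z. (1 - \<epsilon> * h z) * (fst (m z) * snd (m z)) \<partial>\<gamma>) =
    (\<integral>z. fst (fst z) * snd (fst z) - \<epsilon> * (fst (fst z) * snd (fst z) * h z)
      - \<epsilon> * (fst (fst z) * \<delta> snd z * (1 - \<epsilon> * h z)) - \<epsilon> * (snd (fst z) * \<delta> fst z * (1 - \<epsilon> * h z))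
      + \<epsilon>\<^sup>2 * (\<delta> fst z * \<delta> snd z * (1 - \<epsilon> * h z)) \<partial>\<gamma>)"
    by (intro Bochner_Integration.integral_cong) (auto simp: m_def algebra_simps power2_eq_square)
  also have "\<dots> = (\<integral>z. fst (fst z) * snd (fst z) \<partial>\<gamma>)
      - \<epsilon> * (\<integral>z. h z * (fst (snd z) * snd (snd z) - cst (fst z) (snd z)) \<partial>\<gamma>)
      + \<epsilon>\<^sup>2 * (\<integral>z. \<delta> fst z * \<delta> snd z * (1 - \<epsilon> * h z) \<partial>\<gamma>)"
    unfolding hq key1[symmetric] key2[symmetric] distrib_left
    using xx hxx i1 i4 by simp
  finally have second: "(\<integral>z. (1 - \<epsilon> * h z) * (fst (m z) * snd (m z)) \<partial>\<gamma>) = \<dots>" .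
  have first: "(\<integral>z. \<epsilon> * h z * (fst c * snd c) \<partial>\<gamma>) =
    \<epsilon> * ((\<integral>z. h z * fst (snd z) \<partial>\<gamma>) * (\<integral>z. h z * snd (snd z) \<partial>\<gamma>) / (\<integral>z. h z \<partial>\<gamma>))"
    using H by (simp add: c_def)
  have "(\<integral>z. fst (fst z) * snd (fst z) \<partial>\<zeta>) = (\<integral>w. fst (X w) * snd (X w) \<partial>?\<Omega>)"
    unfolding \<zeta>_def by (subst integral_distr) (use Xm' Ym' in auto)
  also have "\<dots> = (\<integral>z. \<epsilon> * h z * (fst c * snd c) \<partial>\<gamma>) + (\<integral>z. (1 - \<epsilon> * h z) * (fst (m z) * snd (m z)) \<partial>\<gamma>)"
  proof (subst mix_eq)
    have "integrable \<gamma> (\<lambda>z. fst (m z) * snd (m z))"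
      by (intro integrable_mult_L2 L2m fstsnd) measurable
    then show "integrable \<gamma> (\<lambda>z. fst (X (z, False)) * snd (X (z, False)))" by (simp add: X_def)
  qed (measurable, simp_all add: X_def)
  finally have "(\<integral>z. fst (fst z) * snd (fst z) \<partial>\<zeta>) = (\<integral>z. fst (fst z) * snd (fst z) \<partial>\<gamma>)
       + \<epsilon> * ((\<integral>z. h z * fst (snd z) \<partial>\<gamma>) * (\<integral>z. h z * snd (snd z) \<partial>\<gamma>) / (\<integral>z. h z \<partial>\<gamma>)
            - (\<integral>z. h z * (fst (snd z) * snd (snd z) - cst (fst z) (snd z)) \<partial>\<gamma>))
       + \<epsilon>\<^sup>2 * (\<integral>z. \<delta> fst z * \<delta> snd z * (1 - \<epsilon> * h z) \<partial>\<gamma>)"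
    unfolding first second by (simp only: right_diff_distrib)
  moreover have "\<epsilon>\<^sup>2 * - ((4 * R)\<^sup>2) \<le> \<epsilon>\<^sup>2 * (\<integral>z. \<delta> fst z * \<delta> snd z * (1 - \<epsilon> * h z) \<partial>\<gamma>)"
    using rest by (rule mult_left_mono) simp
  ultimately show ?thesis using that[OF \<zeta>] by simp
qed

section \<open>The two-point condition\<close>

text \<open>Were the coefficient of \<open>\<epsilon>\<close> in the variation positive, a small
  \<open>\<epsilon>\<close> would let it beat the quadratic loss, and the varied plan would be
  strictly cheaper.\<close>

lemma (in plan) optimal_first_order:
  fixes h :: "pt \<times> pt \<Rightarrow> real"
  assumes opt: "optimal_plan \<nu> \<gamma>" and hm: "h \<in> borel_measurable borel"
    and h01: "\<And>z. 0 \<le> h z" "\<And>z. h z \<le> 1" and supp: "\<And>z. h z \<noteq> 0 \<Longrightarrow> norm z \<le> R" and R: "0 \<le> R"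
    and H: "0 < (\<integral>z. h z \<partial>\<gamma>)"
  shows "(\<integral>z. h z * fst (snd z) \<partial>\<gamma>) * (\<integral>z. h z * snd (snd z) \<partial>\<gamma>) / (\<integral>z. h z \<partial>\<gamma>)
    \<le> (\<integral>z. h z * (fst (snd z) * snd (snd z) - cst (fst z) (snd z)) \<partial>\<gamma>)" (is "?l \<le> ?r")
proof (rule ccontr)
  assume "\<not> ?l \<le> ?r"
  then have A: "0 < ?l - ?r" by simp
  define C where "C = (4 * R)\<^sup>2"
  have C: "0 \<le> C" by (simp add: C_def)
  \<comment> \<open>Chosen so that \<open>\<epsilon> * C\<close> is smaller than the assumed gain;
    the \<open>+ 1\<close> covers \<open>C = 0\<close>.\<close>
  define \<epsilon> where "\<epsilon> = min (1/2) ((?l - ?r) / (2 * (C + 1)))"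
  have \<epsilon>: "0 < \<epsilon>" using A C unfolding \<epsilon>_def min_less_iff_conj by (intro conjI divide_pos_pos) auto
  have \<epsilon>': "\<epsilon> \<le> 1/2" unfolding \<epsilon>_def by (rule min.cobounded1)
  obtain \<zeta> where \<zeta>: "\<zeta> \<in> Gamma \<nu>" "(\<integral>z. fst (fst z) * snd (fst z) \<partial>\<zeta>) \<ge>
      (\<integral>z. fst (fst z) * snd (fst z) \<partial>\<gamma>) + \<epsilon> * (?l - ?r) - \<epsilon>\<^sup>2 * C"
    by (rule variation[OF hm h01 supp R H \<epsilon> \<epsilon>', folded C_def]) (assumption, rule that)
  interpret Z: plan \<nu> \<zeta> by unfold_locales (rule \<zeta>(1))
  have "total_cost \<gamma> \<le> total_cost \<zeta>" using opt \<zeta>(1) by (simp add: optimal_plan_def)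
  then have "\<epsilon> * (?l - ?r) \<le> \<epsilon> * (\<epsilon> * C)"
    using \<zeta>(2) unfolding total_cost_eq Z.total_cost_eq by (simp add: power2_eq_square mult.assoc)
  then have "?l - ?r \<le> \<epsilon> * C" using \<epsilon> by (simp only: mult_le_cancel_left_pos)
  also have "\<dots> \<le> (?l - ?r) / (2 * (C + 1)) * C" using C by (intro mult_right_mono) (simp_all add: \<epsilon>_def)
  also have "\<dots> < ?l - ?r"
  proof -
    have "(?l - ?r) * C < (?l - ?r) * (2 * (C + 1))" using A C by (intro mult_strict_left_mono) auto
    then show ?thesis using C by (simp add: divide_less_eq)
  qed
  finally show False by simp
qed

lemma ball_average_tendsto:
  fixes M :: "'a::metric_space measure" and f :: "'a \<Rightarrow> real"
  assumes "prob_space M" and s: "sets M = sets borel" and f: "continuous_on UNIV f"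
    and pos: "\<And>n. 0 < measure M (ball z (1 / real (Suc n)))"
  shows "(\<lambda>n. (\<integral>w. indicator (ball z (1 / real (Suc n))) w * f w \<partial>M) / measure M (ball z (1 / real (Suc n)))) \<longlonglongrightarrow> f z"
proof (rule LIMSEQ_I)
  interpret prob_space M by fact
  note [measurable_cong] = s
  have [measurable]: "f \<in> borel_measurable borel" by (rule borel_measurable_continuous_onI[OF f])
  fix r :: real assume r: "0 < r"
  obtain \<delta> where \<delta>: "0 < \<delta>" "\<And>w. dist w z < \<delta> \<Longrightarrow> \<bar>f w - f z\<bar> < r / 2"
    using f r unfolding continuous_on_iff dist_real_def by (metis UNIV_I half_gt_zero)
  obtain N where N: "1 / real (Suc N) < \<delta>" using \<delta>(1) nat_approx_posE by blast
  have "norm ((\<integral>w. indicator (ball z (1 / real (Suc n))) w * f w \<partial>M) / measure M (ball z (1 / real (Suc n))) - f z) < r"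
    if n: "n \<ge> N" for n
  proof -
    define B where "B = ball z (1 / real (Suc n))"
    define b where "b = measure M B"
    have Bm [measurable]: "B \<in> sets borel" by (simp add: B_def)
    have b: "0 < b" using pos[of n] by (simp add: b_def B_def)
    have "1 / real (Suc n) \<le> 1 / real (Suc N)" using n by (simp add: frac_le)
    then have fB: "\<bar>f w - f z\<bar> \<le> r / 2" if "w \<in> B" for w
      using that \<delta>(2)[of w] N by (simp add: B_def dist_commute)
    have bd: "\<bar>indicator B w * (f w - f z)\<bar> \<le> indicator B w * (r / 2)" for w
      using fB[of w] by (auto split: split_indicator)
    have i1: "integrable M (\<lambda>w. indicator B w * (r / 2))" by (simp add: emeasure_eq_measure)
    have i2: "integrable M (\<lambda>w. indicator B w * (f w - f z))"
      by (rule Bochner_Integration.integrable_bound[OF i1]) (use bd r in auto)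
    have i3: "integrable M (\<lambda>w. indicator B w * f z)" by (simp add: emeasure_eq_measure)
    have mB: "(\<integral>w. indicator B w * k \<partial>M) = b * k" for k :: real
      using sets_eq_imp_space_eq[OF s] by (simp add: b_def)
    have "(\<integral>w. indicator B w * f w \<partial>M) = (\<integral>w. indicator B w * (f w - f z) + indicator B w * f z \<partial>M)"
      by (simp add: algebra_simps)
    also have "\<dots> = (\<integral>w. indicator B w * (f w - f z) \<partial>M) + b * f z"
      using i2 i3 by (simp only: Bochner_Integration.integral_add mB)
    finally have eq: "(\<integral>w. indicator B w * f w \<partial>M) / b - f z = (\<integral>w. indicator B w * (f w - f z) \<partial>M) / b"
      using b by (simp add: field_simps)
    have "\<bar>\<integral>w. indicator B w * (f w - f z) \<partial>M\<bar> \<le> (\<integral>w. \<bar>indicator B w * (f w - f z)\<bar> \<partial>M)"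
      by (rule integral_abs_bound)
    also have "\<dots> \<le> b * (r / 2)"
      unfolding mB[symmetric] using i1 i2 bd by (intro integral_mono) auto
    finally have "\<bar>(\<integral>w. indicator B w * (f w - f z) \<partial>M) / b\<bar> \<le> r / 2"
      using b by (simp add: field_simps)
    also have "r / 2 < r" using r by simp
    finally show ?thesis unfolding B_def[symmetric] b_def[symmetric] eq real_norm_def .
  qed
  then show "\<exists>N. \<forall>n\<ge>N. norm ((\<integral>w. indicator (ball z (1 / real (Suc n))) w * f w \<partial>M) / measure M (ball z (1 / real (Suc n))) - f z) < r"
    by blast
qed

text \<open>The weight \<open>h\<close> concentrates on balls around the two points in proportion 1
  - t to t, so its barycentre in y tends to (1 - t) y0 + t y1. The limit of the first-order
  inequality compares the product of the coordinates there with its average, and the defect of this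
  quadratic form is t (1 - t) c(y0, y1).\<close>

lemma (in plan) optimal_imp_two_point:
  assumes opt: "optimal_plan \<nu> \<gamma>" and z: "z0 \<in> msupp \<gamma>" "z1 \<in> msupp \<gamma>" and t: "0 \<le> t" "t \<le> 1"
  shows "(1 - t) * cst (fst z0) (snd z0) + t * cst (fst z1) (snd z1) \<le> t * (1 - t) * cst (snd z0) (snd z1)"
proof -
  define B where "B w n = ball w (1 / real (Suc n))" for w :: "pt \<times> pt" and n
  have Bm [measurable]: "B w n \<in> sets borel" for w n by (simp add: B_def)
  have pos: "0 < measure \<gamma> (B w n)" if "w \<in> msupp \<gamma>" for w n
  proof -
    have "emeasure \<gamma> (B w n) \<noteq> 0"
      unfolding B_def by (rule msupp_emeasure_pos[OF sets_plan that]) auto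
    then show ?thesis by (simp add: emeasure_eq_measure zero_less_measure_iff)
  qed
  define av where "av w n f = (\<integral>z. indicator (B w n) z * f z \<partial>\<gamma>) / measure \<gamma> (B w n)"
    for w n and f :: "pt \<times> pt \<Rightarrow> real"
  define L where "L n f = (1 - t) * av z0 n f + t * av z1 n f" for n f
  have av_lim: "(\<lambda>n. av w n f) \<longlonglongrightarrow> f w" if "w \<in> msupp \<gamma>" "continuous_on UNIV f" for w f
    unfolding av_def B_def
    by (rule ball_average_tendsto[OF prob_space_axioms sets_plan that(2)]) (use pos[OF that(1)] in \<open>simp add: B_def\<close>)
  have L_lim: "(\<lambda>n. L n f) \<longlonglongrightarrow> (1 - t) * f z0 + t * f z1" if "continuous_on UNIV f" for f
    unfolding L_def by (intro tendsto_intros av_lim z that)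
  have ineq: "L n (\<lambda>z. fst (snd z)) * L n (\<lambda>z. snd (snd z)) \<le> L n (\<lambda>z. fst (snd z) * snd (snd z) - cst (fst z) (snd z))" for n
  proof -
    define b0 where "b0 = measure \<gamma> (B z0 n)"
    define b1 where "b1 = measure \<gamma> (B z1 n)"
    have b: "0 < b0" "b0 \<le> 1" "0 < b1" "b1 \<le> 1" using pos z by (auto simp: b0_def b1_def)
    \<comment> \<open>The ball masses may decay at different rates. Cross-multiplying by the mass of
      the other ball gives normalised averages the weights 1 - t and t while keeping
      \<open>h\<close> at most 1, even where the balls overlap.\<close>
    define h where "h w = (1 - t) * b1 * indicator (B z0 n) w + t * b0 * indicator (B z1 n) w" for w
    define R where "R = max (norm z0) (norm z1) + 1"
    have hm: "h \<in> borel_measurable borel" unfolding h_def by measurable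
    have i: "integrable \<gamma> (\<lambda>z. indicator (B w n) z * f z)" if "integrable \<gamma> f" for w and f :: "pt \<times> pt \<Rightarrow> real"
      using integrable_mult_bounded[OF that, of "indicator (B w n)" 1] by (simp add: mult.commute split: split_indicator)
    have hL: "(\<integral>z. h z * f z \<partial>\<gamma>) = b0 * b1 * L n f" if f: "integrable \<gamma> f" for f
    proof -
      have "(\<integral>z. h z * f z \<partial>\<gamma>) = (\<integral>z. (1 - t) * b1 * (indicator (B z0 n) z * f z) + t * b0 * (indicator (B z1 n) z * f z) \<partial>\<gamma>)"
        unfolding h_def by (intro Bochner_Integration.integral_cong) (auto simp: algebra_simps)
      also have "\<dots> = (1 - t) * b1 * (\<integral>z. indicator (B z0 n) z * f z \<partial>\<gamma>) + t * b0 * (\<integral>z. indicator (B z1 n) z * f z \<partial>\<gamma>)"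
        using i[OF f] by simp
      also have "\<dots> = b0 * b1 * L n f"
        using b unfolding L_def av_def b0_def[symmetric] b1_def[symmetric] by (simp add: field_simps)
      finally show ?thesis .
    qed
    have "av w n (\<lambda>_. 1) = 1" if "w \<in> msupp \<gamma>" for w
      using pos[OF that, of n] by (simp add: av_def space_plan)
    then have "L n (\<lambda>_. 1) = 1" using z by (simp add: L_def)
    then have hH: "(\<integral>z. h z \<partial>\<gamma>) = b0 * b1" using hL[of "\<lambda>_. 1"] by simp
    have iy: "integrable \<gamma> (\<lambda>z. fst (snd z))" "integrable \<gamma> (\<lambda>z. snd (snd z))"
      using L2_snd[of fst] L2_snd[of snd] by (auto intro!: square_integrable_imp_integrable)
    have iq: "integrable \<gamma> (\<lambda>z. fst (snd z) * snd (snd z) - cst (fst z) (snd z))"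
      using integrable_products[of fst snd] integrable_products[of snd fst]
      by (simp add: cst_def algebra_simps)
    have "(\<integral>z. h z * fst (snd z) \<partial>\<gamma>) * (\<integral>z. h z * snd (snd z) \<partial>\<gamma>) / (\<integral>z. h z \<partial>\<gamma>)
      \<le> (\<integral>z. h z * (fst (snd z) * snd (snd z) - cst (fst z) (snd z)) \<partial>\<gamma>)"
    proof (rule optimal_first_order[OF opt hm, of R])
      show "0 \<le> h w" for w using t b by (simp add: h_def)
      show "h w \<le> 1" for w
      proof -
        have "(1 - t) * b1 * indicator (B z0 n) w \<le> (1 - t) * 1 * 1"
          using t b by (intro mult_mono) (auto split: split_indicator)
        moreover have "t * b0 * indicator (B z1 n) w \<le> t * 1 * 1"
          using t b by (intro mult_mono) (auto split: split_indicator)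
        ultimately show ?thesis by (simp add: h_def)
      qed
      show "norm w \<le> R" if "h w \<noteq> 0" for w
      proof -
        have "w \<in> B z0 n \<or> w \<in> B z1 n" using that by (auto simp: h_def split: split_indicator_asm)
        then obtain v where v: "v = z0 \<or> v = z1" "dist v w < 1 / real (Suc n)"
          unfolding B_def mem_ball by blast
        have "1 / real (Suc n) \<le> 1" by simp
        then have "dist v w \<le> 1" using v(2) by linarith
        then have "norm (w - v) \<le> 1" by (simp add: dist_norm norm_minus_commute)
        then have "norm w \<le> norm v + 1" using norm_triangle_sub[of w v] by linarith
        then show ?thesis using v(1) by (auto simp: R_def)
      qed
      show "0 \<le> R" by (simp add: R_def le_max_iff_disj add_nonneg_nonneg)
      show "0 < (\<integral>z. h z \<partial>\<gamma>)" using b by (simp add: hH)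
    qed
    then have "b0 * b1 * (L n (\<lambda>z. fst (snd z)) * L n (\<lambda>z. snd (snd z))) \<le>
      b0 * b1 * L n (\<lambda>z. fst (snd z) * snd (snd z) - cst (fst z) (snd z))"
      unfolding hL[OF iy(1)] hL[OF iy(2)] hL[OF iq] hH using b by simp
    then show ?thesis using b by (simp only: mult_le_cancel_left_pos mult_pos_pos)
  qed
  have "((1 - t) * fst (snd z0) + t * fst (snd z1)) * ((1 - t) * snd (snd z0) + t * snd (snd z1)) \<le>
    (1 - t) * (fst (snd z0) * snd (snd z0) - cst (fst z0) (snd z0)) + t * (fst (snd z1) * snd (snd z1) - cst (fst z1) (snd z1))"
  proof (rule LIMSEQ_le)
    show "(\<lambda>n. L n (\<lambda>z. fst (snd z)) * L n (\<lambda>z. snd (snd z))) \<longlonglongrightarrow>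
      ((1 - t) * fst (snd z0) + t * fst (snd z1)) * ((1 - t) * snd (snd z0) + t * snd (snd z1))"
      by (intro tendsto_mult L_lim continuous_intros)
    show "(\<lambda>n. L n (\<lambda>z. fst (snd z) * snd (snd z) - cst (fst z) (snd z))) \<longlonglongrightarrow>
      (1 - t) * (fst (snd z0) * snd (snd z0) - cst (fst z0) (snd z0)) + t * (fst (snd z1) * snd (snd z1) - cst (fst z1) (snd z1))"
      unfolding cst_def by (intro L_lim continuous_intros)
    show "\<exists>N. \<forall>n\<ge>N. L n (\<lambda>z. fst (snd z)) * L n (\<lambda>z. snd (snd z)) \<le> L n (\<lambda>z. fst (snd z) * snd (snd z) - cst (fst z) (snd z))"
      using ineq by blast
  qed
  moreover have "t * (1 - t) * cst (snd z0) (snd z1) =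
    (1 - t) * (fst (snd z0) * snd (snd z0)) + t * (fst (snd z1) * snd (snd z1))
     - ((1 - t) * fst (snd z0) + t * fst (snd z1)) * ((1 - t) * snd (snd z0) + t * snd (snd z1))"
    by (simp add: cst_def algebra_simps)
  ultimately show ?thesis by (simp only: right_diff_distrib)
qed

section \<open>Weak duality\<close>

text \<open>An infimum over an uncountable family of continuous functions is upper semicontinuous:
  its strict sublevel sets are unions of open sets.\<close>

lemma borel_measurable_phi: "phi G \<in> borel_measurable borel"
proof (rule borel_measurableI_less)
  fix a
  have "{y \<in> space borel. phi G y < a} = (\<Union>x\<in>G. {y. ereal (cst x y) < a})"
    by (auto simp: phi_def INF_less_iff)
  moreover have "open {y. ereal (cst x y) < a}" for x
    unfolding cst_def by (intro open_Collect_less continuous_intros)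
  then have "open (\<Union>x\<in>G. {y. ereal (cst x y) < a})" by (intro open_UN ballI)
  ultimately show "{y \<in> space borel. phi G y < a} \<in> sets borel" by (simp only: borel_open)
qed

section \<open>The antidiagonal projection onto a graph, integrated against plans\<close>

context
  fixes f :: "real \<Rightarrow> real"
  assumes lip: "1-lipschitz_on UNIV f"
begin

lemma continuous_graph_proj: "continuous_on UNIV (graph_proj f)"
proof -
  have c: "continuous_on UNIV f" by (rule lipschitz_on_continuous_on[OF lip])
  show ?thesis
    unfolding graph_proj_def by (intro continuous_intros continuous_on_compose2[OF c]) auto
qed

lemma graph_proj_bound:
  assumes "p \<in> {fst, snd}"
  shows "(p (graph_proj f x))\<^sup>2 \<le> 4 * (norm x)\<^sup>2 + 2 * (f 0)\<^sup>2"
proof -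
  define u where "u = fst x + snd x"
  have "\<bar>f u\<bar> \<le> \<bar>f 0\<bar> + \<bar>u\<bar>" using lipschitz_1D[OF lip, of u 0] by simp
  then have "\<bar>p (graph_proj f x)\<bar> \<le> \<bar>u\<bar> + \<bar>f 0\<bar>"
    using assms by (auto simp: graph_proj_def u_def[symmetric])
  then have "(p (graph_proj f x))\<^sup>2 \<le> (\<bar>u\<bar> + \<bar>f 0\<bar>)\<^sup>2"
    using power_mono[of "\<bar>p (graph_proj f x)\<bar>" _ 2] by simp
  also have "\<dots> \<le> 2 * u\<^sup>2 + 2 * (f 0)\<^sup>2"
    using zero_le_power2[of "\<bar>u\<bar> - \<bar>f 0\<bar>"] unfolding power2_sum power2_diff power2_abs by linarith
  also have "u\<^sup>2 \<le> 2 * (norm x)\<^sup>2"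
    using zero_le_power2[of "fst x - snd x"]
    unfolding u_def norm_sq_pt by (simp add: power2_eq_square algebra_simps)
  finally show ?thesis by simp
qed

end

context plan
begin

context
  fixes f :: "real \<Rightarrow> real"
  assumes lip: "1-lipschitz_on UNIV f"
begin

lemma graph_proj_measurable [measurable]: "graph_proj f \<in> borel_measurable borel"
  by (rule borel_measurable_continuous_onI[OF continuous_graph_proj[OF lip]])

lemma L2_graph_proj:
  assumes p: "p \<in> {fst, snd}"
  shows "integrable \<gamma> (\<lambda>z. (p (graph_proj f (fst z)))\<^sup>2)"
proof (rule Bochner_Integration.integrable_bound)
  have [measurable]: "p \<in> borel_measurable borel" using p by auto
  show "integrable \<gamma> (\<lambda>z. 4 * (norm (fst z))\<^sup>2 + 2 * (f 0)\<^sup>2)" using integrable_norm_sq_fst by simp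
  show "(\<lambda>z. (p (graph_proj f (fst z)))\<^sup>2) \<in> borel_measurable \<gamma>" by measurable
  show "AE z in \<gamma>. norm ((p (graph_proj f (fst z)))\<^sup>2) \<le> norm (4 * (norm (fst z))\<^sup>2 + 2 * (f 0)\<^sup>2)"
    using graph_proj_bound[OF lip p] by simp
qed

lemma integrable_cst: "integrable \<gamma> (\<lambda>z. cst (fst z) (snd z))"
  using integrable_products[of fst snd] integrable_products[of snd fst]
  by (simp add: cst_def algebra_simps)

lemma integrable_cst_graph_proj:
  "integrable \<gamma> (\<lambda>z. cst (graph_proj f (fst z)) (fst z))"
  "integrable \<gamma> (\<lambda>z. cst (graph_proj f (fst z)) (snd z))"
proof -
  have i: "integrable \<gamma> (\<lambda>z. p (graph_proj f (fst z)) * q (graph_proj f (fst z)))"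
    "integrable \<gamma> (\<lambda>z. p (graph_proj f (fst z)) * q (fst z))"
    "integrable \<gamma> (\<lambda>z. p (graph_proj f (fst z)) * q (snd z))"
    if pq: "p \<in> {fst, snd}" "q \<in> {fst, snd}" for p q
  proof -
    have [measurable]: "p \<in> borel_measurable borel" "q \<in> borel_measurable borel" using pq by auto
    show "integrable \<gamma> (\<lambda>z. p (graph_proj f (fst z)) * q (graph_proj f (fst z)))"
      "integrable \<gamma> (\<lambda>z. p (graph_proj f (fst z)) * q (fst z))"
      "integrable \<gamma> (\<lambda>z. p (graph_proj f (fst z)) * q (snd z))"
      by (intro integrable_mult_L2 L2_graph_proj L2_fst L2_snd pq; measurable)+
  qed
  show "integrable \<gamma> (\<lambda>z. cst (graph_proj f (fst z)) (fst z))"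
    "integrable \<gamma> (\<lambda>z. cst (graph_proj f (fst z)) (snd z))"
    using i[of fst snd] i[of snd fst] integrable_products[of fst snd]
    by (simp_all add: cst_def right_diff_distrib left_diff_distrib mult.commute[of "fst _" "snd (graph_proj _ _)"])
qed

text \<open>The bilinear form is expanded along p x - y = (p x - x) - (y - x). The mixed terms
  multiply the displacement p x - x, a square integrable function of x, by martingale increments and
  integrate to 0.\<close>

lemma integral_cst_graph_proj:
  "(\<integral>z. cst (graph_proj f (fst z)) (snd z) \<partial>\<gamma>) = total_cost \<gamma> + (\<integral>z. cst (graph_proj f (fst z)) (fst z) \<partial>\<gamma>)"
proof -
  define h where "h p x = p (graph_proj f x) - p x" for p :: "pt \<Rightarrow> real" and x
  have hm: "h p \<in> borel_measurable borel" if "p \<in> {fst, snd}" for p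
    using that unfolding h_def[abs_def] by auto
  have hL2: "integrable \<gamma> (\<lambda>z. (h p (fst z))\<^sup>2)" if p: "p \<in> {fst, snd}" for p
  proof -
    have [measurable]: "p \<in> borel_measurable borel" using p by auto
    have "integrable \<gamma> (\<lambda>z. (p (graph_proj f (fst z)) + - p (fst z))\<^sup>2)"
      by (rule integrable_add_square) (use L2_graph_proj[OF p] L2_fst[OF p] in auto)
    then show ?thesis by (simp add: h_def)
  qed
  have i: "integrable \<gamma> (\<lambda>z. h p (fst z) * (q (snd z) - q (fst z)))"
    and o: "(\<integral>z. h p (fst z) * (q (snd z) - q (fst z)) \<partial>\<gamma>) = 0"
    if "p \<in> {fst, snd}" "q \<in> {fst, snd}" for p q
    using that integrable_increment orthogonal hm hL2 by auto
  have "(\<integral>z. cst (graph_proj f (fst z)) (snd z) \<partial>\<gamma>) = (\<integral>z. cst (fst z) (snd z) + cst (graph_proj f (fst z)) (fst z)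
    - h fst (fst z) * (snd (snd z) - snd (fst z)) - h snd (fst z) * (fst (snd z) - fst (fst z)) \<partial>\<gamma>)"
    by (intro Bochner_Integration.integral_cong) (auto simp: h_def cst_def algebra_simps)
  also have "\<dots> = (\<integral>z. cst (fst z) (snd z) \<partial>\<gamma>) + (\<integral>z. cst (graph_proj f (fst z)) (fst z) \<partial>\<gamma>)"
    using i[of fst snd] i[of snd fst] o[of fst snd] o[of snd fst] integrable_cst integrable_cst_graph_proj(1) by simp
  finally show ?thesis by (simp add: total_cost_def)
qed

lemma integral_cst_graph_proj_le: "(\<integral>z. cst (graph_proj f (fst z)) (snd z) \<partial>\<gamma>) \<le> total_cost \<gamma>"
proof -
  have "(\<integral>z. cst (graph_proj f (fst z)) (fst z) \<partial>\<gamma>) \<le> (\<integral>z. 0 \<partial>\<gamma>)"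
    by (intro integral_mono integrable_cst_graph_proj) (auto simp: cst_graph_proj)
  then show ?thesis unfolding integral_cst_graph_proj by simp
qed

text \<open>Weak duality: \<open>\<integral>\<phi> d\<nu>\<close> bounds the cost of every plan from below, and the cost of \<open>\<gamma>\<close> from above.\<close>

lemma graph_condition_imp_optimal:
  assumes le: "\<And>x y z. (x, y) \<in> msupp \<gamma> \<Longrightarrow> z \<in> lipschitz_graph f \<Longrightarrow> cst x y \<le> cst z y"
  shows "optimal_plan \<nu> \<gamma>"
  unfolding optimal_plan_def
proof (intro conjI in_Gamma ballI)
  fix \<zeta> assume \<zeta>: "\<zeta> \<in> Gamma \<nu>"
  interpret Z: plan \<nu> \<zeta> by unfold_locales (rule \<zeta>)
  define G where "G = lipschitz_graph f"
  define F where "F y = real_of_ereal (phi G y)" for y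
  note [measurable] = borel_measurable_phi
  have Fm [measurable]: "F \<in> borel_measurable borel" unfolding F_def[abs_def] by measurable
  have up: "phi G y \<le> ereal (cst (graph_proj f x) y)" for x y
    unfolding phi_def G_def by (intro INF_lower graph_proj_in)
  have lower: "AE z in \<gamma>. ereal (cst (fst z) (snd z)) \<le> phi G (snd z)"
    using AE_msupp[OF sets_plan] by (rule eventually_mono) (use le in \<open>auto simp: le_phi_iff G_def\<close>)
  \<comment> \<open>At some y the infimum may be minus infinity; on the support it is trapped
    between c(x, y) and c(p x, y).\<close>
  have fin: "AE z in \<gamma>. \<bar>phi G (snd z)\<bar> \<noteq> \<infinity>"
    using lower
  proof (rule eventually_mono)
    fix z assume "ereal (cst (fst z) (snd z)) \<le> phi G (snd z)"
    then show "\<bar>phi G (snd z)\<bar> \<noteq> \<infinity>" using up[of "snd z" "fst z"] by (cases "phi G (snd z)") auto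
  qed
  have F_le: "F y \<le> cst (graph_proj f x) y" if "\<bar>phi G y\<bar> \<noteq> \<infinity>" for x y
    using that up[of y x] unfolding F_def by (cases "phi G y") auto
  have c_le: "AE z in \<gamma>. cst (fst z) (snd z) \<le> F (snd z)"
    using fin lower by eventually_elim (auto simp: F_def)
  have iF: "integrable \<gamma> (\<lambda>z. F (snd z))"
  proof (rule Bochner_Integration.integrable_bound)
    show "integrable \<gamma> (\<lambda>z. \<bar>cst (fst z) (snd z)\<bar> + \<bar>cst (graph_proj f (fst z)) (snd z)\<bar>)"
      using integrable_cst integrable_cst_graph_proj(2) by simp
    show "AE z in \<gamma>. norm (F (snd z)) \<le> norm (\<bar>cst (fst z) (snd z)\<bar> + \<bar>cst (graph_proj f (fst z)) (snd z)\<bar>)"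
      using fin c_le
    proof eventually_elim
      case (elim z)
      then show ?case using F_le[of "snd z" "fst z"] by auto
    qed
  qed measurable
  have iF': "integrable \<zeta> (\<lambda>z. F (snd z))" using iF integrable_snd_iff[OF Fm] Z.integrable_snd_iff[OF Fm] by simp
  \<comment> \<open>Finiteness concerns y alone, so it passes from \<open>\<gamma>\<close> to
    \<open>\<nu>\<close> and from there to every competitor.\<close>
  have "AE y in \<nu>. \<bar>phi G y\<bar> \<noteq> \<infinity>"
    unfolding distr_snd[symmetric] using fin by (subst AE_distr_iff) auto
  then have fin': "AE z in \<zeta>. \<bar>phi G (snd z)\<bar> \<noteq> \<infinity>"
    unfolding Z.distr_snd[symmetric] by (subst (asm) AE_distr_iff) auto
  have "total_cost \<gamma> \<le> (\<integral>z. F (snd z) \<partial>\<gamma>)"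
    unfolding total_cost_def using c_le by (intro integral_mono_AE integrable_cst iF)
  also have "\<dots> = (\<integral>z. F (snd z) \<partial>\<zeta>)" using integral_snd_eq[OF Fm] Z.integral_snd_eq[OF Fm] by simp
  also have "\<dots> \<le> (\<integral>z. cst (graph_proj f (fst z)) (snd z) \<partial>\<zeta>)"
    using fin' by (intro integral_mono_AE iF' Z.integrable_cst_graph_proj(2)[OF lip]) (auto elim!: eventually_mono intro: F_le)
  also have "\<dots> \<le> total_cost \<zeta>" by (rule Z.integral_cst_graph_proj_le[OF lip])
  finally show "total_cost \<gamma> \<le> total_cost \<zeta>" .
qed

text \<open>Applied to the plan itself, the hypothesis at z = p x makes the integral of c(p x, x)
  nonnegative, while the integrand is minus a square. So it vanishes almost everywhere, and its
  zeros are the points of the graph.\<close>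

lemma graph_condition_imp_msupp_fst:
  assumes le: "\<And>x y z. (x, y) \<in> msupp \<gamma> \<Longrightarrow> z \<in> lipschitz_graph f \<Longrightarrow> cst x y \<le> cst z y"
  shows "AE z in \<gamma>. fst z \<in> lipschitz_graph f"
proof -
  have "AE z in \<gamma>. cst (fst z) (snd z) \<le> cst (graph_proj f (fst z)) (snd z)"
    using AE_msupp[OF sets_plan] by (rule eventually_mono) (auto intro!: le graph_proj_in)
  then have "total_cost \<gamma> \<le> (\<integral>z. cst (graph_proj f (fst z)) (snd z) \<partial>\<gamma>)"
    unfolding total_cost_def by (intro integral_mono_AE integrable_cst integrable_cst_graph_proj)
  then have "0 \<le> (\<integral>z. cst (graph_proj f (fst z)) (fst z) \<partial>\<gamma>)" unfolding integral_cst_graph_proj by simp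
  moreover have nn: "0 \<le> - cst (graph_proj f x) x" for x by (simp add: cst_graph_proj)
  moreover have "0 \<le> (\<integral>z. - cst (graph_proj f (fst z)) (fst z) \<partial>\<gamma>)" using nn by (intro Bochner_Integration.integral_nonneg)
  ultimately have "(\<integral>z. - cst (graph_proj f (fst z)) (fst z) \<partial>\<gamma>) = 0" by simp
  then have "AE z in \<gamma>. - cst (graph_proj f (fst z)) (fst z) = 0"
    using nn integrable_cst_graph_proj(1) by (subst (asm) integral_nonneg_eq_0_iff_AE) auto
  then show ?thesis
    by (rule eventually_mono) (simp add: cst_graph_proj lipschitz_graph_def)
qed

end

end

theorem theorem1:
  assumes "P2 \<nu>"
  shows "(\<exists>\<gamma>. optimal_plan \<nu> \<gamma>) \<and>
    (\<forall>\<gamma>\<in>Gamma \<nu>.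
       (optimal_plan \<nu> \<gamma> \<longleftrightarrow>
          (\<forall>x0 y0 x1 y1 t. (x0, y0) \<in> msupp \<gamma> \<and> (x1, y1) \<in> msupp \<gamma> \<and> 0 \<le> t \<and> t \<le> 1 \<longrightarrow>
             (1 - t) * cst x0 y0 + t * cst x1 y1 \<le> t * (1 - t) * cst y0 y1)) \<and>
       (optimal_plan \<nu> \<gamma> \<longleftrightarrow>
          (\<exists>G. maximal_monotone G \<and> (\<forall>x y. (x, y) \<in> msupp \<gamma> \<longrightarrow> ereal (cst x y) \<le> phi G y))) \<and>
       (\<forall>G. maximal_monotone G \<and> (\<forall>x y. (x, y) \<in> msupp \<gamma> \<longrightarrow> ereal (cst x y) \<le> phi G y) \<longrightarrow>
          msupp (distr \<gamma> borel fst) \<subseteq> G \<and>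
          (\<forall>x y. (x, y) \<in> msupp \<gamma> \<longrightarrow>
             ereal (cst x y) = phi G y \<and> (\<exists>z\<in>G. ereal (cst z y) = phi G y))))"
proof (intro conjI exists_optimal_plan[OF assms] ballI)
  fix \<gamma> assume \<gamma>: "\<gamma> \<in> Gamma \<nu>"
  interpret plan \<nu> \<gamma> by unfold_locales (rule \<gamma>)
  let ?b = "\<forall>x0 y0 x1 y1 t. (x0, y0) \<in> msupp \<gamma> \<and> (x1, y1) \<in> msupp \<gamma> \<and> 0 \<le> t \<and> t \<le> 1 \<longrightarrow>
             (1 - t) * cst x0 y0 + t * cst x1 y1 \<le> t * (1 - t) * cst y0 y1"
  let ?C = "\<lambda>G. maximal_monotone G \<and> (\<forall>x y. (x, y) \<in> msupp \<gamma> \<longrightarrow> ereal (cst x y) \<le> phi G y)"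
  have ab: ?b if "optimal_plan \<nu> \<gamma>"
  proof (intro allI impI)
    fix x0 y0 x1 y1 t assume "(x0, y0) \<in> msupp \<gamma> \<and> (x1, y1) \<in> msupp \<gamma> \<and> 0 \<le> t \<and> t \<le> (1::real)"
    then show "(1 - t) * cst x0 y0 + t * cst x1 y1 \<le> t * (1 - t) * cst y0 y1"
      using optimal_imp_two_point[OF that, of "(x0, y0)" "(x1, y1)" t] by simp
  qed
  have bc: "\<exists>G. ?C G" if b: ?b
  proof -
    obtain f where f: "1-lipschitz_on UNIV f"
      "\<And>x y z. (x, y) \<in> msupp \<gamma> \<Longrightarrow> z \<in> lipschitz_graph f \<Longrightarrow> cst x y \<le> cst z y"
      by (rule two_point_condition_imp_graph[of "msupp \<gamma>"]) (use b in blast)+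
    then show ?thesis
      by (intro exI[of _ "lipschitz_graph f"]) (auto simp: maximal_monotone_lipschitz_graph le_phi_iff)
  qed
  have graph: "\<exists>f. 1-lipschitz_on UNIV f \<and> G = lipschitz_graph f \<and>
      (\<forall>x y z. (x, y) \<in> msupp \<gamma> \<longrightarrow> z \<in> lipschitz_graph f \<longrightarrow> cst x y \<le> cst z y)" if C: "?C G" for G
  proof -
    obtain f where "1-lipschitz_on UNIV f" "G = lipschitz_graph f"
      using maximal_monotone_imp_lipschitz_graph C by blast
    then show ?thesis using C by (intro exI[of _ f]) (auto simp: le_phi_iff)
  qed
  have ca: "optimal_plan \<nu> \<gamma>" if C: "?C G" for G
  proof -
    obtain f where f: "1-lipschitz_on UNIV f"
      "\<forall>x y z. (x, y) \<in> msupp \<gamma> \<longrightarrow> z \<in> lipschitz_graph f \<longrightarrow> cst x y \<le> cst z y"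
      using graph[OF C] by blast
    show ?thesis by (rule graph_condition_imp_optimal[OF f(1)]) (use f(2) in blast)
  qed
  show "optimal_plan \<nu> \<gamma> \<longleftrightarrow> ?b" using ab bc ca by blast
  show "optimal_plan \<nu> \<gamma> \<longleftrightarrow> (\<exists>G. ?C G)" using ab bc ca by blast
  show "\<forall>G. ?C G \<longrightarrow> msupp (distr \<gamma> borel fst) \<subseteq> G \<and> (\<forall>x y. (x, y) \<in> msupp \<gamma> \<longrightarrow>
             ereal (cst x y) = phi G y \<and> (\<exists>z\<in>G. ereal (cst z y) = phi G y))"
  proof (intro allI impI)
    fix G assume C: "?C G"
    then obtain f where f: "1-lipschitz_on UNIV f" "G = lipschitz_graph f"
      "\<forall>x y z. (x, y) \<in> msupp \<gamma> \<longrightarrow> z \<in> lipschitz_graph f \<longrightarrow> cst x y \<le> cst z y"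
      using graph[OF C] by blast
    have cl: "closed G" unfolding f(2) by (rule closed_lipschitz_graph[OF f(1)])
    have AE: "AE z in \<gamma>. fst z \<in> G"
      unfolding f(2) by (rule graph_condition_imp_msupp_fst[OF f(1)]) (use f(3) in blast)
    have "AE x in distr \<gamma> borel fst. x \<in> G"
      using AE cl by (subst AE_distr_iff) auto
    then have "msupp (distr \<gamma> borel fst) \<subseteq> G" by (intro msupp_subset cl) auto
    moreover have "closed {z. fst z \<in> G}"
      using closed_vimage[OF cl continuous_on_fst[OF continuous_on_id]] by (simp add: vimage_def)
    \<comment> \<open>Closedness of \<open>G\<close> upgrades the almost sure statement to every
      point of the support. There x itself is a candidate in the infimum, hence a minimiser.\<close>
    then have "msupp \<gamma> \<subseteq> {z. fst z \<in> G}" using AE by (intro msupp_subset sets_plan) auto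
    then have "x \<in> G \<and> ereal (cst x y) = phi G y" if xy: "(x, y) \<in> msupp \<gamma>" for x y
    proof -
      have x: "x \<in> G" using \<open>msupp \<gamma> \<subseteq> {z. fst z \<in> G}\<close> xy by auto
      then have "phi G y \<le> ereal (cst x y)" unfolding phi_def by (rule INF_lower)
      moreover have "ereal (cst x y) \<le> phi G y" using C xy by blast
      ultimately show ?thesis using x by (simp add: antisym)
    qed
    ultimately show "msupp (distr \<gamma> borel fst) \<subseteq> G \<and> (\<forall>x y. (x, y) \<in> msupp \<gamma> \<longrightarrow>
             ereal (cst x y) = phi G y \<and> (\<exists>z\<in>G. ereal (cst z y) = phi G y))"
      by blast
  qed
qed

end
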